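(* Let $n\in\mathbb N$, $d\in[0,1]^n$, and let $Y\in\mathcal D^n$ consist of independent Bernoulli random walks $Y_1,\dots,Y_n$ with drifts $d_1,\dots,d_n$. Let $d^\circ=(d^\circ_1\ge\dots\ge d^\circ_n)$ be the order statistics (decreasing rearrangement) of $d$. Then the law of $WY\in\mathcal D^n$ is nonintersecting Bernoulli walks with drift $d^\circ$; that is, the law of $WY$ is a Bernoulli Gibbs measure, and $\lim_{t\to\infty}WY(t)/t=d^\circ$ almost surely.
   Context: $\mathcal D^n$ is the set of $f=(f_1,\dots,f_n)$ where each $f_i:[0,\infty)\to\mathbb R$ is cadlag, has no negative jumps, and $f_i(0)\ge 0$; by convention $f_i(0^-)=0$. Each $f$ defines a finitely additive signed measure $df$ by $df([x,y]\times\{i\})=f_i(y)-f_i(x^-)$. A path from $(0,n)$ to $(y,1)$, $y\ge0$, is a set $\pi=\bigcup_{i=1}^{n}[t_i,t_{i-1}]\times\{i\}$ with $0=t_n\le t_{n-1}\le\dots\le t_1\le t_0=y$; two paths are essentially disjoint if their intersection is finite. $f[(0,n)^k\to(y,1)^k]=\sup df(\pi_1\cup\dots\cup\pi_k)$ over $k$-tuples of pairwise essentially disjoint paths from $(0,n)$ to $(y,1)$, and equals $0$ for $k=0$. The melon map is $Wf_k(y)=f[(0,n)^k\to(y,1)^k]-f[(0,n)^{k-1}\to(y,1)^{k-1}]$, $k=1,\dots,n$. A Bernoulli path is a continuous function $f$ on $[0,t]$ ($t\in\mathbb N$) or $[0,\infty)$ with $f(0)=0$ that is linear with slope in $\{0,1\}$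 on every interval $[j,j+1]$, $j\in\{0,1,2,\dots\}$. A Bernoulli walk of drift $\delta\in[0,1]$ is a random Bernoulli path on $[0,\infty)$ whose slopes are independent Bernoulli random variables of mean $\delta$. For $t\in\mathbb N$ and $x=(x_1\ge\dots\ge x_n)\in\{0,1,\dots\}^n$, $\nu_t(x)$ is the uniform measure on the (finite) set of $n$-tuples of ordered Bernoulli paths $f=(f_1\ge\dots\ge f_n)$ on $[0,t]$ with $f(0)=0$, $f(t)=x$. A probability measure $\mu$ on $n$-tuples of ordered Bernoulli paths $X=(X_1\ge\dots\ge X_n)$ on $[0,\infty)$ is a Bernoulli Gibbs measure if for every integer $t>0$ the conditional distribution under $\mu$ of $X|_{[0,t]}$ given $X|_{[t,\infty)}$ is $\nu_t(X(t))$. "Nonintersecting Bernoulli walks with drift $e$" (for $e_1\ge\dots\ge e_n$) refers to a Bernoulli Gibbs measure under which $\lim_{t\to\infty}X(t)/t=e$ almost surely. *)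

theory Defs
  imports "HOL-Probability.Probability"
begin

section \<open>The space of cadlag tuples\<close>

text \<open>Functions on a set \<open>I\<close> of times are members of \<^term>\<open>extensional I\<close>, and \<open>n\<close>-tuples of
  them are members of \<^term>\<open>{1..n} \<rightarrow>\<^sub>E extensional I\<close>.\<close>

definition left_lim :: "(real \<Rightarrow> real) \<Rightarrow> real \<Rightarrow> real" where
  "left_lim f x = (if x = 0 then 0 else Lim (at_left x) f)"

definition cadlag :: "(real \<Rightarrow> real) \<Rightarrow> bool" where
  "cadlag f \<longleftrightarrow> (\<forall>x\<ge>0. continuous (at_right x) f) \<and> (\<forall>x>0. \<exists>l. (f \<longlongrightarrow> l) (at_left x))"

definition cadlag_tuples :: "nat \<Rightarrow> (nat \<Rightarrow> real \<Rightarrow> real) set" where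
  "cadlag_tuples n = {f \<in> {1..n} \<rightarrow>\<^sub>E extensional {0..}.
     \<forall>i\<in>{1..n}. cadlag (f i) \<and> (\<forall>x>0. left_lim (f i) x \<le> f i x) \<and> 0 \<le> f i 0}"


section \<open>The finitely additive measure, paths and the melon map\<close>

text \<open>The value of \<open>df\<close> on a finite union \<open>A\<close> of sets \<open>[x,y] \<times> {i}\<close>: each slice of \<open>A\<close> is the
  disjoint union of its finitely many connected components, which are compact intervals
  (possibly single points), and finite additivity gives the sum below;
  see \<open>df_interval\<close> and \<open>df_Un\<close>.\<close>

definition df :: "nat \<Rightarrow> (nat \<Rightarrow> real \<Rightarrow> real) \<Rightarrow> (real \<times> nat) set \<Rightarrow> real" where
  "df n f A = (\<Sum>i\<in>{1..n}. \<Sum>C\<in>components {s. (s, i) \<in> A}. f i (Sup C) - left_lim (f i) (Inf C))"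

definition lattice_paths :: "nat \<Rightarrow> real \<Rightarrow> (real \<times> nat) set set" where
  "lattice_paths n y = {\<Union>i\<in>{1..n}. {t i..t (i - 1)} \<times> {i} | t :: nat \<Rightarrow> real.
     t n = 0 \<and> t 0 = y \<and> (\<forall>i\<in>{1..n}. t i \<le> t (i - 1))}"

definition disjoint_path_tuples :: "nat \<Rightarrow> nat \<Rightarrow> real \<Rightarrow> (nat \<Rightarrow> (real \<times> nat) set) set" where
  "disjoint_path_tuples n k y = {\<pi> \<in> {1..k} \<rightarrow>\<^sub>E lattice_paths n y.
     \<forall>i\<in>{1..k}. \<forall>j\<in>{1..k}. i \<noteq> j \<longrightarrow> finite (\<pi> i \<inter> \<pi> j)}"

definition last_passage :: "nat \<Rightarrow> (nat \<Rightarrow> real \<Rightarrow> real) \<Rightarrow> nat \<Rightarrow> real \<Rightarrow> real" where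
  "last_passage n f k y =
     (if k = 0 then 0 else SUP \<pi>\<in>disjoint_path_tuples n k y. df n f (\<Union>j\<in>{1..k}. \<pi> j))"

definition melon :: "nat \<Rightarrow> (nat \<Rightarrow> real \<Rightarrow> real) \<Rightarrow> nat \<Rightarrow> real \<Rightarrow> real" where
  "melon n f = (\<lambda>k\<in>{1..n}. \<lambda>y\<in>{0..}. last_passage n f k y - last_passage n f (k - 1) y)"


section \<open>Bernoulli paths and Bernoulli walks\<close>

definition bernoulli_paths :: "real set \<Rightarrow> (real \<Rightarrow> real) set" where
  "bernoulli_paths I = {f \<in> extensional I. continuous_on I f \<and> f 0 = 0 \<and>
     (\<forall>j::nat. {real j..real j + 1} \<subseteq> I \<longrightarrow>
        (\<exists>s\<in>{0, 1}. \<forall>x\<in>{real j..real j + 1}. f x = f (real j) + s * (x - real j)))}"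

text \<open>Path spaces carry the sigma-algebra generated by the evaluation maps.\<close>

definition path_space :: "real set \<Rightarrow> (real \<Rightarrow> real) measure" where
  "path_space I = Pi\<^sub>M I (\<lambda>_. borel)"

definition tuple_space :: "nat \<Rightarrow> real set \<Rightarrow> (nat \<Rightarrow> real \<Rightarrow> real) measure" where
  "tuple_space n I = Pi\<^sub>M {1..n} (\<lambda>_. path_space I)"

definition bernoulli_walk :: "'a measure \<Rightarrow> real \<Rightarrow> ('a \<Rightarrow> real \<Rightarrow> real) \<Rightarrow> bool" where
  "bernoulli_walk M \<delta> Z \<longleftrightarrow>
     Z \<in> M \<rightarrow>\<^sub>M restrict_space (path_space {0..}) (bernoulli_paths {0..}) \<and>
     prob_space.indep_vars M (\<lambda>_. borel) (\<lambda>j \<omega>. Z \<omega> (real j + 1) - Z \<omega> (real j)) (UNIV :: nat set) \<and>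
     (\<forall>j::nat. distr M borel (\<lambda>\<omega>. Z \<omega> (real j + 1) - Z \<omega> (real j)) =
        distr (bernoulli_pmf \<delta>) borel (of_bool :: bool \<Rightarrow> real))"


section \<open>Bernoulli Gibbs measures\<close>

definition ordered_bernoulli_tuples :: "nat \<Rightarrow> real set \<Rightarrow> (nat \<Rightarrow> real \<Rightarrow> real) set" where
  "ordered_bernoulli_tuples n I = {f \<in> {1..n} \<rightarrow>\<^sub>E bernoulli_paths I.
     \<forall>i\<in>{1..n}. \<forall>j\<in>{1..n}. i \<le> j \<longrightarrow> (\<forall>s\<in>I. f j s \<le> f i s)}"

definition ordered_bernoulli_space :: "nat \<Rightarrow> (nat \<Rightarrow> real \<Rightarrow> real) measure" where
  "ordered_bernoulli_space n =
     restrict_space (tuple_space n {0..}) (ordered_bernoulli_tuples n {0..})"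

definition bernoulli_bridges :: "nat \<Rightarrow> nat \<Rightarrow> (nat \<Rightarrow> real) \<Rightarrow> (nat \<Rightarrow> real \<Rightarrow> real) set" where
  "bernoulli_bridges n t x =
     {f \<in> ordered_bernoulli_tuples n {0..real t}. \<forall>i\<in>{1..n}. f i (real t) = x i}"

text \<open>\<open>pmf_of_set\<close> is the uniform distribution on finite nonempty sets only. The set of bridges is
  always finite (\<open>finite_bernoulli_bridges\<close>), and it is nonempty for the endpoints \<open>x = X t\<close>
  used below, since it then contains the restriction of \<open>X\<close> to \<open>[0,t]\<close>.\<close>

definition bridge_measure :: "nat \<Rightarrow> nat \<Rightarrow> (nat \<Rightarrow> real) \<Rightarrow> (nat \<Rightarrow> real \<Rightarrow> real) pmf" where
  "bridge_measure n t x = pmf_of_set (bernoulli_bridges n t x)"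

definition restrict_tuple :: "nat \<Rightarrow> real set \<Rightarrow> (nat \<Rightarrow> real \<Rightarrow> real) \<Rightarrow> nat \<Rightarrow> real \<Rightarrow> real" where
  "restrict_tuple n I X = (\<lambda>i\<in>{1..n}. \<lambda>s\<in>I. X i s)"

definition future_algebra :: "nat \<Rightarrow> nat \<Rightarrow> (nat \<Rightarrow> real \<Rightarrow> real) measure" where
  "future_algebra n t = vimage_algebra (ordered_bernoulli_tuples n {0..})
     (restrict_tuple n {real t..}) (tuple_space n {real t..})"

definition bernoulli_gibbs :: "nat \<Rightarrow> (nat \<Rightarrow> real \<Rightarrow> real) measure \<Rightarrow> bool" where
  "bernoulli_gibbs n \<mu> \<longleftrightarrow> prob_space \<mu> \<and> sets \<mu> = sets (ordered_bernoulli_space n) \<and>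
     (\<forall>t>0. \<forall>A\<in>sets (tuple_space n {0..real t}).
        AE X in \<mu>. real_cond_exp \<mu> (future_algebra n t)
            (indicator {X \<in> space \<mu>. restrict_tuple n {0..real t} X \<in> A}) X
          = measure (bridge_measure n t (\<lambda>i. X i (real t))) A)"

definition nonintersecting_bernoulli_walks ::
  "nat \<Rightarrow> (nat \<Rightarrow> real) \<Rightarrow> (nat \<Rightarrow> real \<Rightarrow> real) measure \<Rightarrow> bool" where
  "nonintersecting_bernoulli_walks n e \<mu> \<longleftrightarrow> bernoulli_gibbs n \<mu> \<and>
     (AE X in \<mu>. \<forall>i\<in>{1..n}. ((\<lambda>t. X i t / t) \<longlongrightarrow> e i) at_top)"

definition decreasing_rearrangement :: "nat \<Rightarrow> (nat \<Rightarrow> real) \<Rightarrow> nat \<Rightarrow> real" where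
  "decreasing_rearrangement n d k = rev (sort (map d [1..<Suc n])) ! (k - 1)"


section \<open>Consistency of the definitions\<close>

lemma df_interval:
  assumes "i \<in> {1..n}" "x \<le> y"
  shows "df n f ({x..y} \<times> {i}) = f i y - left_lim (f i) x"
proof -
  have c: "components {x..y} = {{x..y}}"
    using assms by (simp add: components_eq_sing_iff)
  have "df n f ({x..y} \<times> {i}) =
      (\<Sum>j\<in>{1..n}. if j = i then f i y - left_lim (f i) x else 0)"
    unfolding df_def
  proof (intro sum.cong refl)
    fix j
    have *: "{s. (s, j) \<in> {x..y} \<times> {i}} = (if j = i then {x..y} else {})" by auto
    show "(\<Sum>C\<in>components {s. (s, j) \<in> {x..y} \<times> {i}}. f j (Sup C) - left_lim (f j) (Inf C))
        = (if j = i then f i y - left_lim (f i) x else 0)"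
      unfolding * using assms(2) c by simp
  qed
  also have "\<dots> = f i y - left_lim (f i) x" using assms(1) by simp
  finally show ?thesis .
qed

lemma components_Un_disjoint_closed:
  fixes A B :: "real set"
  assumes A: "closed A" and B: "closed B" and AB: "A \<inter> B = {}"
  shows "components (A \<union> B) = components A \<union> components B"
proof -
  have split: "C \<subseteq> A \<or> C \<subseteq> B" if "connected C" "C \<subseteq> A \<union> B" for C
  proof (rule ccontr)
    assume "\<not> (C \<subseteq> A \<or> C \<subseteq> B)"
    then have "A \<inter> C \<noteq> {}" "B \<inter> C \<noteq> {}" "A \<inter> B \<inter> C = {}" using that(2) AB by auto
    then show False using connected_closedD[OF that(1) _ that(2) A B] by blast
  qed
  have sub: "C \<in> components (P \<union> Q)"
    if C: "C \<in> components P" and PQ: "P \<inter> Q = {}"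
      and split: "\<And>C. connected C \<Longrightarrow> C \<subseteq> P \<union> Q \<Longrightarrow> C \<subseteq> P \<or> C \<subseteq> Q" for C P Q :: "real set"
    unfolding in_components_maximal
  proof (intro conjI allI impI)
    have C': "C \<noteq> {}" "C \<subseteq> P" "connected C"
      using C by (auto simp: in_components_maximal)
    then show "C \<noteq> {}" "C \<subseteq> P \<union> Q" "connected C" by auto
    fix D assume D: "D \<noteq> {} \<and> C \<subseteq> D \<and> D \<subseteq> P \<union> Q \<and> connected D"
    then have "D \<subseteq> P" using split[of D] C' PQ by blast
    then show "D = C" using C D by (auto simp: in_components_maximal)
  qed
  show ?thesis
  proof (intro set_eqI iffI)
    fix C assume C: "C \<in> components (A \<union> B)"
    then have ne: "C \<noteq> {}" and con: "connected C" and "C \<subseteq> A \<union> B"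
      by (auto simp: in_components_maximal)
    from split[OF con this(3)] show "C \<in> components A \<union> components B"
    proof
      assume "C \<subseteq> A"
      then have "C \<in> components A"
        by (rule components_intermediate_subset[OF C]) simp
      then show ?thesis by simp
    next
      assume "C \<subseteq> B"
      then have "C \<in> components B"
        by (rule components_intermediate_subset[OF C]) simp
      then show ?thesis by simp
    qed
  next
    fix C assume "C \<in> components A \<union> components B"
    then show "C \<in> components (A \<union> B)"
    proof
      assume "C \<in> components A"
      then show ?thesis by (rule sub) (use AB split in auto)
    next
      assume C: "C \<in> components B"
      have "C \<in> components (B \<union> A)"
      proof (rule sub[OF C])
        show "B \<inter> A = {}" using AB by auto
        show "D \<subseteq> B \<or> D \<subseteq> A" if "connected D" "D \<subseteq> B \<union> A" for D
          using split[of D] that by (auto simp: Un_commute)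
      qed
      then show ?thesis by (simp add: Un_commute)
    qed
  qed
qed

lemma df_Un:
  assumes "A \<inter> B = {}"
    and A: "\<And>i. closed {s. (s, i) \<in> A}" "\<And>i. finite (components {s. (s, i) \<in> A})"
    and B: "\<And>i. closed {s. (s, i) \<in> B}" "\<And>i. finite (components {s. (s, i) \<in> B})"
  shows "df n f (A \<union> B) = df n f A + df n f B"
  unfolding df_def sum.distrib[symmetric]
proof (intro sum.cong refl)
  fix i
  let ?A = "{s. (s, i) \<in> A}" and ?B = "{s. (s, i) \<in> B}"
  let ?g = "\<lambda>C. f i (Sup C) - left_lim (f i) (Inf C)"
  have d: "?A \<inter> ?B = {}" using assms(1) by auto
  have "{s. (s, i) \<in> A \<union> B} = ?A \<union> ?B" by auto
  then have "components {s. (s, i) \<in> A \<union> B} = components ?A \<union> components ?B"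
    using components_Un_disjoint_closed[OF A(1) B(1) d] by simp
  moreover have "components ?A \<inter> components ?B = {}"
    using d in_components_nonempty in_components_subset by blast
  ultimately show "sum ?g (components {s. (s, i) \<in> A \<union> B})
      = sum ?g (components ?A) + sum ?g (components ?B)"
    using A(2) B(2) by (simp add: sum.union_disjoint)
qed

lemma bernoulli_tuple_in_cadlag_tuples:
  assumes "f \<in> {1..n} \<rightarrow>\<^sub>E bernoulli_paths {0..}"
  shows "f \<in> cadlag_tuples n"
proof -
  have "cadlag g \<and> (\<forall>x>0. left_lim g x \<le> g x) \<and> 0 \<le> g 0"
    if g: "g \<in> bernoulli_paths {0..}" for g
  proof -
    have c: "continuous_on {0..} g" and g0: "g 0 = 0"
      using g by (auto simp: bernoulli_paths_def)
    have r: "continuous (at_right x) g" if "x \<ge> 0" for x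
    proof -
      have "continuous (at x within {0..}) g"
        using c that by (simp add: continuous_on_eq_continuous_within)
      then show ?thesis by (rule continuous_within_subset) (use that in auto)
    qed
    have l: "(g \<longlongrightarrow> g x) (at_left x)" if "x > 0" for x
    proof -
      have "x \<in> interior {0..}" using that by simp
      then have "isCont g x" using c continuous_on_interior by blast
      then show ?thesis
        by (simp add: isCont_def filterlim_at_split)
    qed
    have "left_lim g x = g x" if "x > 0" for x
      using l[OF that] that by (auto simp: left_lim_def intro!: tendsto_Lim)
    then show ?thesis using r l g0 by (auto simp: cadlag_def)
  qed
  then show ?thesis
    using assms by (auto simp: cadlag_tuples_def PiE_iff bernoulli_paths_def)
qed

lemma finite_bernoulli_paths: "finite (bernoulli_paths {0..real t})"
proof -
  let ?S = "bernoulli_paths {0..real t}"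
  let ?F = "\<lambda>f. \<lambda>j\<in>{..<t}. f (real j + 1) - f (real j)"
  have step: "\<exists>s\<in>{0,1}. \<forall>x\<in>{real j..real j + 1}. f x = f (real j) + s * (x - real j)"
    if f: "f \<in> ?S" and j: "j < t" for f j
  proof -
    have "{real j..real j + 1} \<subseteq> {0..real t}" using j by auto
    then show ?thesis using f unfolding bernoulli_paths_def by blast
  qed
  have lin: "f x = f (real j) + (f (real j + 1) - f (real j)) * (x - real j)"
    if f: "f \<in> ?S" and j: "j < t" and x: "x \<in> {real j..real j + 1}" for f j x
  proof -
    obtain s where s: "\<forall>x\<in>{real j..real j + 1}. f x = f (real j) + s * (x - real j)"
      using step[OF f j] by blast
    have "f (real j + 1) = f (real j) + s" using bspec[OF s, of "real j + 1"] by simp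
    then show ?thesis using bspec[OF s x] by simp
  qed
  have "?F ` ?S \<subseteq> {..<t} \<rightarrow>\<^sub>E {0,1}"
  proof (clarify, rule PiE_I)
    fix f j assume "f \<in> ?S" "j \<in> {..<t}"
    then obtain s where s: "s \<in> {0,1}"
      "\<forall>x\<in>{real j..real j + 1}. f x = f (real j) + s * (x - real j)"
      using step[of f j] by blast
    have "f (real j + 1) = f (real j) + s" using bspec[OF s(2), of "real j + 1"] by simp
    then show "?F f j \<in> {0,1}" using s(1) \<open>j \<in> {..<t}\<close> by simp
  qed auto
  then have "finite (?F ` ?S)"
    by (rule finite_subset) (auto intro: finite_PiE)
  moreover have "inj_on ?F ?S"
  proof (rule inj_onI)
    fix f g assume f: "f \<in> ?S" and g: "g \<in> ?S" and eq: "?F f = ?F g"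
    have inc: "f (real j + 1) - f (real j) = g (real j + 1) - g (real j)" if "j < t" for j
      using fun_cong[OF eq, of j] that by simp
    have int: "f (real j) = g (real j)" if "j \<le> t" for j
      using that
    proof (induction j)
      case 0 then show ?case using f g by (simp add: bernoulli_paths_def)
    next
      case (Suc j) then show ?case using inc[of j] by (simp add: add.commute)
    qed
    show "f = g"
    proof (rule extensionalityI[of _ "{0..real t}"])
      fix x assume x: "x \<in> {0..real t}"
      show "f x = g x"
      proof (cases "x = real t")
        case True then show ?thesis using int by simp
      next
        case False
        define j where "j = nat \<lfloor>x\<rfloor>"
        have j: "j < t" "x \<in> {real j..real j + 1}"
          using x False unfolding j_def by (auto; linarith)+
        show ?thesis using lin[OF f j] lin[OF g j] inc[of j] int[of j] j by simp
      qed
    qed (use f g in \<open>auto simp: bernoulli_paths_def\<close>)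
  qed
  ultimately show ?thesis by (rule finite_imageD)
qed

lemma finite_bernoulli_bridges: "finite (bernoulli_bridges n t x)"
proof (rule finite_subset)
  show "bernoulli_bridges n t x \<subseteq> {1..n} \<rightarrow>\<^sub>E bernoulli_paths {0..real t}"
    by (auto simp: bernoulli_bridges_def ordered_bernoulli_tuples_def)
  show "finite ({1..n} \<rightarrow>\<^sub>E bernoulli_paths {0..real t})"
    by (intro finite_PiE) (auto intro: finite_bernoulli_paths)
qed

lemma space_ordered_bernoulli_space:
  "space (ordered_bernoulli_space n) = ordered_bernoulli_tuples n {0..}"
proof -
  have "bernoulli_paths {0..} \<subseteq> space (path_space {0..})"
    by (auto simp: path_space_def space_PiM bernoulli_paths_def PiE_def)
  then have "{1..n} \<rightarrow>\<^sub>E bernoulli_paths {0..} \<subseteq> {1..n} \<rightarrow>\<^sub>E space (path_space {0..})"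
    by (rule PiE_mono)
  moreover have "ordered_bernoulli_tuples n {0..} \<subseteq> {1..n} \<rightarrow>\<^sub>E bernoulli_paths {0..}"
    unfolding ordered_bernoulli_tuples_def by (rule Collect_restrict)
  ultimately have "ordered_bernoulli_tuples n {0..} \<subseteq> space (tuple_space n {0..})"
    by (simp only: tuple_space_def space_PiM)
  then show ?thesis
    by (simp only: ordered_bernoulli_space_def space_restrict_space Int_absorb2)
qed

lemma measurable_restrict_tuple:
  assumes "I \<subseteq> {0..}"
  shows "restrict_tuple n I \<in> ordered_bernoulli_space n \<rightarrow>\<^sub>M tuple_space n I"
proof -
  have "(\<lambda>X. X i s) \<in> borel_measurable (tuple_space n {0..})" if "i \<in> {1..n}" "s \<in> I" for i s
  proof -
    have "(\<lambda>X. X i) \<in> tuple_space n {0..} \<rightarrow>\<^sub>M path_space {0..}"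
      unfolding tuple_space_def using that(1) by (rule measurable_component_singleton)
    moreover have "(\<lambda>g. g s) \<in> path_space {0..} \<rightarrow>\<^sub>M borel"
      unfolding path_space_def using that(2) assms by (intro measurable_component_singleton) auto
    ultimately show ?thesis by (rule measurable_compose)
  qed
  then have "restrict_tuple n I \<in> tuple_space n {0..} \<rightarrow>\<^sub>M tuple_space n I"
    unfolding restrict_tuple_def[abs_def] tuple_space_def[of n I] path_space_def[of I]
    by (intro measurable_restrict)
  then show ?thesis
    unfolding ordered_bernoulli_space_def by (rule measurable_restrict_space1)
qed

lemma subalgebra_future_algebra:
  assumes "sets \<mu> = sets (ordered_bernoulli_space n)"
  shows "subalgebra \<mu> (future_algebra n t)"
proof -
  have sp: "space \<mu> = ordered_bernoulli_tuples n {0..}"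
    using sets_eq_imp_space_eq[OF assms] space_ordered_bernoulli_space by simp
  have "restrict_tuple n {real t..} \<in> \<mu> \<rightarrow>\<^sub>M tuple_space n {real t..}"
    using measurable_restrict_tuple[of "{real t..}" n] measurable_cong_sets[OF assms refl] by auto
  then show ?thesis
    unfolding subalgebra_def future_algebra_def
    using sp by (simp add: measurable_iff_sets)
qed

end

theory Submission
  imports Defs "HOL-Real_Asymp.Real_Asymp"
begin

text \<open>A Bernoulli path is encoded by its sequence of slopes. On two lines the melon map is the departure
  process of a queue, and it preserves the two-line last passage value between \<^emph>\<open>any\<close> two times; since \<open>k\<close>
  disjoint paths restricted to two adjacent lines decompose into independent single-path blocks, it
  preserves all multi-path last passage values. Inserting the lines one by one with these two-line maps
  yields ordered lines, for which the optimal \<open>k\<close> paths follow the top \<open>k\<close> lines. Hence the melon is the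
  result of the insertions.

  For the law, insertion of a new line is a bijection onto pairs of an ordered array and an interlacing
  vector of endpoints. By induction on the number of lines, the probability of seeing a given melon on
  \<open>[0,T]\<close> depends only on its endpoint at \<open>T\<close>, which is the Gibbs property. The two-line map replaces the two
  asymptotic slopes by their maximum and minimum, so the insertions sort the drifts.\<close>

section \<open>Queues and disjoint paths on two lines\<close>

text \<open>The supremum in \<open>last_passage\<close> runs over real jump times, while queues live
  on integer times. Slopes are constant on each unit of time, so a union of paths matters only
  through the lengths of its overlaps with the units. Such a length is an average over the unit, and
  the occupation pattern at some single moment does at least as well as the average. This yields
  integer counts at the price of a fractional last weight, which the two-line comparison has to
  carry along. That comparison consists of two inequalities, each of which moves the crossing to an
  idle step of the queue, because a crossing that is good for one pair of lines need not be good for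
  the other. For the law, the obstacle is that the drifts may differ, so arrays with the same melon
  may have different probabilities. It is overcome by conservation: an insertion keeps the total
  number of ascents, so the endpoints before and after it fix the number of ascents of the new line
  and thereby its weight. The Gibbs property conditions on an infinite future. Integer times and
  finite horizons generate it, so uniformity up to every \<open>T\<close> is enough.\<close>

definition ascent :: "(nat \<Rightarrow> bool) \<Rightarrow> nat \<Rightarrow> nat" where
  "ascent x j = (\<Sum>i<j. of_bool (x i))"

lemma ascent_0 [simp]: "ascent x 0 = 0"
  by (simp add: ascent_def)

lemma ascent_Suc [simp]: "ascent x (Suc j) = ascent x j + of_bool (x j)"
  by (simp add: ascent_def)

text \<open>Reading \<open>a\<close> as arrivals and \<open>b\<close> as services of a discrete-time queue, \<open>lower a b\<close> are the departures
  and \<open>upper a b\<close> the arrivals plus the unused services. This is the two-line melon map in terms of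
  slopes: \<open>ascent (upper a b) j\<close> is the maximum over \<open>s \<le> j\<close> of the two-line path values
  \<open>ascent b s + (ascent a j - ascent a s)\<close>. The truncated subtraction on \<^typ>\<open>nat\<close> is the
  reflection of the queue at 0.\<close>

primrec queue :: "(nat \<Rightarrow> bool) \<Rightarrow> (nat \<Rightarrow> bool) \<Rightarrow> nat \<Rightarrow> nat" where
  "queue a b 0 = 0"
| "queue a b (Suc j) = queue a b j + of_bool (a j) - of_bool (b j)"

definition idle :: "(nat \<Rightarrow> bool) \<Rightarrow> (nat \<Rightarrow> bool) \<Rightarrow> nat \<Rightarrow> bool" where
  "idle a b j \<longleftrightarrow> queue a b j = 0 \<and> \<not> a j \<and> b j"

definition upper :: "(nat \<Rightarrow> bool) \<Rightarrow> (nat \<Rightarrow> bool) \<Rightarrow> nat \<Rightarrow> bool" where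
  "upper a b j \<longleftrightarrow> a j \<or> idle a b j"

definition lower :: "(nat \<Rightarrow> bool) \<Rightarrow> (nat \<Rightarrow> bool) \<Rightarrow> nat \<Rightarrow> bool" where
  "lower a b j \<longleftrightarrow> b j \<and> \<not> idle a b j"

lemma queue_Suc: "real (queue a b (Suc j)) = real (queue a b j) + of_bool (a j) - of_bool (lower a b j)"
  by (cases "queue a b j") (auto simp: lower_def idle_def of_nat_diff)

lemma ascent_lower_queue: "ascent a j = ascent (lower a b) j + queue a b j"
proof (induction j)
  case (Suc j)
  then show ?case by (cases "queue a b j") (auto simp: lower_def idle_def)
qed simp

lemma upper_lower:
  "(of_bool (upper a b j) :: 'b :: semiring_1) + of_bool (lower a b j) = of_bool (a j) + of_bool (b j)"
  by (auto simp: upper_def lower_def idle_def)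

lemma ascent_upper_lower: "ascent (upper a b) j + ascent (lower a b) j = ascent a j + ascent b j"
proof (induction j)
  case (Suc j)
  then show ?case using upper_lower[of a b j, where 'b = nat] by simp
qed simp

text \<open>Arrivals minus departures telescope to the queue length; the only step whose weight may
  differ from 1 is the last one, which is split off.\<close>

lemma weighted_queue:
  assumes "s < c" "\<And>i. Suc i < c \<Longrightarrow> w i = 1"
  shows "(\<Sum>j\<in>{s..<c}. w j * (of_bool (a j) - of_bool (lower a b j))) =
    queue a b (c - 1) - real (queue a b s) + w (c - 1) * (queue a b c - real (queue a b (c - 1)))"
proof -
  obtain c' where c: "c = Suc c'" "s \<le> c'" using assms(1) by (cases c) auto
  have "(\<Sum>j\<in>{s..<c'}. w j * (of_bool (a j) - of_bool (lower a b j))) =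
    (\<Sum>j\<in>{s..<c'}. real (queue a b (Suc j)) - queue a b j)"
    using assms(2) c by (intro sum.cong) (auto simp: queue_Suc simp del: queue.simps)
  also have "\<dots> = real (queue a b c') - queue a b s"
    using c(2) by (rule sum_Suc_diff')
  finally show ?thesis using c by (simp add: queue_Suc del: queue.simps)
qed

lemma two_line_expand:
  assumes w: "\<And>i. Suc i < T \<Longrightarrow> w i = 1" "\<And>i. 0 \<le> w i" "\<And>i. w i \<le> (1::real)"
    and abc: "p \<le> c" "c \<le> q" "q \<le> T"
  shows "\<exists>c'\<in>{p..q}.
     (\<Sum>j\<in>{p..<c}. w j * of_bool (b j)) + (\<Sum>j\<in>{c..<q}. w j * of_bool (a j)) \<le>
     (\<Sum>j\<in>{p..<c'}. w j * of_bool (lower a b j)) + (\<Sum>j\<in>{c'..<q}. w j * of_bool (upper a b j))"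
proof (cases "\<exists>s. s \<in> {p..<c} \<and> idle a b s")
  case False
  have "(\<Sum>j\<in>{p..<c}. w j * of_bool (b j)) = (\<Sum>j\<in>{p..<c}. w j * of_bool (lower a b j))"
    using False by (intro sum.cong) (auto simp: lower_def)
  moreover have "(\<Sum>j\<in>{c..<q}. w j * of_bool (a j)) \<le> (\<Sum>j\<in>{c..<q}. w j * of_bool (upper a b j))"
    by (intro sum_mono mult_left_mono w) (auto simp: upper_def)
  ultimately show ?thesis using abc by (intro bexI[of _ c]) auto
next
  case True
  define s where "s = (LEAST s. s \<in> {p..<c} \<and> idle a b s)"
  have s: "s \<in> {p..<c}" "idle a b s" using LeastI_ex[OF True] by (auto simp: s_def)
  have pre: "\<not> idle a b j" if "j \<in> {p..<s}" for j
    using not_less_Least[of j "\<lambda>s. s \<in> {p..<c} \<and> idle a b s"] that s by (auto simp: s_def)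
  have 1: "(\<Sum>j\<in>{p..<s}. w j * of_bool (b j)) = (\<Sum>j\<in>{p..<s}. w j * of_bool (lower a b j))"
    using pre by (intro sum.cong) (auto simp: lower_def)
  have 2: "(\<Sum>j\<in>{c..<q}. w j * of_bool (a j)) \<le> (\<Sum>j\<in>{c..<q}. w j * of_bool (upper a b j))"
    by (intro sum_mono mult_left_mono w) (auto simp: upper_def)
  have q0: "queue a b s = 0" using s by (simp add: idle_def)
  \<comment> \<open>The fractional last weight turns the final queue length into a convex
    combination of the lengths at \<open>c - 1\<close> and at \<open>c\<close>.\<close>
  have "0 \<le> (1 - w (c - 1)) * queue a b (c - 1) + w (c - 1) * queue a b c"
    using w by simp
  also have "\<dots> = (\<Sum>j\<in>{s..<c}. w j * (of_bool (a j) - of_bool (lower a b j)))"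
    using s abc by (subst weighted_queue) (auto simp: q0 algebra_simps w)
  also have "\<dots> = (\<Sum>j\<in>{s..<c}. w j * of_bool (upper a b j)) - (\<Sum>j\<in>{s..<c}. w j * of_bool (b j))"
    unfolding sum_subtractf[symmetric]
  proof (intro sum.cong refl)
    fix j
    show "w j * (of_bool (a j) - of_bool (lower a b j)) = w j * of_bool (upper a b j) - w j * of_bool (b j)"
      unfolding right_diff_distrib[symmetric] using upper_lower[of a b j, where 'b = real]
        by (intro arg_cong[where f = "(*) (w j)"]) linarith
  qed
  finally have 3: "(\<Sum>j\<in>{s..<c}. w j * of_bool (b j)) \<le> (\<Sum>j\<in>{s..<c}. w j * of_bool (upper a b j))" by simp
  have "(\<Sum>j\<in>{p..<c}. w j * of_bool (b j)) = (\<Sum>j\<in>{p..<s}. w j * of_bool (b j)) + (\<Sum>j\<in>{s..<c}. w j * of_bool (b j))"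
    using s by (intro sum.atLeastLessThan_concat[symmetric]) auto
  moreover have "(\<Sum>j\<in>{s..<q}. w j * of_bool (upper a b j)) = (\<Sum>j\<in>{s..<c}. w j * of_bool (upper a b j)) + (\<Sum>j\<in>{c..<q}. w j * of_bool (upper a b j))"
    using s abc by (intro sum.atLeastLessThan_concat[symmetric]) auto
  ultimately show ?thesis using 1 2 3 s abc by (intro bexI[of _ s]) auto
qed

lemma two_line_contract:
  assumes w: "\<And>i. Suc i < T \<Longrightarrow> w i = 1" "\<And>i. 0 \<le> w i" "\<And>i. w i \<le> (1::real)"
    and abc: "p \<le> c" "c \<le> q" "q \<le> T"
  shows "\<exists>c'\<in>{p..q}.
     (\<Sum>j\<in>{p..<c}. w j * of_bool (lower a b j)) + (\<Sum>j\<in>{c..<q}. w j * of_bool (upper a b j)) \<le>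
     (\<Sum>j\<in>{p..<c'}. w j * of_bool (b j)) + (\<Sum>j\<in>{c'..<q}. w j * of_bool (a j))"
proof -
  have 1: "(\<Sum>j\<in>{p..<c}. w j * of_bool (lower a b j)) \<le> (\<Sum>j\<in>{p..<c}. w j * of_bool (b j))"
    by (intro sum_mono mult_left_mono w) (auto simp: lower_def)
  show ?thesis
  proof (cases "\<exists>s. s \<in> {c..<q} \<and> idle a b s")
    case False
    have "(\<Sum>j\<in>{c..<q}. w j * of_bool (upper a b j)) = (\<Sum>j\<in>{c..<q}. w j * of_bool (a j))"
      using False by (intro sum.cong) (auto simp: upper_def)
    then show ?thesis using 1 abc by (intro bexI[of _ c]) auto
  next
    case True
    define r where "r = Max {s. s \<in> {c..<q} \<and> idle a b s}"
    have fin: "finite {s. s \<in> {c..<q} \<and> idle a b s}" by simp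
    have "r \<in> {s. s \<in> {c..<q} \<and> idle a b s}" unfolding r_def using True by (intro Max_in[OF fin]) auto
    then have r: "r \<in> {c..<q}" "idle a b r" by auto
    have post: "\<not> idle a b j" if "j \<in> {Suc r..<q}" for j
      using Max_ge[OF fin, of j] that r(1) unfolding r_def[symmetric] by auto
    have 2: "(\<Sum>j\<in>{Suc r..<q}. w j * of_bool (upper a b j)) = (\<Sum>j\<in>{Suc r..<q}. w j * of_bool (a j))"
      using post by (intro sum.cong) (auto simp: upper_def)
    have q0: "queue a b r = 0" "queue a b (Suc r) = 0" using r by (auto simp: idle_def)
    have "(\<Sum>j\<in>{c..<Suc r}. w j * of_bool (upper a b j)) - (\<Sum>j\<in>{c..<Suc r}. w j * of_bool (b j)) =
       (\<Sum>j\<in>{c..<Suc r}. w j * (of_bool (a j) - of_bool (lower a b j)))"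
      unfolding sum_subtractf[symmetric]
    proof (intro sum.cong refl)
      fix j
      show "w j * of_bool (upper a b j) - w j * of_bool (b j) = w j * (of_bool (a j) - of_bool (lower a b j))"
        unfolding right_diff_distrib[symmetric] using upper_lower[of a b j, where 'b = real]
        by (intro arg_cong[where f = "(*) (w j)"]) linarith
    qed
    \<comment> \<open>The queue is empty before and after step \<open>r\<close>, so the last weight
      multiplies 0 and minus the queue length at \<open>c\<close> remains.\<close>
    also have "\<dots> \<le> 0" using r abc w by (subst weighted_queue) (auto simp: q0 simp del: queue.simps)
    finally have 3: "(\<Sum>j\<in>{c..<Suc r}. w j * of_bool (upper a b j)) \<le> (\<Sum>j\<in>{c..<Suc r}. w j * of_bool (b j))" by simp
    have "(\<Sum>j\<in>{p..<Suc r}. w j * of_bool (b j)) = (\<Sum>j\<in>{p..<c}. w j * of_bool (b j)) + (\<Sum>j\<in>{c..<Suc r}. w j * of_bool (b j))"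
      using r abc by (intro sum.atLeastLessThan_concat[symmetric]) auto
    moreover have "(\<Sum>j\<in>{c..<q}. w j * of_bool (upper a b j)) = (\<Sum>j\<in>{c..<Suc r}. w j * of_bool (upper a b j)) + (\<Sum>j\<in>{Suc r..<q}. w j * of_bool (upper a b j))"
      using r abc by (intro sum.atLeastLessThan_concat[symmetric]) auto
    ultimately show ?thesis using 1 2 3 r abc by (intro bexI[of _ "Suc r"]) auto
  qed
qed

text \<open>A tuple of \<open>k\<close> disjoint paths on \<open>n\<close> lines is recorded by the number \<open>N l j\<close> of paths that are on one of the
  lines \<open>1..l\<close> in the \<open>j\<close>-th unit of time. The weight \<open>w j\<close> is the part of that unit which lies before the
  endpoint \<open>y\<close>, so only the last weight can differ from 1.\<close>

definition config :: "nat \<Rightarrow> nat \<Rightarrow> nat \<Rightarrow> (nat \<Rightarrow> nat \<Rightarrow> nat) \<Rightarrow> bool" where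
  "config n k T N \<longleftrightarrow>
     (\<forall>j<T. N 0 j = 0 \<and> N n j = k \<and> (\<forall>l<n. N l j \<le> N (Suc l) j \<and> N (Suc l) j \<le> Suc (N l j))) \<and>
     (\<forall>l\<le>n. \<forall>j<T. \<forall>i\<le>j. N l i \<le> N l j)"

definition gain :: "nat \<Rightarrow> nat \<Rightarrow> (nat \<Rightarrow> real) \<Rightarrow> (nat \<Rightarrow> nat \<Rightarrow> bool) \<Rightarrow> (nat \<Rightarrow> nat \<Rightarrow> nat) \<Rightarrow> real" where
  "gain n T w x N =
     (\<Sum>j<T. w j * (\<Sum>l<n. of_bool (x (Suc l) j) * (real (N (Suc l) j) - real (N l j))))"

lemma convex_nat_interval:
  fixes S :: "nat set"
  assumes "S \<subseteq> {..<T}" and conv: "\<And>i j l. i \<in> S \<Longrightarrow> l \<in> S \<Longrightarrow> i \<le> j \<Longrightarrow> j \<le> l \<Longrightarrow> j \<in> S"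
  shows "\<exists>p q. S = {p..<q} \<and> p \<le> q \<and> q \<le> T"
proof (cases "S = {}")
  case True
  then show ?thesis by (intro exI[of _ 0]) auto
next
  case False
  have fin: "finite S" using assms(1) finite_subset by blast
  have "S = {Min S..<Suc (Max S)}"
    using conv[OF Min_in[OF fin False] Max_in[OF fin False]] Min_le[OF fin] Max_ge[OF fin]
    by (auto simp: less_Suc_eq_le)
  moreover have "Min S \<le> Max S" using fin False by simp
  moreover have "Max S < T" using assms(1) Max_in[OF fin False] by auto
  ultimately show ?thesis by (intro exI[of _ "Min S"] exI[of _ "Suc (Max S)"]) auto
qed

lemma sum_split_interval:
  fixes c :: nat
  assumes "p \<le> c" "c \<le> q"
  shows "(\<Sum>j\<in>{p..<q}. w j * of_bool (if j < c then b j else a j)) =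
    (\<Sum>j\<in>{p..<c}. w j * of_bool (b j)) + (\<Sum>j\<in>{c..<q}. (w j :: real) * of_bool (a j))"
  unfolding sum.atLeastLessThan_concat[OF assms, symmetric] by (intro arg_cong2[where f = "(+)"] sum.cong) auto

text \<open>Where exactly one of the two lines is occupied, and the numbers of paths above and below are
  constant, the configuration restricted to these lines is one path that moves up once.\<close>

lemma gain_exchange:
  assumes i: "Suc i < n" and cfg: "config n k T N"
    and other: "\<And>l. l \<noteq> Suc i \<Longrightarrow> l \<noteq> Suc (Suc i) \<Longrightarrow> x' l = x l"
    and tot: "\<And>j. (of_bool (x' (Suc i) j) :: real) + of_bool (x' (Suc (Suc i)) j) =
       of_bool (x (Suc i) j) + of_bool (x (Suc (Suc i)) j)"
    and two: "\<And>p c q. p \<le> c \<Longrightarrow> c \<le> q \<Longrightarrow> q \<le> T \<Longrightarrow> \<exists>c'\<in>{p..q}.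
       (\<Sum>j\<in>{p..<c}. w j * of_bool (x (Suc (Suc i)) j)) + (\<Sum>j\<in>{c..<q}. w j * of_bool (x (Suc i) j)) \<le>
       (\<Sum>j\<in>{p..<c'}. w j * of_bool (x' (Suc (Suc i)) j)) + (\<Sum>j\<in>{c'..<q}. w j * of_bool (x' (Suc i) j))"
  shows "\<exists>N'. config n k T N' \<and> gain n T w x N \<le> gain n T w x' N'"
proof -
  define u where "u = N i"
  define v where "v = N (Suc (Suc i))"
  define m where "m = N (Suc i)"
  have umv: "u j \<le> m j" "m j \<le> v j" "m j \<le> Suc (u j)" "v j \<le> Suc (m j)" if "j < T" for j
    using cfg i that Suc_lessD[OF i] unfolding config_def u_def v_def m_def by blast+
  have mono: "u j \<le> u j'" "v j \<le> v j'" "m j \<le> m j'" if "j \<le> j'" "j' < T" for j j'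
    using cfg i that Suc_lessD[OF i] unfolding config_def u_def v_def m_def by auto
  \<comment> \<open>Outside \<open>S\<close> both lines are occupied or both are free, and then only
    the sum of the two slopes counts, which \<open>tot\<close> preserves.\<close>
  define S where "S = {j. j < T \<and> v j = Suc (u j)}"
  \<comment> \<open>A block fixes the number \<open>r\<close> of paths above the two lines;
    monotonicity of \<open>u\<close> and \<open>v\<close> in time makes it an interval.\<close>
  define J where "J r = {j\<in>S. u j = r}" for r
  have "\<exists>p q. J r = {p..<q} \<and> p \<le> q \<and> q \<le> T" for r
  proof (rule convex_nat_interval)
    show "J r \<subseteq> {..<T}" by (auto simp: J_def S_def)
    fix j1 j j2 assume *: "j1 \<in> J r" "j2 \<in> J r" "j1 \<le> j" "j \<le> j2"
    then have "j2 < T" "u j1 = r" "u j2 = r" "v j1 = Suc r" "v j2 = Suc r" by (auto simp: J_def S_def)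
    with * mono[of j1 j] mono[of j j2] have "u j = r" "v j = Suc r" "j < T" by auto
    then show "j \<in> J r" by (simp add: J_def S_def)
  qed
  then obtain p q where pq: "\<And>r. J r = {p r..<q r}" "\<And>r. p r \<le> q r" "\<And>r. q r \<le> T" by metis
  have "\<exists>c. p r \<le> c \<and> c \<le> q r \<and> (\<forall>j\<in>J r. m j = (if j < c then r else Suc r))" for r
  proof -
    \<comment> \<open>If the path never moves up inside the block, the end \<open>q r\<close> serves
      as its crossing time.\<close>
    define c where "c = (LEAST c. p r \<le> c \<and> (c = q r \<or> (c < q r \<and> m c = Suc r)))"
    have ex: "\<exists>c. p r \<le> c \<and> (c = q r \<or> (c < q r \<and> m c = Suc r))" using pq(2) by auto
    have c: "p r \<le> c" "c = q r \<or> (c < q r \<and> m c = Suc r)" using LeastI_ex[OF ex] by (auto simp: c_def)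
    have "m j = (if j < c then r else Suc r)" if j: "j \<in> J r" for j
    proof -
      have "j \<in> {p r..<q r}" using j pq(1)[of r] by simp
      then have j': "j < T" "u j = r" "v j = Suc r" "p r \<le> j" "j < q r" using j by (auto simp: J_def S_def)
      then have mj: "m j \<in> {r, Suc r}" using umv[of j] by auto
      show ?thesis
      proof (cases "j < c")
        case True
        then show ?thesis using not_less_Least[of j "\<lambda>c. p r \<le> c \<and> (c = q r \<or> (c < q r \<and> m c = Suc r))"] j' mj
          by (auto simp: c_def)
      next
        case False
        then have "m c = Suc r" using c j' by auto
        then show ?thesis using False mono(3)[of c j] j' mj by auto
      qed
    qed
    then show ?thesis using c by auto
  qed
  then obtain c where c: "\<And>r. p r \<le> c r" "\<And>r. c r \<le> q r"
    "\<And>r j. j \<in> J r \<Longrightarrow> m j = (if j < c r then r else Suc r)" by metis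
  have "\<forall>r. \<exists>c'. c' \<in> {p r..q r} \<and>
       (\<Sum>j\<in>{p r..<c r}. w j * of_bool (x (Suc (Suc i)) j)) + (\<Sum>j\<in>{c r..<q r}. w j * of_bool (x (Suc i) j)) \<le>
       (\<Sum>j\<in>{p r..<c'}. w j * of_bool (x' (Suc (Suc i)) j)) + (\<Sum>j\<in>{c'..<q r}. w j * of_bool (x' (Suc i) j))"
    using two[OF c(1,2) pq(3)] unfolding Bex_def by (intro allI)
  from choice[OF this] obtain c' where c': "\<And>r. c' r \<in> {p r..q r}"
       "\<And>r. (\<Sum>j\<in>{p r..<c r}. w j * of_bool (x (Suc (Suc i)) j)) + (\<Sum>j\<in>{c r..<q r}. w j * of_bool (x (Suc i) j)) \<le>
       (\<Sum>j\<in>{p r..<c' r}. w j * of_bool (x' (Suc (Suc i)) j)) + (\<Sum>j\<in>{c' r..<q r}. w j * of_bool (x' (Suc i) j))"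
    by blast
  define m' where "m' j = (if v j = Suc (u j) then (if j < c' (u j) then u j else Suc (u j)) else m j)" for j
  define N' where "N' = N(Suc i := m')"
  have m'b: "u j \<le> m' j" "m' j \<le> v j" "m' j \<le> Suc (u j)" "v j \<le> Suc (m' j)" if "j < T" for j
    using umv[OF that] by (auto simp: m'_def)
  have m'mono: "m' j \<le> m' j'" if "j \<le> j'" "j' < T" for j j'
  proof -
    have *: "u j \<le> u j'" "v j \<le> v j'" "m j \<le> m j'" using mono[OF that] by auto
    have **: "u j \<le> m j" "m j \<le> v j" "m j \<le> Suc (u j)" "v j \<le> Suc (m j)"
      "u j' \<le> m j'" "m j' \<le> v j'" "m j' \<le> Suc (u j')" "v j' \<le> Suc (m j')"
      using umv[of j] umv[of j'] that by auto
    show ?thesis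
    \<comment> \<open>Crossing times chosen in different blocks cannot conflict: once
      \<open>u\<close> has grown,
      \<open>m' j \<le> Suc (u j) \<le> u j' \<le> m' j'\<close>.\<close>
    proof (cases "u j = u j'")
      case True
      then show ?thesis using * ** that unfolding m'_def by auto
    next
      case False
      then show ?thesis using * ** that unfolding m'_def by auto
    qed
  qed
  have cfg': "config n k T N'"
    unfolding config_def
  proof (intro conjI allI impI)
    fix j assume j: "j < T"
    show "N' 0 j = 0" "N' n j = k" using cfg i j by (auto simp: N'_def config_def)
    fix l assume l: "l < n"
    have N: "N l j \<le> N (Suc l) j" "N (Suc l) j \<le> Suc (N l j)" using cfg j l by (auto simp: config_def)
    show "N' l j \<le> N' (Suc l) j"
      using N m'b[OF j] by (auto simp: N'_def u_def v_def)
    show "N' (Suc l) j \<le> Suc (N' l j)"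
      using N m'b[OF j] by (auto simp: N'_def u_def v_def)
  next
    fix l j i' assume "l \<le> n" "j < T" "i' \<le> j"
    then show "N' l i' \<le> N' l j" using cfg m'mono by (auto simp: N'_def config_def)
  qed
  define \<phi> where "\<phi> j = of_bool (x (Suc i) j) * (real (m j) - u j) + of_bool (x (Suc (Suc i)) j) * (real (v j) - m j)" for j
  define \<phi>' where "\<phi>' j = of_bool (x' (Suc i) j) * (real (m' j) - u j) + of_bool (x' (Suc (Suc i)) j) * (real (v j) - m' j)" for j
  let ?R = "{..<n} - {i, Suc i}"
  define \<rho> where "\<rho> j = (\<Sum>l\<in>?R. of_bool (x (Suc l) j) * (real (N (Suc l) j) - real (N l j)))" for j
  have split: "(\<Sum>l<n. f l) = f i + f (Suc i) + (\<Sum>l\<in>?R. f l)" for f :: "nat \<Rightarrow> real"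
  proof -
    have "{..<n} = insert i (insert (Suc i) ?R)" using i by auto
    then have "(\<Sum>l<n. f l) = sum f (insert i (insert (Suc i) ?R))" by simp
    also have "\<dots> = f i + f (Suc i) + (\<Sum>l\<in>?R. f l)" by (subst sum.insert; simp)
    finally show ?thesis .
  qed
  have g: "gain n T w x N = (\<Sum>j<T. w j * \<phi> j) + (\<Sum>j<T. w j * \<rho> j)"
    unfolding gain_def split by (simp add: \<phi>_def \<rho>_def u_def v_def m_def distrib_left sum.distrib)
  have \<rho>': "(\<Sum>l\<in>?R. of_bool (x' (Suc l) j) * (real (N' (Suc l) j) - real (N' l j))) = \<rho> j" for j
    unfolding \<rho>_def by (intro sum.cong) (auto simp: N'_def other)
  have g': "gain n T w x' N' = (\<Sum>j<T. w j * \<phi>' j) + (\<Sum>j<T. w j * \<rho> j)"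
    unfolding gain_def split \<rho>' by (simp add: \<phi>'_def \<rho>_def u_def v_def m_def N'_def distrib_left sum.distrib)
  have S: "S \<subseteq> {..<T}" "finite S" by (auto simp: S_def)
  have eq: "\<phi> j = \<phi>' j" if "j \<in> {..<T} - S" for j
  proof -
    have "v j \<noteq> Suc (u j)" "j < T" using that by (auto simp: S_def)
    then have "m' j = m j" "(m j = u j \<and> v j = u j) \<or> (m j = Suc (u j) \<and> v j = Suc (m j))"
      using umv[of j] by (auto simp: m'_def)
    then show ?thesis using tot[of j] by (auto simp: \<phi>_def \<phi>'_def)
  qed
  have decomp: "(\<Sum>j<T. w j * h j) = (\<Sum>j\<in>{..<T} - S. w j * h j) + (\<Sum>r\<in>u ` S. \<Sum>j\<in>{p r..<q r}. w j * h j)"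
    for h :: "nat \<Rightarrow> real"
  proof -
    have "(\<Sum>j<T. w j * h j) = (\<Sum>j\<in>{..<T} - S. w j * h j) + (\<Sum>j\<in>S. w j * h j)"
      using S by (simp add: sum.subset_diff)
    also have "(\<Sum>j\<in>S. w j * h j) = (\<Sum>r\<in>u ` S. \<Sum>j\<in>J r. w j * h j)"
      unfolding J_def by (rule sum.image_gen[OF S(2)])
    finally show ?thesis by (simp add: pq)
  qed
  have "(\<Sum>j\<in>{p r..<q r}. w j * \<phi> j) \<le> (\<Sum>j\<in>{p r..<q r}. w j * \<phi>' j)" for r
  proof -
    have in_J: "u j = r" "v j = Suc r" "m j = (if j < c r then r else Suc r)" "m' j = (if j < c' r then r else Suc r)"
      if "j \<in> {p r..<q r}" for j
      using that c(3)[of j r] unfolding pq(1)[symmetric] by (auto simp: J_def S_def m'_def)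
    have "(\<Sum>j\<in>{p r..<q r}. w j * \<phi> j) =
       (\<Sum>j\<in>{p r..<q r}. w j * of_bool (if j < c r then x (Suc (Suc i)) j else x (Suc i) j))"
      using in_J by (intro sum.cong) (auto simp: \<phi>_def)
    moreover have "(\<Sum>j\<in>{p r..<q r}. w j * \<phi>' j) =
       (\<Sum>j\<in>{p r..<q r}. w j * of_bool (if j < c' r then x' (Suc (Suc i)) j else x' (Suc i) j))"
      using in_J by (intro sum.cong) (auto simp: \<phi>'_def)
    ultimately show ?thesis
      using c'(2)[of r] sum_split_interval[OF c(1,2)[of r]] sum_split_interval[of "p r" "c' r" "q r"] c'(1)[of r]
      by (simp only: atLeastAtMost_iff)
  qed
  then have "(\<Sum>j<T. w j * \<phi> j) \<le> (\<Sum>j<T. w j * \<phi>' j)"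
    unfolding decomp using eq by (simp add: sum_mono)
  then show ?thesis using cfg' g g' by auto
qed

section \<open>The melon map on slopes\<close>

definition pitman :: "nat \<Rightarrow> (nat \<Rightarrow> nat \<Rightarrow> bool) \<Rightarrow> nat \<Rightarrow> nat \<Rightarrow> bool" where
  "pitman i u = u(i := upper (u i) (u (Suc i)), Suc i := lower (u i) (u (Suc i)))"

text \<open>Lines are numbered from 1, so \<open>bubble m\<close> acts on the lines \<open>1..m + 1\<close> and \<open>slope_melon m\<close> on \<open>1..m\<close>.\<close>

primrec bubble :: "nat \<Rightarrow> (nat \<Rightarrow> nat \<Rightarrow> bool) \<Rightarrow> nat \<Rightarrow> nat \<Rightarrow> bool" where
  "bubble 0 u = u"
| "bubble (Suc m) u = bubble m (pitman (Suc m) u)"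

primrec slope_melon :: "nat \<Rightarrow> (nat \<Rightarrow> nat \<Rightarrow> bool) \<Rightarrow> nat \<Rightarrow> nat \<Rightarrow> bool" where
  "slope_melon 0 u = u"
| "slope_melon (Suc m) u = bubble m (slope_melon m u)"

lemma bubble_beyond: "Suc m < l \<Longrightarrow> bubble m u l = u l"
  by (induction m arbitrary: u) (auto simp: pitman_def)

lemma slope_melon_beyond: "m < l \<Longrightarrow> slope_melon m u l = u l"
  by (induction m arbitrary: u) (auto simp: bubble_beyond)

definition unit_weights :: "nat \<Rightarrow> (nat \<Rightarrow> real) \<Rightarrow> bool" where
  "unit_weights T w \<longleftrightarrow> (\<forall>i. Suc i < T \<longrightarrow> w i = 1) \<and> (\<forall>i. 0 \<le> w i \<and> w i \<le> 1)"

text \<open>Holding in both directions, this says that the maximal gains agree for every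
  \<open>k\<close>, without mentioning a maximum; as a preorder it passes through the chain of
  two-line steps.\<close>

definition gain_le :: "nat \<Rightarrow> nat \<Rightarrow> (nat \<Rightarrow> real) \<Rightarrow> (nat \<Rightarrow> nat \<Rightarrow> bool) \<Rightarrow> (nat \<Rightarrow> nat \<Rightarrow> bool) \<Rightarrow> bool" where
  "gain_le n T w x x' \<longleftrightarrow>
    (\<forall>k N. config n k T N \<longrightarrow> (\<exists>N'. config n k T N' \<and> gain n T w x N \<le> gain n T w x' N'))"

lemma gain_le_refl: "gain_le n T w x x"
  by (auto simp: gain_le_def)

lemma gain_le_trans: "gain_le n T w x y \<Longrightarrow> gain_le n T w y z \<Longrightarrow> gain_le n T w x z"
  unfolding gain_le_def by (meson order_trans)

lemma gain_le_pitman: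
  assumes "unit_weights T w" "Suc i < n"
  shows "gain_le n T w x (pitman (Suc i) x)" "gain_le n T w (pitman (Suc i) x) x"
proof -
  have w: "\<And>i. Suc i < T \<Longrightarrow> w i = 1" "\<And>i. 0 \<le> w i" "\<And>i. w i \<le> 1"
    using assms(1) by (auto simp: unit_weights_def)
  show "gain_le n T w x (pitman (Suc i) x)"
    unfolding gain_le_def
    by (intro allI impI gain_exchange[OF assms(2)])
       (use two_line_expand[OF w] in \<open>auto simp: pitman_def upper_lower\<close>)
  show "gain_le n T w (pitman (Suc i) x) x"
    unfolding gain_le_def
    by (intro allI impI gain_exchange[OF assms(2)])
       (use two_line_contract[OF w] in \<open>auto simp: pitman_def upper_lower\<close>)
qed

lemma gain_le_bubble:
  assumes "unit_weights T w" "m < n"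
  shows "gain_le n T w x (bubble m x) \<and> gain_le n T w (bubble m x) x"
  using assms(2)
proof (induction m arbitrary: x)
  case 0
  then show ?case by (simp add: gain_le_refl)
next
  case (Suc m)
  then show ?case using Suc.IH[of "pitman (Suc m) x"] gain_le_pitman[OF assms(1) Suc.prems, of x]
    by (auto intro: gain_le_trans)
qed

lemma gain_le_slope_melon:
  assumes "unit_weights T w" "m \<le> n"
  shows "gain_le n T w x (slope_melon m x) \<and> gain_le n T w (slope_melon m x) x"
  using assms(2)
proof (induction m)
  case 0
  then show ?case by (simp add: gain_le_refl)
next
  case (Suc m)
  then show ?case using Suc.IH gain_le_bubble[OF assms(1), of m n "slope_melon m x"]
    by (auto intro: gain_le_trans)
qed

section \<open>Ordered lines and the configuration that is optimal on them\<close>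

definition ordered_slopes :: "nat \<Rightarrow> nat \<Rightarrow> (nat \<Rightarrow> nat \<Rightarrow> bool) \<Rightarrow> bool" where
  "ordered_slopes n T x \<longleftrightarrow> (\<forall>l j. 1 \<le> l \<longrightarrow> l < n \<longrightarrow> j \<le> T \<longrightarrow> ascent (x (Suc l)) j \<le> ascent (x l) j)"

text \<open>The departures follow the services \<open>y\<close> except at idle steps; there the
  queue is empty, so the departures have caught up with the arrivals, which dominate
  \<open>e\<close>.\<close>

lemma ascent_le_lower:
  assumes "\<And>j. j < T \<Longrightarrow> e j \<Longrightarrow> y j" "\<And>j. j \<le> T \<Longrightarrow> ascent e j \<le> ascent a j" "j \<le> T"
  shows "ascent e j \<le> ascent (lower a y) j"
  using assms(3)
proof (induction j)
  case (Suc j)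
  show ?case
  proof (cases "idle a y j")
    case True
    then have "queue a y j = 0" "\<not> a j" "\<not> lower a y j" by (auto simp: idle_def lower_def)
    then show ?thesis using assms(2)[OF Suc.prems] ascent_lower_queue[of a j y] by simp
  next
    case False
    then have "lower a y j = y j" by (auto simp: lower_def)
    then show ?thesis using Suc assms(1)[of j] by auto
  qed
qed simp

lemma ascent_lower_le: "ascent (lower a y) j \<le> ascent a j"
  by (simp add: ascent_lower_queue[of a j y])

lemma upper_slope_mono: "a j \<Longrightarrow> upper a y j"
  by (simp add: upper_def)

lemma bubble_last: "bubble (Suc m) u (Suc (Suc m)) = lower (u (Suc m)) (u (Suc (Suc m)))"
  by (simp add: bubble_beyond pitman_def)

text \<open>Used with \<open>e\<close> an old line whose slopes survive in the upper output of one
  two-line step; this output is the service line of the next step.\<close>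

lemma bubble_interlace_last:
  assumes "\<And>j. j < T \<Longrightarrow> e j \<Longrightarrow> u (Suc m) j"
    "\<And>j. 1 \<le> m \<Longrightarrow> j \<le> T \<Longrightarrow> ascent e j \<le> ascent (u m) j" "j \<le> T"
  shows "ascent e j \<le> ascent (bubble m u (Suc m)) j"
proof (cases m)
  case 0
  have "ascent e j \<le> ascent (u (Suc m)) j"
    unfolding ascent_def using assms(1,3) by (intro sum_mono) auto
  then show ?thesis using 0 by simp
next
  case (Suc m')
  show ?thesis unfolding Suc bubble_last
    using assms Suc by (intro ascent_le_lower) auto
qed

text \<open>Gelfand-Tsetlin interlacing before and after an insertion: departures never exceed
  arrivals, which is the first inequality, and \<open>bubble_interlace_last\<close> is the second.
  Order of the new lines follows by chaining the two.\<close>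

lemma bubble_interlace:
  assumes "ordered_slopes m T u" "1 \<le> l" "l \<le> m" "j \<le> T"
  shows "ascent (bubble m u (Suc l)) j \<le> ascent (u l) j \<and> ascent (u l) j \<le> ascent (bubble m u l) j"
  using assms(1-3)
proof (induction m arbitrary: u)
  case (Suc m)
  define u' where "u' = pitman (Suc m) u"
  have u': "u' i = u i" if "i \<le> m" for i using that by (simp add: u'_def pitman_def)
  have ord: "ordered_slopes m T u'"
    using Suc.prems by (auto simp: ordered_slopes_def u')
  show ?case
  proof (cases "l = Suc m")
    case True
    have 1: "ascent (bubble (Suc m) u (Suc l)) j \<le> ascent (u l) j"
      unfolding True bubble_last by (rule ascent_lower_le)
    have "ascent (u l) j \<le> ascent (bubble m u' (Suc m)) j"
    proof (rule bubble_interlace_last)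
      show "u' (Suc m) j" if "u l j" for j
        using that True by (simp add: u'_def pitman_def upper_slope_mono)
      show "ascent (u l) j \<le> ascent (u' m) j" if "1 \<le> m" "j \<le> T" for j
        using that Suc.prems(1) True by (simp add: u' ordered_slopes_def)
    qed fact
    then show ?thesis using 1 True by (simp add: u'_def)
  next
    case False
    then show ?thesis using Suc.IH[OF ord] Suc.prems u' by (simp add: u'_def)
  qed
qed simp

lemma ordered_bubble:
  assumes "ordered_slopes m T u"
  shows "ordered_slopes (Suc m) T (bubble m u)"
  unfolding ordered_slopes_def
  using bubble_interlace[OF assms] by (meson Suc_leI le_trans less_Suc_eq_le)

lemma ordered_slope_melon: "ordered_slopes m T (slope_melon m u)"
  by (induction m) (simp_all add: ordered_bubble, simp add: ordered_slopes_def)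

lemma config_le:
  assumes "config n k T N" "l \<le> n" "j < T"
  shows "N l j \<le> l" "N l j \<le> k"
proof -
  show "N l j \<le> l" using assms(2)
  proof (induction l)
    case 0
    then show ?case using assms by (simp add: config_def)
  next
    case (Suc l)
    then show ?case using assms(1,3) unfolding config_def
      by (metis Suc_leD Suc_le_eq Suc_le_mono order.trans)
  qed
  show "N l j \<le> k" using assms(2)
  proof (induction l rule: inc_induct)
    case base
    then show ?case using assms by (simp add: config_def)
  next
    case (step l)
    then show ?case using assms(1,3) unfolding config_def by (meson order_trans)
  qed
qed

definition weighted_ascent :: "(nat \<Rightarrow> real) \<Rightarrow> (nat \<Rightarrow> bool) \<Rightarrow> nat \<Rightarrow> real" where
  "weighted_ascent w x T = (\<Sum>j<T. w j * of_bool (x j))"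

text \<open>As a convex combination of the ascents at \<open>T - 1\<close> and \<open>T\<close>, the
  weighted value inherits every comparison that holds at integer times.\<close>

lemma weighted_ascent_eq:
  assumes "unit_weights T w"
  shows "weighted_ascent w x T = (if T = 0 then 0 else
    (1 - w (T - 1)) * ascent x (T - 1) + w (T - 1) * ascent x T)"
proof (cases T)
  case (Suc T')
  have "(\<Sum>j<T'. w j * of_bool (x j)) = real (ascent x T')"
    using assms Suc by (simp add: unit_weights_def ascent_def)
  then show ?thesis using Suc by (simp add: weighted_ascent_def algebra_simps)
qed (simp add: weighted_ascent_def)

lemma weighted_ascent_mono:
  assumes "unit_weights T w" "\<And>j. j \<le> T \<Longrightarrow> ascent x j \<le> ascent y j"
  shows "weighted_ascent w x T \<le> weighted_ascent w y T"
  using assms unfolding weighted_ascent_eq[OF assms(1)]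
  by (auto simp: unit_weights_def intro!: add_mono mult_left_mono)

lemma unit_weights_less: "unit_weights T w \<Longrightarrow> j \<le> T \<Longrightarrow> unit_weights j w"
  by (auto simp: unit_weights_def)

lemma sum_telescope_min:
  fixes G :: "nat \<Rightarrow> real"
  assumes "k \<le> n"
  shows "(\<Sum>l<n. (real (min k (Suc l)) - real (min k l)) * G (Suc l)) = (\<Sum>l\<in>{1..k}. G l)"
proof -
  have "(\<Sum>l<n. (real (min k (Suc l)) - real (min k l)) * G (Suc l)) = (\<Sum>l<n. if l \<in> {..<k} then G (Suc l) else 0)"
    by (intro sum.cong) (auto simp: min_def not_le Suc_le_eq)
  also have "\<dots> = (\<Sum>l\<in>{..<n} \<inter> {..<k}. G (Suc l))"
    by (simp add: sum.If_cases lessThan_def)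
  also have "{..<n} \<inter> {..<k} = {..<k}" using assms by auto
  also have "(\<Sum>l<k. G (Suc l)) = (\<Sum>l\<in>{1..k}. G l)"
    by (simp add: sum.atLeast1_atMost_eq lessThan_atLeast0)
  finally show ?thesis .
qed

text \<open>Summation by parts over the lines. Lines are numbered from 1, so \<open>x 0\<close> is a
  junk value, which \<open>c 0 = 0\<close> cancels.\<close>

lemma abel_lines:
  fixes x :: "nat \<Rightarrow> real"
  assumes "c 0 = 0"
  shows "(\<Sum>l<n. x (Suc l) * (c (Suc l) - c l)) = (\<Sum>l<n. c l * (x l - x (Suc l))) + c n * x n"
  using assms by (induction n) (auto simp: algebra_simps)

text \<open>Summation by parts in time: \<open>c\<close> is nondecreasing and \<open>D\<close>
  nonnegative, so all terms but the one at \<open>T\<close> have a favourable sign.\<close>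

lemma abel_time:
  fixes c :: "nat \<Rightarrow> nat" and D :: "nat \<Rightarrow> real"
  assumes "\<And>j. j \<le> T \<Longrightarrow> 0 \<le> D j" "D 0 = 0" "\<And>i j. i \<le> j \<Longrightarrow> j < T \<Longrightarrow> c i \<le> c j"
    "\<And>j. j < T \<Longrightarrow> c j \<le> M"
  shows "(\<Sum>j<T. c j * (D (Suc j) - D j)) \<le> M * D T"
proof -
  have "(\<Sum>j<t. c j * (D (Suc j) - D j)) \<le> c (t - 1) * D t" if "t \<le> T" for t
    using that
  proof (induction t)
    case (Suc t)
    have "c (t - 1) * D t \<le> c t * D t"
      using Suc.prems assms(1)[of t] assms(3)[of "t - 1" t] by (intro mult_right_mono) auto
    then show ?case using Suc by (simp add: algebra_simps)
  qed (simp add: assms)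
  from this[of T] have "(\<Sum>j<T. c j * (D (Suc j) - D j)) \<le> c (T - 1) * D T" by simp
  also have "\<dots> \<le> M * D T"
  proof (cases T)
    case (Suc T')
    then show ?thesis using assms(1)[of T] assms(4)[of T'] by (intro mult_right_mono) auto
  qed (simp add: assms)
  finally show ?thesis .
qed

text \<open>Summation by parts over the lines pairs \<open>N l\<close> with the gap between lines
  \<open>l\<close> and \<open>Suc l\<close>, which is nonnegative. Summation by parts in time then
  replaces \<open>N l\<close> by its bound \<open>min k l\<close>, and this bound is itself the
  configuration that keeps the paths on the top \<open>k\<close> lines.\<close>

lemma gain_ordered_le:
  assumes w: "unit_weights T w" and ord: "ordered_slopes n T x" and cfg: "config n k T N" and k: "k \<le> n"
  shows "gain n T w x N \<le> (\<Sum>l\<in>{1..k}. weighted_ascent w (x l) T)"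
proof -
  define G where "G l j = weighted_ascent w (x l) j" for l j
  have G0: "G l 0 = 0" for l by (simp add: G_def weighted_ascent_def)
  have GS: "G l (Suc j) - G l j = w j * of_bool (x l j)" for l j by (simp add: G_def weighted_ascent_def)
  have N0: "N 0 j = 0" "N n j = k" if "j < T" for j using cfg that by (auto simp: config_def)
  have "gain n T w x N = (\<Sum>j<T. \<Sum>l<n. (G (Suc l) (Suc j) - G (Suc l) j) * (real (N (Suc l) j) - real (N l j)))"
    unfolding gain_def GS by (simp only: sum_distrib_left mult.assoc)
  also have "\<dots> = (\<Sum>j<T. (\<Sum>l<n. real (N l j) * ((G l (Suc j) - G l j) - (G (Suc l) (Suc j) - G (Suc l) j))) +
       real k * (G n (Suc j) - G n j))"
    using N0 by (intro sum.cong refl, subst abel_lines) auto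
  also have "\<dots> = (\<Sum>l<n. \<Sum>j<T. real (N l j) * ((G l (Suc j) - G (Suc l) (Suc j)) - (G l j - G (Suc l) j))) + real k * G n T"
  proof -
    have "(\<Sum>j<T. real k * (G n (Suc j) - G n j)) = real k * G n T"
      by (simp add: sum_lessThan_telescope G0 flip: sum_distrib_left)
    then show ?thesis
      unfolding sum.distrib by (subst sum.swap) (simp add: algebra_simps)
  qed
  also have "\<dots> \<le> (\<Sum>l<n. real (min k l) * (G l T - G (Suc l) T)) + real k * G n T"
  proof (intro add_right_mono sum_mono)
    fix l assume "l \<in> {..<n}"
    then have l: "l < n" by simp
    show "(\<Sum>j<T. real (N l j) * ((G l (Suc j) - G (Suc l) (Suc j)) - (G l j - G (Suc l) j))) \<le>
       real (min k l) * (G l T - G (Suc l) T)"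
    proof (cases "l = 0")
      case True
      then show ?thesis using N0 by simp
    next
      case False
      show ?thesis
      proof (rule abel_time)
        fix j assume j: "j \<le> T"
        have "G (Suc l) j \<le> G l j" unfolding G_def
          using ord j l False by (intro weighted_ascent_mono unit_weights_less[OF w])
            (auto simp: ordered_slopes_def)
        then show "0 \<le> G l j - G (Suc l) j" by simp
      next
        fix i j assume "i \<le> j" "j < T"
        then show "N l i \<le> N l j" using cfg l by (simp add: config_def)
      next
        fix j assume "j < T"
        then show "N l j \<le> min k l" using config_le[OF cfg, of l j] l by simp
      qed (simp add: G0)
    qed
  qed
  also have "\<dots> = (\<Sum>l<n. (real (min k (Suc l)) - real (min k l)) * G (Suc l) T)"
    using abel_lines[of "\<lambda>l. real (min k l)" "\<lambda>l. G l T" n] k by (simp add: mult.commute min_def)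
  also have "\<dots> = (\<Sum>l\<in>{1..k}. G l T)" by (rule sum_telescope_min[OF k])
  finally show ?thesis by (simp add: G_def)
qed

lemma gain_min_config:
  assumes k: "k \<le> n"
  shows "config n k T (\<lambda>l j. min k l)"
    "gain n T w x (\<lambda>l j. min k l) = (\<Sum>l\<in>{1..k}. weighted_ascent w (x l) T)"
proof -
  show "config n k T (\<lambda>l j. min k l)" using k by (auto simp: config_def)
  have "gain n T w x (\<lambda>l j. min k l) =
     (\<Sum>l<n. (real (min k (Suc l)) - real (min k l)) * weighted_ascent w (x (Suc l)) T)"
    unfolding gain_def weighted_ascent_def sum_distrib_left
    by (subst sum.swap) (simp add: mult_ac)
  then show "gain n T w x (\<lambda>l j. min k l) = (\<Sum>l\<in>{1..k}. weighted_ascent w (x l) T)"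
    using sum_telescope_min[OF k] by simp
qed

text \<open>A discrete form of Greene's theorem.\<close>

theorem gain_slope_melon:
  assumes "unit_weights T w" "k \<le> n"
  shows "config n k T N \<Longrightarrow> gain n T w x N \<le> (\<Sum>l\<in>{1..k}. weighted_ascent w (slope_melon n x l) T)"
    and "\<exists>N. config n k T N \<and> gain n T w x N = (\<Sum>l\<in>{1..k}. weighted_ascent w (slope_melon n x l) T)"
proof -
  have le: "gain_le n T w x (slope_melon n x)" "gain_le n T w (slope_melon n x) x"
    using gain_le_slope_melon[OF assms(1) order_refl] by auto
  show ub: "gain n T w x N \<le> (\<Sum>l\<in>{1..k}. weighted_ascent w (slope_melon n x l) T)" if "config n k T N" for N
    using le(1) that gain_ordered_le[OF assms(1) ordered_slope_melon _ assms(2)]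
    unfolding gain_le_def by (meson order_trans)
  obtain N where N: "config n k T N" "gain n T w (slope_melon n x) (\<lambda>l j. min k l) \<le> gain n T w x N"
    using le(2) gain_min_config(1)[OF assms(2)] unfolding gain_le_def by blast
  with ub[OF N(1)] show "\<exists>N. config n k T N \<and> gain n T w x N = (\<Sum>l\<in>{1..k}. weighted_ascent w (slope_melon n x l) T)"
    unfolding gain_min_config(2)[OF assms(2)] by force
qed

section \<open>Interpolation and the measure of a union of paths\<close>

definition clamp01 :: "real \<Rightarrow> real" where
  "clamp01 u = max 0 (min 1 u)"

text \<open>The weight \<open>clamp01 (s - real j)\<close> is the length of the part of unit
  \<open>j\<close> before \<open>s\<close>. As a \<open>weighted_ascent\<close>, the piecewise
  linear path is directly within reach of \<open>gain_slope_melon\<close> at real times.\<close>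

definition interp :: "(nat \<Rightarrow> bool) \<Rightarrow> real \<Rightarrow> real" where
  "interp x s = weighted_ascent (\<lambda>j. clamp01 (s - real j)) x (nat \<lceil>s\<rceil>)"

definition slopes :: "(real \<Rightarrow> real) \<Rightarrow> nat \<Rightarrow> bool" where
  "slopes g j \<longleftrightarrow> g (real j + 1) - g (real j) = 1"

lemma unit_weights_clamp: "unit_weights (nat \<lceil>s\<rceil>) (\<lambda>j. clamp01 (s - real j))"
  unfolding unit_weights_def
proof (intro conjI allI impI)
  fix i assume "Suc i < nat \<lceil>s\<rceil>"
  then have "real (Suc i) < s" by linarith
  then show "clamp01 (s - real i) = 1" by (simp add: clamp01_def)
qed (auto simp: clamp01_def)

lemma interp_eq:
  assumes "s \<le> real T"
  shows "interp x s = (\<Sum>j<T. clamp01 (s - real j) * of_bool (x j))"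
  unfolding interp_def weighted_ascent_def
proof (rule sum.mono_neutral_left)
  show "{..<nat \<lceil>s\<rceil>} \<subseteq> {..<T}" using assms by (simp add: ceiling_le_iff)
  have "clamp01 (s - real i) = 0" if "\<not> i < nat \<lceil>s\<rceil>" for i
  proof -
    have "s \<le> real i" using that by linarith
    then show ?thesis by (simp add: clamp01_def)
  qed
  then show "\<forall>i\<in>{..<T} - {..<nat \<lceil>s\<rceil>}. clamp01 (s - real i) * of_bool (x i) = 0"
    by (metis DiffD2 lessThan_iff mult_zero_left)
qed simp

lemma interp_segment:
  assumes "real j \<le> s" "s \<le> real j + 1"
  shows "interp x s = ascent x j + of_bool (x j) * (s - real j)"
proof -
  have "interp x s = (\<Sum>i<Suc j. clamp01 (s - real i) * of_bool (x i))"
    using assms by (intro interp_eq) auto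
  also have "\<dots> = (\<Sum>i<j. of_bool (x i)) + (s - real j) * of_bool (x j)"
  proof -
    have "(\<Sum>i<j. clamp01 (s - real i) * of_bool (x i)) = (\<Sum>i<j. of_bool (x i))"
      using assms by (intro sum.cong) (auto simp: clamp01_def)
    moreover have "clamp01 (s - real j) = s - real j" using assms by (auto simp: clamp01_def)
    ultimately show ?thesis by simp
  qed
  finally show ?thesis by (simp add: ascent_def mult.commute)
qed

lemma interp_nat [simp]: "interp x (real j) = ascent x j"
  using interp_segment[of j "real j" x] by simp

lemma interp_0 [simp]: "interp x 0 = 0"
  using interp_nat[of x 0] by simp

lemma slopes_interp [simp]: "slopes (interp x) = x"
  using interp_nat[of x "Suc _"] by (auto simp: slopes_def fun_eq_iff add.commute)

lemma nat_floor_segment: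
  assumes "0 \<le> s"
  obtains j where "real j \<le> s" "s < real j + 1"
  using assms that[of "nat \<lfloor>s\<rfloor>"] by linarith

text \<open>The condition on \<open>I\<close> is met by both \<open>{0..}\<close> and
  \<open>{0..real t}\<close>, the two domains that occur.\<close>

lemma bernoulli_path_interp:
  assumes g: "g \<in> bernoulli_paths I" and I: "I \<subseteq> {0..}" "\<And>j s. s \<in> I \<Longrightarrow> real j < s \<Longrightarrow> {real j..real j + 1} \<subseteq> I"
    and s: "s \<in> I"
  shows "g s = interp (slopes g) s"
proof -
  have seg: "g s = g (real j) + of_bool (slopes g j) * (s - real j)"
    if "s \<in> I" "real j < s" "s \<le> real j + 1" for s j
  proof -
    obtain \<sigma> where \<sigma>: "\<sigma> \<in> {0,1}" "\<forall>x\<in>{real j..real j + 1}. g x = g (real j) + \<sigma> * (x - real j)"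
      using g I(2)[OF \<open>s \<in> I\<close> \<open>real j < s\<close>] unfolding bernoulli_paths_def by blast
    have "of_bool (slopes g j) = \<sigma>" using \<sigma>(1) bspec[OF \<sigma>(2), of "real j + 1"] by (auto simp: slopes_def)
    then show ?thesis using bspec[OF \<sigma>(2), of s] that by auto
  qed
  have int: "g (real j) = ascent (slopes g) j" if "real j \<in> I" for j
    using that
  proof (induction j)
    case 0
    then show ?case using g by (simp add: bernoulli_paths_def)
  next
    case (Suc j)
    have "{real j..real j + 1} \<subseteq> I" using I(2)[OF Suc.prems, of j] by simp
    then have "real j \<in> I" by auto
    then show ?case using Suc.IH seg[OF Suc.prems, of j] by (simp add: add.commute)
  qed
  obtain j where j: "real j \<le> s" "s < real j + 1" using s I(1) by (auto elim: nat_floor_segment[of s])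
  show ?thesis
  proof (cases "real j = s")
    case True
    then show ?thesis using int[of j] s by auto
  next
    case False
    then have "{real j..real j + 1} \<subseteq> I" using I(2)[OF s, of j] j by simp
    then have "real j \<in> I" by auto
    then show ?thesis using seg[OF s, of j] int[of j] interp_segment[of j s "slopes g"] j False by auto
  qed
qed

lemma bernoulli_path_interp_ge0:
  assumes "g \<in> bernoulli_paths {0..}" "0 \<le> s"
  shows "g s = interp (slopes g) s"
  by (rule bernoulli_path_interp[OF assms(1)]) (use assms(2) in auto)

lemma bernoulli_path_interp_upto:
  assumes "g \<in> bernoulli_paths {0..real t}" "0 \<le> s" "s \<le> real t"
  shows "g s = interp (slopes g) s"
proof (rule bernoulli_path_interp[OF assms(1)])
  fix j s assume "s \<in> {0..real t}" "real j < s"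
  then have "real j < real t" by simp
  then have "real (Suc j) \<le> real t" by (simp only: of_nat_le_iff of_nat_less_iff Suc_le_eq)
  then show "{real j..real j + 1} \<subseteq> {0..real t}" by auto
qed (use assms(2,3) in auto)

lemma continuous_on_interp: "continuous_on UNIV (interp x)"
proof -
  have "continuous_on {..<real T} (interp x)" for T
  proof -
    have "continuous_on {..<real T} (\<lambda>s. \<Sum>j<T. clamp01 (s - real j) * of_bool (x j))"
      unfolding clamp01_def by (intro continuous_intros)
    then show ?thesis by (rule continuous_on_eq) (simp only: interp_eq[of _ T] lessThan_iff less_imp_le)
  qed
  then have "continuous_on (\<Union>T::nat. {..<real T}) (interp x)"
    by (intro continuous_on_open_UN) auto
  moreover have "(\<Union>T::nat. {..<real T}) = UNIV" using reals_Archimedean2 by auto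
  ultimately show ?thesis by simp
qed

lemma interp_bernoulli_path:
  assumes "I \<subseteq> {0..}" "0 \<in> I"
  shows "restrict (interp x) I \<in> bernoulli_paths I"
  unfolding bernoulli_paths_def
proof (intro CollectI conjI allI impI)
  show "continuous_on I (restrict (interp x) I)"
    by (rule continuous_on_eq[of _ "interp x"]) (auto intro: continuous_on_subset[OF continuous_on_interp])
  fix j assume j: "{real j..real j + 1} \<subseteq> I"
  have "real j \<in> I" using j by auto
  then show "\<exists>s\<in>{0, 1}. \<forall>xa\<in>{real j..real j + 1}. restrict (interp x) I xa = restrict (interp x) I (real j) + s * (xa - real j)"
    using j by (intro bexI[of _ "of_bool (x j)"]) (auto simp: interp_segment subset_iff)
qed (use assms in auto)

text \<open>Increments become lengths, so the finitely many points where disjoint paths touch can be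
  ignored from here on.\<close>

lemma interp_diff_measure:
  assumes "a \<le> b" "0 \<le> a" "b \<le> real T"
  shows "interp x b - interp x a = (\<Sum>j<T. of_bool (x j) * measure lborel ({a..b} \<inter> {real j..real j + 1}))"
proof -
  have m: "measure lborel ({a..b} \<inter> {real j..real j + 1}) = clamp01 (b - j) - clamp01 (a - j)" for j
  proof -
    have "{a..b} \<inter> {real j..real j + 1} = {max a j..min b (real j + 1)}" by auto
    then show ?thesis using assms(1) by (cases "max a j \<le> min b (real j + 1)") (auto simp: clamp01_def)
  qed
  show ?thesis
    unfolding interp_eq[OF assms(3)] interp_eq[OF order_trans[OF assms(1,3)]] sum_subtractf[symmetric] m
    by (intro sum.cong refl) (simp add: algebra_simps)
qed

text \<open>Each component contains the left endpoint of some interval, so there are finitely many;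
  being compact and connected, it is an interval itself.\<close>

lemma components_Union_intervals:
  fixes a b :: "'i \<Rightarrow> real"
  assumes "finite P" "\<And>p. p \<in> P \<Longrightarrow> a p \<le> b p"
  defines "S \<equiv> \<Union>p\<in>P. {a p..b p}"
  shows "finite (components S)" "C \<in> components S \<Longrightarrow> C = {Inf C..Sup C} \<and> Inf C \<in> S \<and> Sup C \<in> S \<and> Inf C \<le> Sup C"
proof -
  have "components S \<subseteq> (\<lambda>p. connected_component_set S (a p)) ` P"
  proof
    fix C assume C: "C \<in> components S"
    then obtain x where x: "x \<in> S" "C = connected_component_set S x" by (auto simp: components_def)
    then obtain p where p: "p \<in> P" "x \<in> {a p..b p}" by (auto simp: S_def)
    have "connected_component S x (a p)"
      unfolding connected_component_def
      using p assms(2)[OF p(1)] by (intro exI[of _ "{a p..b p}"]) (auto simp: S_def)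
    then have "C = connected_component_set S (a p)" using x connected_component_eq by fastforce
    then show "C \<in> (\<lambda>p. connected_component_set S (a p)) ` P" using p by auto
  qed
  then show "finite (components S)" using assms(1) finite_surj by blast
  assume C: "C \<in> components S"
  have "compact S" unfolding S_def using assms(1) by (intro compact_UN) auto
  then have "compact C" "connected C" "C \<noteq> {}"
    using C compact_components in_components_connected in_components_nonempty by blast+
  then obtain l u where lu: "C = {l..u}" using connected_compact_interval_1 by blast
  with \<open>C \<noteq> {}\<close> have "l \<le> u" by simp
  moreover have "C \<subseteq> S" using C in_components_subset by blast
  ultimately show "C = {Inf C..Sup C} \<and> Inf C \<in> S \<and> Sup C \<in> S \<and> Inf C \<le> Sup C" using lu by auto
qed

lemma left_lim_bernoulli_path:
  assumes g: "g \<in> bernoulli_paths {0..}" and "0 \<le> x"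
  shows "left_lim g x = g x"
proof (cases "x = 0")
  case True
  then show ?thesis using g by (simp add: left_lim_def bernoulli_paths_def)
next
  case False
  have "x \<in> interior {0..}" using False assms(2) by simp
  moreover have "continuous_on {0..} g" using g by (simp add: bernoulli_paths_def)
  ultimately have "isCont g x" using continuous_on_interior by blast
  then have "(g \<longlongrightarrow> g x) (at_left x)" by (simp add: isCont_def filterlim_at_split)
  then show ?thesis using False by (auto simp: left_lim_def intro!: tendsto_Lim)
qed

text \<open>Paths without jumps have \<open>left_lim\<close> equal to the value, so single-point
  components contribute 0 and \<open>df\<close> has the slope as its density with respect to
  Lebesgue measure.\<close>

lemma df_eq_measure:
  assumes f: "\<And>i. i \<in> {1..n} \<Longrightarrow> f i \<in> bernoulli_paths {0..}"
    and P: "finite P" "\<And>i p. i \<in> {1..n} \<Longrightarrow> p \<in> P \<Longrightarrow> 0 \<le> a i p \<and> a i p \<le> b i p \<and> b i p \<le> real T"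
    and A: "\<And>i. i \<in> {1..n} \<Longrightarrow> {s. (s, i) \<in> A} = (\<Union>p\<in>P. {a i p..b i p})"
  shows "df n f A = (\<Sum>i\<in>{1..n}. \<Sum>j<T. of_bool (slopes (f i) j) *
     measure lborel ((\<Union>p\<in>P. {a i p..b i p}) \<inter> {real j..real j + 1}))"
  unfolding df_def
proof (intro sum.cong refl)
  fix i assume i: "i \<in> {1..n}"
  define S where "S = (\<Union>p\<in>P. {a i p..b i p})"
  have S: "0 \<le> s \<and> s \<le> real T" if "s \<in> S" for s
    using that P(2)[OF i] by (force simp: S_def)
  have ab: "a i p \<le> b i p" if "p \<in> P" for p using P(2)[OF i that] by simp
  have comp: "finite (components S)"
    "\<And>C. C \<in> components S \<Longrightarrow> C = {Inf C..Sup C} \<and> Inf C \<in> S \<and> Sup C \<in> S \<and> Inf C \<le> Sup C"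
    unfolding S_def using components_Union_intervals[OF P(1), of "a i" "b i"] ab by blast+
  have "(\<Sum>C\<in>components {s. (s, i) \<in> A}. f i (Sup C) - left_lim (f i) (Inf C)) =
     (\<Sum>C\<in>components S. \<Sum>j<T. of_bool (slopes (f i) j) * measure lborel (C \<inter> {real j..real j + 1}))"
    unfolding A[OF i] S_def[symmetric]
  proof (intro sum.cong refl)
    fix C assume "C \<in> components S"
    from comp(2)[OF this] have C: "C = {Inf C..Sup C}" "Inf C \<in> S" "Sup C \<in> S" "Inf C \<le> Sup C" by auto
    have "f i (Sup C) - left_lim (f i) (Inf C) = interp (slopes (f i)) (Sup C) - interp (slopes (f i)) (Inf C)"
      using S[OF C(2)] S[OF C(3)] f[OF i] by (simp add: left_lim_bernoulli_path bernoulli_path_interp_ge0)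
    also have "\<dots> = (\<Sum>j<T. of_bool (slopes (f i) j) * measure lborel ({Inf C..Sup C} \<inter> {real j..real j + 1}))"
      using S[OF C(2)] S[OF C(3)] C(4) by (intro interp_diff_measure) auto
    finally show "f i (Sup C) - left_lim (f i) (Inf C) = (\<Sum>j<T. of_bool (slopes (f i) j) * measure lborel (C \<inter> {real j..real j + 1}))"
      using C(1) by metis
  qed
  also have "\<dots> = (\<Sum>j<T. of_bool (slopes (f i) j) * (\<Sum>C\<in>components S. measure lborel (C \<inter> {real j..real j + 1})))"
    unfolding sum_distrib_left by (rule sum.swap)
  also have "\<dots> = (\<Sum>j<T. of_bool (slopes (f i) j) * measure lborel (S \<inter> {real j..real j + 1}))"
  proof (intro sum.cong refl arg_cong2[where f = "(*)"])
    fix j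
    have CI: "C \<inter> {real j..real j + 1} = {max (Inf C) j..min (Sup C) (real j + 1)}" if "C \<in> components S" for C
      using comp(2)[OF that] by (metis Int_atLeastAtMost)
    have "measure lborel (\<Union>C\<in>components S. C \<inter> {real j..real j + 1}) = (\<Sum>C\<in>components S. measure lborel (C \<inter> {real j..real j + 1}))"
    proof (rule measure_finite_Union[OF comp(1)])
      show "disjoint_family_on (\<lambda>C. C \<inter> {real j..real j + 1}) (components S)"
        using pairwise_disjoint_components[of S] by (auto simp: disjoint_family_on_def pairwise_def)
    qed (auto simp: CI emeasure_lborel_Icc_eq)
    moreover have "(\<Union>C\<in>components S. C \<inter> {real j..real j + 1}) = S \<inter> {real j..real j + 1}"
      using Union_components[of S] by blast
    ultimately show "(\<Sum>C\<in>components S. measure lborel (C \<inter> {real j..real j + 1})) = measure lborel (S \<inter> {real j..real j + 1})"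
      by simp
  qed
  finally show "(\<Sum>C\<in>components {s. (s, i) \<in> A}. f i (Sup C) - left_lim (f i) (Inf C)) =
    (\<Sum>j<T. of_bool (slopes (f i) j) * measure lborel ((\<Union>p\<in>P. {a i p..b i p}) \<inter> {real j..real j + 1}))"
    unfolding S_def .
qed

section \<open>Last passage values of Bernoulli paths\<close>

lemma finite_atLeastAtMost_le: "(b :: real) \<le> a \<Longrightarrow> finite {a..b}"
  by (cases "a = b") auto

lemma chain_le:
  fixes t :: "nat \<Rightarrow> real"
  assumes "\<forall>i\<in>{1..n}. t i \<le> t (i - 1)" "i \<le> l" "l \<le> n"
  shows "t l \<le> t i"
  using assms(2,3)
proof (induction l rule: dec_induct)
  case (step l)
  then show ?case using bspec[OF assms(1), of "Suc l"] by auto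
qed simp

text \<open>The step function takes finitely many values, so its maximum is attained, and it is at
  least the average over \<open>{l..<u}\<close>.\<close>

lemma exists_ge_average:
  fixes c :: "'i \<Rightarrow> real" and l u :: real
  assumes "finite I" "l < u" "\<And>i. i \<in> I \<Longrightarrow> B i \<in> sets lborel" "\<And>i. i \<in> I \<Longrightarrow> B i \<subseteq> {l..<u}"
  shows "\<exists>s\<in>{l..<u}. (\<Sum>i\<in>I. c i * measure lborel (B i)) \<le> (u - l) * (\<Sum>i\<in>I. c i * indicator (B i) s)"
proof -
  define \<psi> where "\<psi> s = (\<Sum>i\<in>I. c i * indicator (B i) s)" for s :: real
  have "\<psi> s \<in> (\<lambda>K. \<Sum>i\<in>K. c i) ` Pow I" for s
  proof (rule image_eqI)
    have "\<psi> s = (\<Sum>i\<in>I. if s \<in> B i then c i else 0)"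
      unfolding \<psi>_def by (intro sum.cong) auto
    then show "\<psi> s = sum c {i\<in>I. s \<in> B i}" using assms(1) by (simp add: sum.inter_filter)
  qed auto
  then have "\<psi> ` {l..<u} \<subseteq> (\<lambda>K. \<Sum>i\<in>K. c i) ` Pow I" by blast
  then have "finite (\<psi> ` {l..<u})" by (rule finite_subset) (use assms(1) in auto)
  moreover have "\<psi> ` {l..<u} \<noteq> {}" using assms(2) by simp
  ultimately have "Max (\<psi> ` {l..<u}) \<in> \<psi> ` {l..<u}" "\<And>s. s \<in> {l..<u} \<Longrightarrow> \<psi> s \<le> Max (\<psi> ` {l..<u})"
    using Max_in Max_ge by auto
  then obtain s where s: "s \<in> {l..<u}" "\<And>s'. s' \<in> {l..<u} \<Longrightarrow> \<psi> s' \<le> \<psi> s" by auto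
  have fin: "emeasure lborel (B i) < \<infinity>" if "i \<in> I" for i
  proof -
    have "emeasure lborel (B i) \<le> emeasure lborel {l..<u}"
      using assms that by (intro emeasure_mono) auto
    then show ?thesis using assms(2) by (simp add: le_less_trans)
  qed
  have "(\<Sum>i\<in>I. c i * measure lborel (B i)) = (\<integral>x. \<psi> x \<partial>lborel)"
    unfolding \<psi>_def using assms fin by (subst Bochner_Integration.integral_sum) (auto simp: integrable_mult_right_iff)
  also have "\<dots> \<le> (\<integral>x. \<psi> s * indicator {l..<u} x \<partial>lborel)"
  proof (rule integral_mono)
    show "integrable lborel \<psi>" unfolding \<psi>_def
      using assms fin by (intro Bochner_Integration.integrable_sum integrable_mult_right) auto
    show "integrable lborel (\<lambda>x. \<psi> s * indicator {l..<u} x)"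
      using assms(2) by (intro integrable_mult_right) auto
    fix x :: real
    show "\<psi> x \<le> \<psi> s * indicator {l..<u} x"
    proof (cases "x \<in> {l..<u}")
      case False
      then have "x \<notin> B i" if "i \<in> I" for i using assms(4)[OF that] by blast
      then have "\<psi> x = 0" by (simp add: \<psi>_def)
      then show ?thesis using False by simp
    qed (use s in auto)
  qed
  also have "\<dots> = (u - l) * \<psi> s" using assms(2) by simp
  finally show ?thesis using s(1) unfolding \<psi>_def by blast
qed

lemma measure_lborel_cong_finite:
  assumes "A \<in> sets lborel" "B \<in> sets lborel" "finite F" "\<And>x :: real. x \<notin> F \<Longrightarrow> x \<in> A \<longleftrightarrow> x \<in> B"
  shows "measure lborel A = measure lborel B"
proof (rule measure_eq_AE[OF _ assms(1,2)])
  have "AE x in lborel. x \<notin> F"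
    using assms(3) by (intro AE_not_in finite_imp_null_set_lborel)
  then show "AE x in lborel. x \<in> A \<longleftrightarrow> x \<in> B" by eventually_elim (use assms(4) in auto)
qed

lemma sum_lines_shift: "(\<Sum>i\<in>{1..n}. h i) = (\<Sum>l<n. h (Suc l :: nat) :: real)"
  by (simp add: sum.atLeast1_atMost_eq lessThan_atLeast0)

text \<open>In each unit all paths are observed at one common moment \<open>\<sigma> j\<close>,
  chosen such that the occupied slopes are at least their average over the unit. The moments
  increase with \<open>j\<close>, so the observed counts form a configuration.\<close>

lemma df_path_tuple_le_gain:
  assumes f: "\<And>i. i \<in> {1..n} \<Longrightarrow> f i \<in> bernoulli_paths {0..}"
    and \<pi>: "\<pi> \<in> disjoint_path_tuples n k y" and y: "0 \<le> y"
  shows "\<exists>N. config n k (nat \<lceil>y\<rceil>) N \<and>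
    df n f (\<Union>p\<in>{1..k}. \<pi> p) \<le> gain n (nat \<lceil>y\<rceil>) (\<lambda>j. clamp01 (y - real j)) (\<lambda>i. slopes (f i)) N"
proof -
  define T where "T = nat \<lceil>y\<rceil>"
  have yT: "y \<le> real T" by (simp add: T_def real_nat_ceiling_ge)
  have jy: "real j < y" if "j < T" for j using that by (simp add: T_def less_ceiling_iff zless_nat_eq_int_zless)
  have "\<forall>p\<in>{1..k}. \<exists>t. \<pi> p = (\<Union>i\<in>{1..n}. {t i..t (i - 1)} \<times> {i}) \<and> t n = 0 \<and> t 0 = y \<and> (\<forall>i\<in>{1..n}. t i \<le> t (i - 1))"
    using \<pi> unfolding disjoint_path_tuples_def lattice_paths_def by (auto simp: PiE_iff)
  from bchoice[OF this] obtain t where t: "\<And>p. p \<in> {1..k} \<Longrightarrow> \<pi> p = (\<Union>i\<in>{1..n}. {t p i..t p (i - 1)} \<times> {i})"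
    "\<And>p. p \<in> {1..k} \<Longrightarrow> t p n = 0" "\<And>p. p \<in> {1..k} \<Longrightarrow> t p 0 = y"
    "\<And>p. p \<in> {1..k} \<Longrightarrow> \<forall>i\<in>{1..n}. t p i \<le> t p (i - 1)" by blast
  \<comment> \<open>Two paths sharing an interval of positive length on line \<open>i\<close> would
    meet in infinitely many points.\<close>
  have disj: "t p' (i - 1) \<le> max (t p i) (t p' i) \<or> t p (i - 1) \<le> max (t p i) (t p' i)"
    if "p \<in> {1..k}" "p' \<in> {1..k}" "p \<noteq> p'" "i \<in> {1..n}" for p p' i
  proof (rule ccontr)
    assume neg: "\<not> ?thesis"
    have "finite (\<pi> p \<inter> \<pi> p')" using \<pi> that by (auto simp: disjoint_path_tuples_def)
    moreover have "(\<lambda>s. (s, i)) ` {max (t p i) (t p' i)..min (t p' (i - 1)) (t p (i - 1))} \<subseteq> \<pi> p \<inter> \<pi> p'"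
      using that by (auto simp: t(1))
    ultimately have "finite ((\<lambda>s. (s, i)) ` {max (t p i) (t p' i)..min (t p' (i - 1)) (t p (i - 1))})"
      using finite_subset by blast
    then have "finite {max (t p i) (t p' i)..min (t p' (i - 1)) (t p (i - 1))}"
      by (rule finite_imageD) (auto simp: inj_on_def)
    then have "\<not> max (t p i) (t p' i) < min (t p' (i - 1)) (t p (i - 1))" using infinite_Icc by blast
    then show False using neg by auto
  qed
  \<comment> \<open>Path \<open>p\<close> enters line \<open>l\<close> at time \<open>t p l\<close>,
    so for \<open>s < y\<close> this counts the paths that are on lines \<open>1..l\<close> at time
    \<open>s\<close>.\<close>
  define N where "N l s = card {p\<in>{1..k}. t p l \<le> s}" for l and s :: real
  have N_mono: "N l s \<le> N l s'" if "s \<le> s'" for l s s'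
    unfolding N_def using that by (intro card_mono) auto
  have N_0: "N 0 s = 0" if "s < y" for s using that t(3) by (auto simp: N_def)
  have N_n: "N n s = k" if "0 \<le> s" for s
  proof -
    have "{p\<in>{1..k}. t p n \<le> s} = {1..k}" using that t(2) by auto
    then show ?thesis by (simp add: N_def)
  qed
  have N_line: "N (Suc l) s = N l s + of_bool (\<exists>p\<in>{1..k}. t p (Suc l) \<le> s \<and> s < t p l)" if l: "l < n" for l s
  proof -
    define E where "E = {p\<in>{1..k}. t p (Suc l) \<le> s \<and> s < t p l}"
    have tl: "t p (Suc l) \<le> t p l" if "p \<in> {1..k}" for p using bspec[OF t(4)[OF that], of "Suc l"] l by simp
    have "{p\<in>{1..k}. t p (Suc l) \<le> s} = {p\<in>{1..k}. t p l \<le> s} \<union> E"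
      unfolding E_def using tl by (auto simp: not_less intro: order_trans)
    then have "N (Suc l) s = card ({p\<in>{1..k}. t p l \<le> s} \<union> E)" by (simp add: N_def)
    also have "\<dots> = N l s + card E" unfolding N_def E_def by (subst card_Un_disjoint) auto
    also have "card E = of_bool (\<exists>p\<in>{1..k}. t p (Suc l) \<le> s \<and> s < t p l)"
    proof -
      have "p = p'" if "p \<in> E" "p' \<in> E" for p p'
      proof (rule ccontr)
        assume "p \<noteq> p'"
        then have "t p' l \<le> max (t p (Suc l)) (t p' (Suc l)) \<or> t p l \<le> max (t p (Suc l)) (t p' (Suc l))"
          using that disj[of p p' "Suc l"] l unfolding E_def by simp
        then show False using that unfolding E_def by auto
      qed
      then have "card E \<le> 1" by (auto intro: card_le_Suc0_iff_eq[THEN iffD2] simp: E_def)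
      moreover have "finite E" by (simp add: E_def)
      ultimately have "card E = of_bool (E \<noteq> {})" by (cases "E = {}") (auto simp: card_eq_0_iff le_Suc_eq)
      then show ?thesis by (auto simp: E_def)
    qed
    finally show ?thesis .
  qed
  \<comment> \<open>With half-open intervals each path is on exactly one line at each moment in
    \<open>{0..<y}\<close>, as in \<open>N_line\<close>; the closed intervals differ from them by
    finitely many points.\<close>
  define B where "B j i = (\<Union>p\<in>{1..k}. {t p i..<t p (i - 1)}) \<inter> {real j..<min (real j + 1) y}" for j i
  have t_bounds: "0 \<le> t p l \<and> t p l \<le> y" if "p \<in> {1..k}" "l \<le> n" for p l
    using chain_le[OF t(4)[OF that(1)], of 0 l] chain_le[OF t(4)[OF that(1)], of l n] t(2,3)[OF that(1)] that(2) by auto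
  have meas: "measure lborel ((\<Union>p\<in>{1..k}. {t p i..t p (i - 1)}) \<inter> {real j..real j + 1}) = measure lborel (B j i)"
    if i: "i \<in> {1..n}" for i j
  proof (rule measure_lborel_cong_finite[where F = "insert (real j + 1) (insert y ((\<lambda>p. t p (i - 1)) ` {1..k}))"])
    fix s assume s: "s \<notin> insert (real j + 1) (insert y ((\<lambda>p. t p (i - 1)) ` {1..k}))"
    have "i - 1 \<le> n" using i by auto
    then have sy: "s < y" if "p \<in> {1..k}" "s \<le> t p (i - 1)" for p
      using that t_bounds[of p "i - 1"] s by auto
    show "s \<in> (\<Union>p\<in>{1..k}. {t p i..t p (i - 1)}) \<inter> {real j..real j + 1} \<longleftrightarrow> s \<in> B j i" (is "?L \<longleftrightarrow> ?R")
    proof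
      assume ?L
      then obtain p where p: "p \<in> {1..k}" "t p i \<le> s" "s \<le> t p (i - 1)" "real j \<le> s" "s \<le> real j + 1" by auto
      then have "s < t p (i - 1)" "s < real j + 1" using s by (auto simp: less_le)
      then show ?R using p sy[OF p(1,3)] unfolding B_def by auto
    next
      assume ?R
      then obtain p where "p \<in> {1..k}" "t p i \<le> s" "s < t p (i - 1)" "real j \<le> s" "s < real j + 1"
        unfolding B_def by auto
      then show ?L by (intro IntI UN_I[of p]) auto
    qed
  qed (auto simp: B_def)
  have "\<exists>s\<in>{real j..<min (real j + 1) y}.
     (\<Sum>i\<in>{1..n}. of_bool (slopes (f i) j) * measure lborel (B j i)) \<le>
     (min (real j + 1) y - real j) * (\<Sum>i\<in>{1..n}. of_bool (slopes (f i) j) * indicator (B j i) s)" if "j < T" for j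
    by (rule exists_ge_average) (use jy[OF that] in \<open>auto simp: B_def\<close>)
  then have "\<forall>j\<in>{..<T}. \<exists>s. s \<in> {real j..<min (real j + 1) y} \<and>
     (\<Sum>i\<in>{1..n}. of_bool (slopes (f i) j) * measure lborel (B j i)) \<le>
     (min (real j + 1) y - real j) * (\<Sum>i\<in>{1..n}. of_bool (slopes (f i) j) * indicator (B j i) s)"
    unfolding Bex_def by blast
  from bchoice[OF this] obtain \<sigma> where \<sigma>: "\<And>j. j < T \<Longrightarrow> \<sigma> j \<in> {real j..<min (real j + 1) y}"
    "\<And>j. j < T \<Longrightarrow> (\<Sum>i\<in>{1..n}. of_bool (slopes (f i) j) * measure lborel (B j i)) \<le>
     (min (real j + 1) y - real j) * (\<Sum>i\<in>{1..n}. of_bool (slopes (f i) j) * indicator (B j i) (\<sigma> j))"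
    by auto
  define N' where "N' l j = N l (\<sigma> j)" for l j
  have \<sigma>_mono: "\<sigma> i \<le> \<sigma> j" if "i \<le> j" "j < T" for i j
  proof (cases "i = j")
    case False
    then have "real i + 1 \<le> real j" using that by linarith
    then show ?thesis using \<sigma>(1)[of i] \<sigma>(1)[of j] that by auto
  qed simp
  have cfg: "config n k T N'"
    unfolding config_def N'_def
  proof (intro conjI allI impI)
    fix j assume j: "j < T"
    have "0 \<le> \<sigma> j" using \<sigma>(1)[OF j] by (auto intro: order_trans[of 0 "real j"])
    then show "N 0 (\<sigma> j) = 0" "N n (\<sigma> j) = k" using N_0 N_n \<sigma>(1)[OF j] by auto
    fix l assume "l < n"
    then show "N l (\<sigma> j) \<le> N (Suc l) (\<sigma> j)" "N (Suc l) (\<sigma> j) \<le> Suc (N l (\<sigma> j))"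
      by (auto simp: N_line)
  next
    fix l j i assume "j < T" "i \<le> j"
    then show "N l (\<sigma> i) \<le> N l (\<sigma> j)" by (intro N_mono \<sigma>_mono)
  qed
  have "df n f (\<Union>p\<in>{1..k}. \<pi> p) = (\<Sum>i\<in>{1..n}. \<Sum>j<T. of_bool (slopes (f i) j) *
     measure lborel ((\<Union>p\<in>{1..k}. {t p i..t p (i - 1)}) \<inter> {real j..real j + 1}))"
  proof (rule df_eq_measure[OF f])
    fix i p assume ip: "i \<in> {1..n}" "p \<in> {1..k}"
    show "0 \<le> t p i \<and> t p i \<le> t p (i - 1) \<and> t p (i - 1) \<le> real T"
      using t_bounds[OF ip(2), of i] t_bounds[OF ip(2), of "i - 1"] bspec[OF t(4)[OF ip(2)] ip(1)] ip(1) yT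
        by (simp add: le_diff_conv)
  next
    fix i assume "i \<in> {1..n}"
    then show "{s. (s, i) \<in> (\<Union>p\<in>{1..k}. \<pi> p)} = (\<Union>p\<in>{1..k}. {t p i..t p (i - 1)})"
      by (auto simp: t(1))
  qed auto
  also have "\<dots> = (\<Sum>j<T. \<Sum>i\<in>{1..n}. of_bool (slopes (f i) j) * measure lborel (B j i))"
    by (subst sum.swap, intro sum.cong refl) (simp only: meas)
  also have "\<dots> \<le> (\<Sum>j<T. (min (real j + 1) y - real j) * (\<Sum>i\<in>{1..n}. of_bool (slopes (f i) j) * indicator (B j i) (\<sigma> j)))"
    by (intro sum_mono \<sigma>(2)) simp
  also have "\<dots> = gain n T (\<lambda>j. clamp01 (y - real j)) (\<lambda>i. slopes (f i)) N'"
    unfolding gain_def sum_lines_shift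
  proof (intro sum.cong refl arg_cong2[where f = "(*)"])
    fix j assume j: "j \<in> {..<T}"
    show "min (real j + 1) y - real j = clamp01 (y - real j)" using jy[of j] j by (auto simp: clamp01_def)
    fix l assume l: "l \<in> {..<n}"
    have "indicator (B j (Suc l)) (\<sigma> j) = (of_bool (\<exists>p\<in>{1..k}. t p (Suc l) \<le> \<sigma> j \<and> \<sigma> j < t p l) :: real)"
      using \<sigma>(1)[of j] j by (auto simp: B_def indicator_def)
    then show "indicator (B j (Suc l)) (\<sigma> j) = real (N' (Suc l) j) - real (N' l j)"
      using l by (simp add: N'_def N_line)
  qed
  finally show ?thesis using cfg unfolding T_def by blast
qed

text \<open>Path \<open>p\<close> enters line \<open>l\<close> in the first unit in which at least
  \<open>p\<close> paths are on lines \<open>1..l\<close>. All jumps are at integers or at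
  \<open>y\<close>, so each unit contributes exactly its weight.\<close>

lemma gain_eq_df_path_tuple:
  assumes f: "\<And>i. i \<in> {1..n} \<Longrightarrow> f i \<in> bernoulli_paths {0..}"
    and cfg: "config n k (nat \<lceil>y\<rceil>) N" and y: "0 \<le> y"
  shows "\<exists>\<pi>\<in>disjoint_path_tuples n k y.
    df n f (\<Union>p\<in>{1..k}. \<pi> p) = gain n (nat \<lceil>y\<rceil>) (\<lambda>j. clamp01 (y - real j)) (\<lambda>i. slopes (f i)) N"
proof -
  define T where "T = nat \<lceil>y\<rceil>"
  have yT: "y \<le> real T" by (simp add: T_def real_nat_ceiling_ge)
  have jy: "real j < y" if "j < T" for j using that by (simp add: T_def less_ceiling_iff zless_nat_eq_int_zless)
  have N: "N 0 j = 0" "N n j = k" if "j < T" for j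
    using cfg that by (auto simp: config_def T_def)
  have N': "N l j \<le> N (Suc l) j" "N (Suc l) j \<le> Suc (N l j)" if "j < T" "l < n" for l j
    using cfg that by (auto simp: config_def T_def)
  have N_mono: "N l i \<le> N l j" if "l \<le> n" "i \<le> j" "j < T" for l i j
    using cfg that by (auto simp: config_def T_def)
  \<comment> \<open>The alternative \<open>T \<le> j\<close> makes the minimum exist, with value
    \<open>T\<close> if lines \<open>1..l\<close> never hold \<open>p\<close> paths.\<close>
  define \<tau> where "\<tau> p l = (LEAST j. T \<le> j \<or> p \<le> N l j)" for p l
  have \<tau>: "T \<le> \<tau> p l \<or> p \<le> N l (\<tau> p l)" "\<tau> p l \<le> T" for p l
    unfolding \<tau>_def by (rule LeastI[of _ T], simp, rule Least_le, simp)
  have \<tau>_le: "\<tau> p l \<le> j \<longleftrightarrow> p \<le> N l j" if "j < T" "l \<le> n" for p l j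
  proof
    assume "\<tau> p l \<le> j"
    then show "p \<le> N l j" using \<tau>(1)[of p l] N_mono[OF that(2), of "\<tau> p l" j] that by auto
  qed (auto simp: \<tau>_def intro: Least_le)
  define t where "t p l = min y (real (\<tau> p l))" for p l
  have t_mono: "t p (Suc l) \<le> t p l" if "l < n" for p l
  proof -
    have "\<tau> p (Suc l) \<le> \<tau> p l"
    proof (cases "\<tau> p l < T")
      case True
      then show ?thesis using \<tau>_le[of "\<tau> p l" "Suc l" p] \<tau>(1)[of p l] N'(1)[OF True that] that by auto
    qed (use \<tau>(2)[of p "Suc l"] in auto)
    then show ?thesis by (simp add: t_def min.coboundedI2 min_le_iff_disj)
  qed
  have t_mono': "t p i \<le> t p (i - 1)" if "i \<in> {1..n}" for p i
    using t_mono[of "i - 1" p] that by (cases i) auto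
  have t_0: "t p 0 = y" if "p \<in> {1..k}" for p
  proof -
    have "\<tau> p 0 = T" using \<tau>(1,2)[of p 0] N(1)[of "\<tau> p 0"] that by (cases "\<tau> p 0 < T") auto
    then show ?thesis using yT by (simp add: t_def)
  qed
  have t_n: "t p n = 0" if "p \<in> {1..k}" for p
  proof -
    have "\<tau> p n = 0" using \<tau>(2)[of p n] \<tau>_le[of 0 n p] N(2)[of 0] that by (cases "T = 0") auto
    then show ?thesis using y by (simp add: t_def)
  qed
  define \<pi> where "\<pi> = (\<lambda>p\<in>{1..k}. \<Union>i\<in>{1..n}. {t p i..t p (i - 1)} \<times> {i})"
  have disj: "min (t p (i - 1)) (t p' (i - 1)) \<le> max (t p i) (t p' i)" if "p < p'" "i \<in> {1..n}" for p p' i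
  proof (rule ccontr)
    assume neg: "\<not> ?thesis"
    \<comment> \<open>In the unit in which \<open>p'\<close> enters line \<open>i\<close>, path
      \<open>p\<close> has not left that line. Hence \<open>p' \<le> N i j\<close> while
      \<open>N (i - 1) j < p\<close>, a jump by two between neighbouring counts.\<close>
    define j where "j = \<tau> p' i"
    have "t p' i < t p (i - 1)" using neg by auto
    then have j: "j < \<tau> p (i - 1)" unfolding j_def t_def by linarith
    then have jT: "j < T" using \<tau>(2)[of p "i - 1"] by simp
    have "i - 1 \<le> n" using that by auto
    then have "N (i - 1) j < p" using \<tau>_le[OF jT, of "i - 1" p] j by auto
    moreover have "p' \<le> N i j" using \<tau>_le[OF jT, of i p'] that by (auto simp: j_def)
    moreover have "N i j \<le> Suc (N (i - 1) j)" using N'(2)[OF jT, of "i - 1"] that by (cases i) auto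
    ultimately show False using that by simp
  qed
  have "finite (\<pi> p \<inter> \<pi> p')" if "p < p'" "p \<in> {1..k}" "p' \<in> {1..k}" for p p'
  proof (rule finite_subset)
    show "\<pi> p \<inter> \<pi> p' \<subseteq> (\<Union>i\<in>{1..n}. {max (t p i) (t p' i)..min (t p (i - 1)) (t p' (i - 1))} \<times> {i})"
      using that by (auto simp: \<pi>_def)
    show "finite (\<Union>i\<in>{1..n}. {max (t p i) (t p' i)..min (t p (i - 1)) (t p' (i - 1))} \<times> {i})"
    proof (intro finite_UN_I finite_cartesian_product)
      fix i assume "i \<in> {1..n}"
      then show "finite {max (t p i) (t p' i)..min (t p (i - 1)) (t p' (i - 1))}"
        using disj[OF that(1)] finite_atLeastAtMost_le by blast
    qed auto
  qed
  then have fin: "finite (\<pi> p \<inter> \<pi> p')" if "p \<noteq> p'" "p \<in> {1..k}" "p' \<in> {1..k}" for p p'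
    using that by (metis Int_commute nat_neq_iff)
  have \<pi>: "\<pi> \<in> disjoint_path_tuples n k y"
    unfolding disjoint_path_tuples_def
  proof (intro CollectI conjI ballI impI fin)
    show "\<pi> \<in> {1..k} \<rightarrow>\<^sub>E lattice_paths n y"
      unfolding \<pi>_def
    proof (rule restrict_PiE_iff[THEN iffD2], rule ballI)
      fix p assume p: "p \<in> {1..k}"
      show "(\<Union>i\<in>{1..n}. {t p i..t p (i - 1)} \<times> {i}) \<in> lattice_paths n y"
        unfolding lattice_paths_def using t_0[OF p] t_n[OF p] t_mono'[of _ p] by blast
    qed
  qed
  have t_bounds: "0 \<le> t p l \<and> t p l \<le> y" for p l using y by (simp add: t_def)
  have meas: "measure lborel ((\<Union>p\<in>{1..k}. {t p (Suc l)..t p l}) \<inter> {real j..real j + 1}) =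
     clamp01 (y - real j) * (real (N (Suc l) j) - real (N l j))" if l: "l < n" and j: "j < T" for l j
  proof -
    define e where "e = min (real j + 1) y"
    have e: "real j < e" "e \<le> y" "e \<le> real j + 1" "clamp01 (y - real j) = e - real j"
      using jy[OF j] by (auto simp: e_def clamp01_def)
    define D where "D = (if N (Suc l) j = N l j then {} else {real j..e})"
    have in_iff: "s \<in> {t p (Suc l)..t p l} \<longleftrightarrow> \<tau> p (Suc l) \<le> j \<and> j < \<tau> p l" if s: "real j < s" "s < e" for s p
    proof -
      have "t p (Suc l) \<le> s \<longleftrightarrow> \<tau> p (Suc l) \<le> j"
      proof
        assume "t p (Suc l) \<le> s"
        then have "real (\<tau> p (Suc l)) < real j + 1" using s e by (auto simp: t_def)
        then show "\<tau> p (Suc l) \<le> j" by linarith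
      qed (use s in \<open>auto simp: t_def\<close>)
      moreover have "s \<le> t p l \<longleftrightarrow> j < \<tau> p l"
      proof
        assume "j < \<tau> p l"
        then have "real j + 1 \<le> real (\<tau> p l)" by linarith
        then show "s \<le> t p l" using s e by (auto simp: t_def)
      next
        assume "s \<le> t p l"
        then show "j < \<tau> p l" using s by (auto simp: t_def)
      qed
      ultimately show ?thesis by auto
    qed
    have ex: "(\<exists>p\<in>{1..k}. \<tau> p (Suc l) \<le> j \<and> j < \<tau> p l) \<longleftrightarrow> N (Suc l) j \<noteq> N l j"
    proof -
      have "(\<exists>p\<in>{1..k}. \<tau> p (Suc l) \<le> j \<and> j < \<tau> p l) \<longleftrightarrow> (\<exists>p\<in>{1..k}. p \<le> N (Suc l) j \<and> N l j < p)"
        using \<tau>_le[OF j] l by (simp add: not_le[symmetric])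
      also have "\<dots> \<longleftrightarrow> N (Suc l) j \<noteq> N l j"
        using N'[OF j l] config_le(2)[OF cfg, of "Suc l" j] l j
        by (auto simp: T_def intro!: bexI[of _ "N (Suc l) j"])
      finally show ?thesis .
    qed
    have "measure lborel ((\<Union>p\<in>{1..k}. {t p (Suc l)..t p l}) \<inter> {real j..real j + 1}) = measure lborel D"
    proof (rule measure_lborel_cong_finite[where F = "{real j, e, real j + 1}"])
      fix s assume s: "s \<notin> {real j, e, real j + 1}"
      show "s \<in> (\<Union>p\<in>{1..k}. {t p (Suc l)..t p l}) \<inter> {real j..real j + 1} \<longleftrightarrow> s \<in> D"
      proof (cases "real j < s \<and> s < e")
        case True
        then have "s \<in> (\<Union>p\<in>{1..k}. {t p (Suc l)..t p l}) \<longleftrightarrow> N (Suc l) j \<noteq> N l j"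
          using in_iff[of s] unfolding ex[symmetric] by blast
        then show ?thesis using True e by (auto simp: D_def)
      next
        case False
        have "\<not> (s \<in> (\<Union>p\<in>{1..k}. {t p (Suc l)..t p l}) \<inter> {real j..real j + 1})"
        proof
          assume *: "s \<in> (\<Union>p\<in>{1..k}. {t p (Suc l)..t p l}) \<inter> {real j..real j + 1}"
          then obtain p where "s \<le> t p l" by auto
          then have "s \<le> y" using t_bounds[of p l] by linarith
          with * False s show False by (auto simp: e_def)
        qed
        then show ?thesis using False s e by (auto simp: D_def)
      qed
    qed (auto simp: D_def)
    also have "\<dots> = (e - real j) * (real (N (Suc l) j) - real (N l j))"
      using N'[OF j l] e(1) by (auto simp: D_def le_Suc_eq)
    finally show ?thesis using e(4) by simp
  qed
  have "df n f (\<Union>p\<in>{1..k}. \<pi> p) = (\<Sum>i\<in>{1..n}. \<Sum>j<T. of_bool (slopes (f i) j) *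
     measure lborel ((\<Union>p\<in>{1..k}. {t p i..t p (i - 1)}) \<inter> {real j..real j + 1}))"
  proof (rule df_eq_measure[OF f])
    fix i p assume "i \<in> {1..n}" "p \<in> {1..k}"
    then show "0 \<le> t p i \<and> t p i \<le> t p (i - 1) \<and> t p (i - 1) \<le> real T"
      using t_bounds t_mono' yT order_trans by blast
  next
    fix i assume "i \<in> {1..n}"
    then show "{s. (s, i) \<in> (\<Union>p\<in>{1..k}. \<pi> p)} = (\<Union>p\<in>{1..k}. {t p i..t p (i - 1)})"
      by (auto simp: \<pi>_def)
  qed auto
  also have "\<dots> = gain n T (\<lambda>j. clamp01 (y - real j)) (\<lambda>i. slopes (f i)) N"
    unfolding gain_def sum_lines_shift sum_distrib_left
    by (subst sum.swap, intro sum.cong refl) (simp only: diff_Suc_1 meas lessThan_iff mult.left_commute)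
  finally show ?thesis using \<pi> unfolding T_def by blast
qed

text \<open>The supremum is a maximum: an optimal configuration is realized by a tuple of paths, and
  no tuple of paths beats all configurations.\<close>

theorem last_passage_eq:
  assumes f: "\<And>i. i \<in> {1..n} \<Longrightarrow> f i \<in> bernoulli_paths {0..}" and y: "0 \<le> y" and k: "k \<le> n"
  shows "last_passage n f k y = (\<Sum>l\<in>{1..k}. interp (slope_melon n (\<lambda>i. slopes (f i)) l) y)"
proof (cases "k = 0")
  case False
  let ?V = "\<Sum>l\<in>{1..k}. interp (slope_melon n (\<lambda>i. slopes (f i)) l) y"
  let ?g = "gain n (nat \<lceil>y\<rceil>) (\<lambda>j. clamp01 (y - real j)) (\<lambda>i. slopes (f i))"
  have gain: "config n k (nat \<lceil>y\<rceil>) N \<Longrightarrow> ?g N \<le> ?V" "\<exists>N. config n k (nat \<lceil>y\<rceil>) N \<and> ?g N = ?V" for N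
    unfolding interp_def using gain_slope_melon[OF unit_weights_clamp k] by blast+
  have le: "df n f (\<Union>p\<in>{1..k}. \<pi> p) \<le> ?V" if \<pi>: "\<pi> \<in> disjoint_path_tuples n k y" for \<pi>
  proof -
    obtain N where "config n k (nat \<lceil>y\<rceil>) N" "df n f (\<Union>p\<in>{1..k}. \<pi> p) \<le> ?g N"
      using df_path_tuple_le_gain[of n f, OF _ \<pi> y] f by blast
    with gain(1)[of N] show ?thesis by linarith
  qed
  obtain N where N: "config n k (nat \<lceil>y\<rceil>) N" "?g N = ?V" using gain(2) by blast
  obtain \<pi> where \<pi>: "\<pi> \<in> disjoint_path_tuples n k y" "df n f (\<Union>p\<in>{1..k}. \<pi> p) = ?g N"
    using gain_eq_df_path_tuple[of n f, OF _ N(1) y] f by blast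
  have "(SUP \<pi>\<in>disjoint_path_tuples n k y. df n f (\<Union>p\<in>{1..k}. \<pi> p)) = ?V"
  proof (rule cSup_eq_maximum)
    show "?V \<in> (\<lambda>\<pi>. df n f (\<Union>p\<in>{1..k}. \<pi> p)) ` disjoint_path_tuples n k y"
      using \<pi>(1) by (intro image_eqI[of _ _ \<pi>]) (simp_all only: \<pi>(2) N(2))
  qed (use le in auto)
  then show ?thesis using False by (simp add: last_passage_def)
qed (simp add: last_passage_def)

theorem melon_eq_interp:
  assumes "\<And>i. i \<in> {1..n} \<Longrightarrow> f i \<in> bernoulli_paths {0..}"
  shows "melon n f = (\<lambda>k\<in>{1..n}. \<lambda>y\<in>{0..}. interp (slope_melon n (\<lambda>i. slopes (f i)) k) y)"
  unfolding melon_def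
proof (intro restrict_ext)
  fix k and y :: real assume k: "k \<in> {1..n}" and y: "y \<in> {0..}"
  let ?h = "\<lambda>l. interp (slope_melon n (\<lambda>i. slopes (f i)) l) y"
  have "last_passage n f k' y = sum ?h {1..k'}" if "k' \<le> n" for k'
    using y that by (intro last_passage_eq assms) auto
  moreover have "k \<le> n" "k - 1 \<le> n" using k by auto
  ultimately have "last_passage n f k y - last_passage n f (k - 1) y = sum ?h {1..k} - sum ?h {1..k - 1}"
    by simp
  also have "\<dots> = ?h k" using k by (cases k) auto
  finally show "last_passage n f k y - last_passage n f (k - 1) y = ?h k" .
qed

section \<open>Fibers of the melon map\<close>

lemma queue_cong:
  assumes "\<And>i. i < j \<Longrightarrow> a i = a' i" "\<And>i. i < j \<Longrightarrow> b i = b' i"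
  shows "queue a b j = queue a' b' j"
  using assms by (induction j) auto

lemma ascent_cong:
  assumes "\<And>i. i < j \<Longrightarrow> a i = a' i"
  shows "ascent a j = ascent a' j"
  using assms by (auto simp: ascent_def)

lemma upper_lower_cong:
  assumes "\<And>i. i \<le> j \<Longrightarrow> a i = a' i" "\<And>i. i \<le> j \<Longrightarrow> b i = b' i"
  shows "upper a b j = upper a' b' j" "lower a b j = lower a' b' j"
  using assms queue_cong[of j a a' b b'] by (auto simp: upper_def lower_def idle_def)

text \<open>The queue is run backwards in time. Its length is the number of arrivals minus the
  number of departures, so the endpoint \<open>a\<close> supplies the terminal length that makes the
  backward run deterministic.\<close>

lemma two_line_fiber_exists:
  assumes "\<And>j. j \<le> T \<Longrightarrow> ascent g j \<le> ascent z j" "ascent g T \<le> a" "a \<le> ascent z T"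
  shows "\<exists>e y. (\<forall>j<T. upper e y j = z j \<and> lower e y j = g j) \<and> ascent e T = a"
  using assms
proof (induction T arbitrary: a)
  case (Suc T)
  define \<epsilon> where "\<epsilon> \<longleftrightarrow> z T \<and> (g T \<or> ascent g T < a)"
  define \<eta> where "\<eta> \<longleftrightarrow> g T \<or> (z T \<and> \<not> \<epsilon>)"
  have gz: "ascent g T \<le> ascent z T" using Suc.prems(1)[of T] by simp
  have a: "ascent g T \<le> a - of_bool \<epsilon>" "a - of_bool \<epsilon> \<le> ascent z T" "of_bool \<epsilon> \<le> a"
    using Suc.prems(2,3) gz by (auto simp: \<epsilon>_def split: if_splits)
  obtain e y where ey: "\<And>j. j < T \<Longrightarrow> upper e y j = z j" "\<And>j. j < T \<Longrightarrow> lower e y j = g j"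
    "ascent e T = a - of_bool \<epsilon>"
    using Suc.IH[OF Suc.prems(1) a(1,2)] by auto
  define e' where "e' = e(T := \<epsilon>)"
  define y' where "y' = y(T := \<eta>)"
  have old: "upper e' y' j = z j \<and> lower e' y' j = g j" if "j < T" for j
    using ey(1,2)[OF that] upper_lower_cong[of j e' e y' y] that by (auto simp: e'_def y'_def)
  have "ascent (lower e' y') T = ascent g T" using old by (intro ascent_cong) auto
  moreover have e'T: "ascent e' T = a - of_bool \<epsilon>" using ey(3) ascent_cong[of T e' e] by (auto simp: e'_def)
  ultimately have q: "ascent g T + queue e' y' T = a - of_bool \<epsilon>"
    using ascent_lower_queue[of e' T y'] by simp
  have eT: "e' T = \<epsilon>" "y' T = \<eta>" by (simp_all add: e'_def y'_def)
  have "upper e' y' T = z T \<and> lower e' y' T = g T"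
    using q a Suc.prems(2) unfolding upper_def lower_def idle_def eT
    by (cases "z T"; cases "g T") (auto simp: \<epsilon>_def \<eta>_def split: if_splits)
  then have "\<forall>j<Suc T. upper e' y' j = z j \<and> lower e' y' j = g j" using old by (simp add: less_Suc_eq)
  moreover have "ascent e' (Suc T) = a" using e'T a(3) eT by simp
  ultimately show ?case by blast
qed auto

lemma two_line_step_inj:
  assumes "queue a b (Suc j) = queue a' b' (Suc j)" "upper a b j = upper a' b' j" "lower a b j = lower a' b' j"
  shows "a j = a' j \<and> b j = b' j"
  using assms by (auto simp: upper_def lower_def idle_def split: if_splits)

text \<open>Equal endpoints and equal departures give equal terminal queues, from which
  \<open>two_line_step_inj\<close> recovers the last step.\<close>

lemma two_line_fiber_unique:
  assumes "\<And>j. j < T \<Longrightarrow> upper e y j = upper e' y' j" "\<And>j. j < T \<Longrightarrow> lower e y j = lower e' y' j"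
    "ascent e T = ascent e' T" "j < T"
  shows "e j = e' j \<and> y j = y' j"
  using assms
proof (induction T)
  case (Suc T)
  have "ascent (lower e y) (Suc T) = ascent (lower e' y') (Suc T)"
    by (intro ascent_cong Suc.prems)
  then have "queue e y (Suc T) = queue e' y' (Suc T)"
    using ascent_lower_queue[of e "Suc T" y] ascent_lower_queue[of e' "Suc T" y'] Suc.prems(3) by linarith
  then have last: "e T = e' T \<and> y T = y' T" using Suc.prems by (intro two_line_step_inj) auto
  then have "ascent e T = ascent e' T" using Suc.prems(3) by simp
  then show ?case using Suc.IH Suc.prems last by (auto simp: less_Suc_eq)
qed simp

section \<open>Inverting the insertion of a line\<close>

definition agree :: "nat \<Rightarrow> nat \<Rightarrow> (nat \<Rightarrow> nat \<Rightarrow> bool) \<Rightarrow> (nat \<Rightarrow> nat \<Rightarrow> bool) \<Rightarrow> bool" where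
  "agree n T u v \<longleftrightarrow> (\<forall>l\<in>{1..n}. \<forall>j<T. u l j = v l j)"

lemma agree_Suc: "agree (Suc n) T u v \<longleftrightarrow> agree n T u v \<and> (\<forall>j<T. u (Suc n) j = v (Suc n) j)"
proof -
  have *: "{1..Suc n} = insert (Suc n) {1..n}" by auto
  show ?thesis unfolding agree_def * by blast
qed

lemma agree_sym: "agree n T u v \<Longrightarrow> agree n T v u"
  by (auto simp: agree_def)

lemma agree_trans: "agree n T u v \<Longrightarrow> agree n T v w \<Longrightarrow> agree n T u w"
  by (auto simp: agree_def)

lemma agree_less: "agree n T u v \<Longrightarrow> m \<le> n \<Longrightarrow> agree m T u v"
  by (auto simp: agree_def)

lemma agree_ascent: "agree n T u v \<Longrightarrow> l \<in> {1..n} \<Longrightarrow> j \<le> T \<Longrightarrow> ascent (u l) j = ascent (v l) j"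
  by (intro ascent_cong) (auto simp: agree_def)

lemma agree_pitman:
  assumes "agree n T u v" "1 \<le> i" "Suc i \<le> n"
  shows "agree n T (pitman i u) (pitman i v)"
proof -
  have "u i j = v i j \<and> u (Suc i) j = v (Suc i) j" if "j < T" for j
    using assms that by (auto simp: agree_def)
  then have "upper (u i) (u (Suc i)) j = upper (v i) (v (Suc i)) j \<and> lower (u i) (u (Suc i)) j = lower (v i) (v (Suc i)) j"
    if "j < T" for j
    using upper_lower_cong[of j "u i" "v i" "u (Suc i)" "v (Suc i)"] that by auto
  then show ?thesis using assms(1) by (auto simp: agree_def pitman_def)
qed

lemma agree_bubble: "agree n T u v \<Longrightarrow> Suc m \<le> n \<Longrightarrow> agree n T (bubble m u) (bubble m v)"
  by (induction m arbitrary: u v) (simp_all add: agree_pitman)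

lemma agree_slope_melon: "agree n T u v \<Longrightarrow> m \<le> n \<Longrightarrow> agree n T (slope_melon m u) (slope_melon m v)"
  by (induction m) (auto intro: agree_bubble)

lemma ascent_bubble_last_le: "ascent (bubble m u (Suc m)) j \<le> ascent (u (Suc m)) j"
proof (cases m)
  case (Suc m')
  show ?thesis unfolding Suc bubble_last ascent_def by (intro sum_mono) (auto simp: lower_def)
qed simp

text \<open>The comparison is known at the final time \<open>T\<close> and propagates backwards: where it first fails, the
  queue is idle, which forces \<open>e\<close> to meet \<open>g2\<close>.\<close>

lemma two_line_fiber_ordered:
  assumes z: "\<And>j. j < T \<Longrightarrow> upper e y j = z j" and g2: "\<And>j. j < T \<Longrightarrow> lower e y j = g2 j"
    and g1: "\<And>j. j < T \<Longrightarrow> g1 j \<Longrightarrow> z j"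
    and le: "\<And>j. j \<le> T \<Longrightarrow> ascent g2 j \<le> ascent g1 j" and last: "ascent e T \<le> ascent g1 T" and "j \<le> T"
  shows "ascent e j \<le> ascent g1 j"
  using \<open>j \<le> T\<close>
proof (induction j rule: inc_induct)
  case (step j)
  show ?case
  proof (rule ccontr)
    assume neg: "\<not> ?thesis"
    then have "g1 j" "\<not> e j" using step.IH by (cases "g1 j"; cases "e j"; simp)+
    then have "idle e y j" using g1[of j] z[of j] step by (auto simp: upper_def)
    then have "ascent e j = ascent (lower e y) j" using ascent_lower_queue[of e j y] by (simp add: idle_def)
    also have "\<dots> = ascent g2 j" using g2 step by (intro ascent_cong) auto
    finally show False using le[of j] step neg by simp
  qed
qed (rule last)

text \<open>The induction hypothesis undoes all two-line steps but the first, recovering the upper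
  \<open>m\<close> lines and the line \<open>z\<close> that the first step passed upwards. Then
  \<open>two_line_fiber_exists\<close> splits \<open>z\<close> and the lowest line of
  \<open>g\<close>, with the prescribed endpoint.\<close>

lemma bubble_fiber_exists:
  assumes "ordered_slopes (Suc m) T g"
    "\<And>l. l \<in> {1..m} \<Longrightarrow> ascent (g (Suc l)) T \<le> a l \<and> a l \<le> ascent (g l) T"
  shows "\<exists>u. ordered_slopes m T u \<and> agree (Suc m) T (bubble m u) g \<and> (\<forall>l\<in>{1..m}. ascent (u l) T = a l)"
  using assms
proof (induction m)
  case 0
  show ?case by (rule exI[of _ g]) (auto simp: ordered_slopes_def agree_def)
next
  case (Suc m)
  have "ordered_slopes (Suc m) T g" using Suc.prems(1) by (auto simp: ordered_slopes_def)
  from Suc.IH[OF this] Suc.prems(2) obtain u' where u': "ordered_slopes m T u'"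
    "agree (Suc m) T (bubble m u') g" "\<And>l. l \<in> {1..m} \<Longrightarrow> ascent (u' l) T = a l" by auto
  define z where "z = u' (Suc m)"
  have g_z: "ascent (g (Suc m)) j \<le> ascent z j" if "j \<le> T" for j
    using ascent_bubble_last_le[of m u' j] agree_ascent[OF u'(2), of "Suc m" j] that by (simp add: z_def)
  have g_g: "ascent (g (Suc (Suc m))) j \<le> ascent (g (Suc m)) j" if "j \<le> T" for j
    using Suc.prems(1) that by (simp add: ordered_slopes_def)
  have "\<exists>e y. (\<forall>j<T. upper e y j = z j \<and> lower e y j = g (Suc (Suc m)) j) \<and> ascent e T = a (Suc m)"
  proof (rule two_line_fiber_exists)
    show "ascent (g (Suc (Suc m))) j \<le> ascent z j" if "j \<le> T" for j
      using g_z[OF that] g_g[OF that] by linarith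
    show "ascent (g (Suc (Suc m))) T \<le> a (Suc m)" "a (Suc m) \<le> ascent z T"
      using Suc.prems(2)[of "Suc m"] g_z[of T] by auto
  qed
  then obtain e y where ey: "\<And>j. j < T \<Longrightarrow> upper e y j = z j" "\<And>j. j < T \<Longrightarrow> lower e y j = g (Suc (Suc m)) j"
    "ascent e T = a (Suc m)" by blast
  define u where "u = u'(Suc m := e, Suc (Suc m) := y)"
  have pit: "agree (Suc m) T (pitman (Suc m) u) u'"
    using ey(1) by (auto simp: agree_def pitman_def u_def z_def)
  have "agree (Suc m) T (bubble (Suc m) u) g"
    using agree_trans[OF agree_bubble[OF pit order_refl] u'(2)] by simp
  moreover have "bubble (Suc m) u (Suc (Suc m)) j = g (Suc (Suc m)) j" if "j < T" for j
    unfolding bubble_last using ey(2)[OF that] by (simp add: u_def)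
  ultimately have ag: "agree (Suc (Suc m)) T (bubble (Suc m) u) g"
    by (auto simp: agree_def le_Suc_eq)
  \<comment> \<open>The recovered line must fit below \<open>u' m\<close>: it stays below
    \<open>g (Suc m)\<close>, which is the departure process for the arrivals
    \<open>u' m\<close>.\<close>
  have e_le: "ascent e j \<le> ascent (u' m) j" if m: "1 \<le> m" and "j \<le> T" for j
  proof -
    obtain m' where m': "m = Suc m'" using m by (cases m) auto
    have g_low: "g (Suc m) j = lower (u' m) z j" if "j < T" for j
      using u'(2) that unfolding agree_Suc m' bubble_last z_def by simp
    have "ascent e j \<le> ascent (g (Suc m)) j"
    proof (rule two_line_fiber_ordered[OF ey(1,2)])
      show "z j" if "j < T" "g (Suc m) j" for j using g_low that by (simp add: lower_def)
      show "ascent e T \<le> ascent (g (Suc m)) T" using ey(3) Suc.prems(2)[of "Suc m"] by simp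
    qed (use g_g that in auto)
    also have "\<dots> = ascent (lower (u' m) z) j" using g_low that by (intro ascent_cong) auto
    also have "\<dots> \<le> ascent (u' m) j" by (rule ascent_lower_le)
    finally show ?thesis .
  qed
  have ord: "ordered_slopes (Suc m) T u"
    unfolding ordered_slopes_def
  proof (intro allI impI)
    fix l j assume l: "1 \<le> l" "l < Suc m" "j \<le> T"
    show "ascent (u (Suc l)) j \<le> ascent (u l) j"
    proof (cases "l = m")
      case False
      then show ?thesis using u'(1) l by (auto simp: u_def ordered_slopes_def)
    qed (use e_le l in \<open>auto simp: u_def\<close>)
  qed
  have "\<forall>l\<in>{1..Suc m}. ascent (u l) T = a l"
    using u'(3) ey(3) by (auto simp: u_def le_Suc_eq)
  then show ?case using ag ord by blast
qed

lemma bubble_fiber_unique: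
  assumes "agree (Suc m) T (bubble m u) (bubble m v)" "\<And>l. l \<in> {1..m} \<Longrightarrow> ascent (u l) T = ascent (v l) T"
  shows "agree (Suc m) T u v"
  using assms
proof (induction m arbitrary: u v)
  case (Suc m)
  have "agree (Suc m) T (bubble m (pitman (Suc m) u)) (bubble m (pitman (Suc m) v))"
    using agree_less[OF Suc.prems(1)] by simp
  then have pit: "agree (Suc m) T (pitman (Suc m) u) (pitman (Suc m) v)"
    by (rule Suc.IH) (use Suc.prems(2) in \<open>auto simp: pitman_def\<close>)
  have up: "upper (u (Suc m)) (u (Suc (Suc m))) j = upper (v (Suc m)) (v (Suc (Suc m))) j" if "j < T" for j
    using pit that by (auto simp: agree_def pitman_def dest: bspec[of _ _ "Suc m"])
  have low: "lower (u (Suc m)) (u (Suc (Suc m))) j = lower (v (Suc m)) (v (Suc (Suc m))) j" if "j < T" for j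
    using Suc.prems(1) that unfolding agree_def bubble_last[symmetric] by auto
  have "u (Suc m) j = v (Suc m) j \<and> u (Suc (Suc m)) j = v (Suc (Suc m)) j" if "j < T" for j
    by (rule two_line_fiber_unique[OF up low _ that]) (use Suc.prems(2) in auto)
  moreover have "u l j = v l j" if "l \<in> {1..m}" "j < T" for l j
  proof -
    have "pitman (Suc m) u l j = pitman (Suc m) v l j" using pit that by (auto simp: agree_def)
    then show ?thesis using that by (simp add: pitman_def)
  qed
  ultimately show ?case by (auto simp: agree_def le_Suc_eq)
qed (simp add: agree_def)

text \<open>Each two-line step conserves the total; this lets the ascents of the inserted line be
  read off from the endpoints.\<close>

lemma sum_ascent_bubble:
  "(\<Sum>l\<in>{1..Suc m}. ascent (bubble m u l) T) = (\<Sum>l\<in>{1..Suc m}. ascent (u l) T)"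
proof (induction m arbitrary: u)
  case (Suc m)
  let ?u = "pitman (Suc m) u"
  have "(\<Sum>l\<in>{1..Suc (Suc m)}. ascent (bubble (Suc m) u l) T) =
     (\<Sum>l\<in>{1..Suc m}. ascent (?u l) T) + ascent (?u (Suc (Suc m))) T"
    using Suc.IH[of ?u] bubble_beyond[of m "Suc (Suc m)" ?u] by simp
  also have "\<dots> = (\<Sum>l\<in>{1..m}. ascent (u l) T) + (ascent (u (Suc m)) T + ascent (u (Suc (Suc m))) T)"
    unfolding ascent_upper_lower[of "u (Suc m)" "u (Suc (Suc m))" T, symmetric]
    by (simp add: pitman_def)
  finally show ?case by simp
qed simp

text \<open>Being \<open>False\<close> outside the window makes the set finite and turns
  \<open>agree n T\<close> between its members into equality.\<close>

definition slope_arrays :: "nat \<Rightarrow> nat \<Rightarrow> (nat \<Rightarrow> nat \<Rightarrow> bool) set" where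
  "slope_arrays n T = {x. \<forall>l j. x l j \<longrightarrow> l \<in> {1..n} \<and> j < T}"

lemma finite_slope_arrays: "finite (slope_arrays n T)"
proof (rule finite_subset)
  show "slope_arrays n T \<subseteq> (\<lambda>S l j. (l, j) \<in> S) ` Pow ({1..n} \<times> {..<T})"
  proof
    fix x assume "x \<in> slope_arrays n T"
    then have "x = (\<lambda>l j. (l, j) \<in> {(l, j). x l j})" "{(l, j). x l j} \<in> Pow ({1..n} \<times> {..<T})"
      by (auto simp: slope_arrays_def)
    then show "x \<in> (\<lambda>S l j. (l, j) \<in> S) ` Pow ({1..n} \<times> {..<T})" by blast
  qed
qed auto

text \<open>The total weight of all slope arrays whose melon is \<open>g\<close>, where line \<open>l\<close> carries a weight that depends
  only on its number of ascents.\<close>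

definition melon_weight :: "(nat \<Rightarrow> nat \<Rightarrow> real) \<Rightarrow> nat \<Rightarrow> nat \<Rightarrow> (nat \<Rightarrow> nat \<Rightarrow> bool) \<Rightarrow> real" where
  "melon_weight c n T g =
    (\<Sum>x\<in>{x\<in>slope_arrays n T. agree n T (slope_melon n x) g}. \<Prod>l\<in>{1..n}. c l (ascent (x l) T))"

text \<open>By uniqueness of the inverse insertion, \<open>g\<close> and \<open>a\<close> leave only
  \<open>u\<close> as melon of the first \<open>n\<close> lines and the slopes of
  \<open>u (Suc n)\<close> for the last line. So the sum factorizes, and conservation of ascents
  expresses the last factor by endpoints alone.\<close>

lemma melon_weight_Suc:
  assumes u: "ordered_slopes n T u" "agree (Suc n) T (bubble n u) g"
    and a: "\<And>l. l \<in> {1..n} \<Longrightarrow> ascent (u l) T = a l"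
  shows "(\<Sum>x\<in>{x\<in>slope_arrays (Suc n) T. agree (Suc n) T (slope_melon (Suc n) x) g \<and>
       (\<forall>l\<in>{1..n}. ascent (slope_melon n x l) T = a l)}. \<Prod>l\<in>{1..Suc n}. c l (ascent (x l) T)) =
    melon_weight c n T u * c (Suc n) ((\<Sum>l\<in>{1..Suc n}. ascent (g l) T) - (\<Sum>l\<in>{1..n}. a l))"
    (is "sum ?F ?X = _")
proof -
  define y where "y = (\<lambda>j. j < T \<and> u (Suc n) j)"
  let ?Z = "{x\<in>slope_arrays n T. agree n T (slope_melon n x) u}"
  have char: "agree (Suc n) T (slope_melon (Suc n) x) g \<and> (\<forall>l\<in>{1..n}. ascent (slope_melon n x l) T = a l)
     \<longleftrightarrow> agree n T (slope_melon n x) u \<and> (\<forall>j<T. x (Suc n) j = u (Suc n) j)" (is "?L \<longleftrightarrow> ?R") for x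
  proof -
    have "?R \<longleftrightarrow> agree (Suc n) T (slope_melon n x) u"
      using slope_melon_beyond[of n "Suc n" x] by (simp add: agree_Suc)
    also have "\<dots> \<longleftrightarrow> ?L"
    proof
      assume ag: "agree (Suc n) T (slope_melon n x) u"
      then have "agree (Suc n) T (bubble n (slope_melon n x)) g"
        using agree_trans[OF agree_bubble[OF ag order_refl] u(2)] by simp
      then show ?L using agree_ascent[OF ag] a by simp
    next
      assume L: ?L
      then have "agree (Suc n) T (bubble n (slope_melon n x)) (bubble n u)"
        using agree_trans[OF _ agree_sym[OF u(2)]] by simp
      then show "agree (Suc n) T (slope_melon n x) u"
        by (rule bubble_fiber_unique) (use L a in auto)
    qed
    finally show ?thesis by simp
  qed
  have cong: "agree n T (slope_melon n (x(Suc n := v))) u \<longleftrightarrow> agree n T (slope_melon n x) u" for x v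
  proof -
    have "agree n T (x(Suc n := v)) x" by (auto simp: agree_def)
    from agree_slope_melon[OF this order_refl] show ?thesis by (meson agree_trans agree_sym)
  qed
  have "(\<Sum>l\<in>{1..Suc n}. ascent (g l) T) = (\<Sum>l\<in>{1..Suc n}. ascent (bubble n u l) T)"
    using agree_ascent[OF u(2)] by (intro sum.cong) auto
  also have "\<dots> = (\<Sum>l\<in>{1..n}. a l) + ascent (u (Suc n)) T"
    unfolding sum_ascent_bubble using a by simp
  also have "ascent (u (Suc n)) T = ascent y T" by (intro ascent_cong) (simp add: y_def)
  finally have y_asc: "ascent y T = (\<Sum>l\<in>{1..Suc n}. ascent (g l) T) - (\<Sum>l\<in>{1..n}. a l)" by simp
  have "sum ?F ?X = (\<Sum>x\<in>?Z. (\<Prod>l\<in>{1..n}. c l (ascent (x l) T)) * c (Suc n) (ascent y T))"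
  \<comment> \<open>One direction erases the last line, the other one restores it as
    \<open>y\<close>.\<close>
  proof (rule sum.reindex_bij_witness[where i = "\<lambda>x. x(Suc n := y)" and j = "\<lambda>x. x(Suc n := \<lambda>_. False)"])
    fix x assume x: "x \<in> ?X"
    then have x': "agree n T (slope_melon n x) u" "\<And>j. j < T \<Longrightarrow> x (Suc n) j = u (Suc n) j" "x \<in> slope_arrays (Suc n) T"
      using char[of x] by auto
    have xy: "x (Suc n) = y"
      using x'(2,3) by (auto simp: y_def slope_arrays_def fun_eq_iff)
    show "(x(Suc n := \<lambda>_. False))(Suc n := y) = x" using xy by auto
    show "x(Suc n := \<lambda>_. False) \<in> ?Z"
      using x' cong[of x] by (auto simp: slope_arrays_def le_Suc_eq)
    have "(\<Prod>l\<in>{1..n}. c l (ascent ((x(Suc n := \<lambda>_. False)) l) T)) = (\<Prod>l\<in>{1..n}. c l (ascent (x l) T))"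
      by (intro prod.cong) auto
    then show "(\<Prod>l\<in>{1..n}. c l (ascent ((x(Suc n := \<lambda>_. False)) l) T)) * c (Suc n) (ascent y T) = ?F x"
      using xy by simp
  next
    fix x assume x: "x \<in> ?Z"
    then have "x (Suc n) j \<Longrightarrow> Suc n \<in> {1..n}" for j unfolding slope_arrays_def by blast
    then have "x (Suc n) = (\<lambda>_. False)" by auto
    then show "(x(Suc n := y))(Suc n := \<lambda>_. False) = x" by auto
    have "x(Suc n := y) \<in> slope_arrays (Suc n) T" using x by (auto simp: slope_arrays_def y_def intro: le_SucI)
    moreover have "agree n T (slope_melon n (x(Suc n := y))) u \<and> (\<forall>j<T. (x(Suc n := y)) (Suc n) j = u (Suc n) j)"
      using x cong[of x y] by (simp add: y_def)
    ultimately show "x(Suc n := y) \<in> ?X" using char[of "x(Suc n := y)"] by blast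
  qed
  then show ?thesis unfolding melon_weight_def y_asc sum_distrib_right .
qed

text \<open>The endpoints \<open>a\<close> of the melon of the first \<open>n\<close> lines range over all vectors that interlace with the
  endpoints of \<open>g\<close>, and each of them determines the melon of the first \<open>n\<close> lines and the last line.\<close>

theorem melon_weight_endpoint:
  assumes "ordered_slopes n T g" "ordered_slopes n T g'" "\<And>l. l \<in> {1..n} \<Longrightarrow> ascent (g l) T = ascent (g' l) T"
  shows "melon_weight c n T g = melon_weight c n T g'"
  using assms
proof (induction n arbitrary: g g')
  case 0
  then show ?case by (simp add: melon_weight_def agree_def)
next
  case (Suc n)
  \<comment> \<open>Only the endpoints of \<open>g\<close> enter, so the same index set serves for
    \<open>g'\<close>.\<close>
  define A where "A = (\<Pi>\<^sub>E l\<in>{1..n}. {ascent (g (Suc l)) T..ascent (g l) T})"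
  have "finite A" unfolding A_def by (intro finite_PiE) auto
  let ?X = "\<lambda>g. {x\<in>slope_arrays (Suc n) T. agree (Suc n) T (slope_melon (Suc n) x) g}"
  define ep where "ep x = (\<lambda>l\<in>{1..n}. ascent (slope_melon n x l) T)" for x
  let ?F = "\<lambda>x. \<Prod>l\<in>{1..Suc n}. c l (ascent (x l) T)"
  have split: "melon_weight c (Suc n) T h = (\<Sum>a\<in>A. \<Sum>x\<in>{x\<in>slope_arrays (Suc n) T. agree (Suc n) T (slope_melon (Suc n) x) h \<and>
       (\<forall>l\<in>{1..n}. ascent (slope_melon n x l) T = a l)}. ?F x)"
    if h: "\<And>l. l \<in> {1..Suc n} \<Longrightarrow> ascent (g l) T = ascent (h l) T" for h
  proof -
    have "ep ` ?X h \<subseteq> A"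
    proof (rule image_subsetI)
      fix x assume "x \<in> ?X h"
      then have ag: "agree (Suc n) T (bubble n (slope_melon n x)) h" by simp
      have "ascent (g (Suc l)) T \<le> ascent (slope_melon n x l) T \<and> ascent (slope_melon n x l) T \<le> ascent (g l) T"
        if l: "l \<in> {1..n}" for l
        using bubble_interlace[OF ordered_slope_melon[of n T x], of l T] l h[of l] h[of "Suc l"]
          agree_ascent[OF ag, of l T] agree_ascent[OF ag, of "Suc l" T] by auto
      then show "ep x \<in> A" unfolding ep_def A_def by auto
    qed
    then have "melon_weight c (Suc n) T h = (\<Sum>a\<in>A. \<Sum>x\<in>{x\<in>?X h. ep x = a}. ?F x)"
      unfolding melon_weight_def
      using \<open>finite A\<close> finite_slope_arrays by (intro sum.group[symmetric]) auto
    also have "\<dots> = (\<Sum>a\<in>A. \<Sum>x\<in>{x\<in>slope_arrays (Suc n) T. agree (Suc n) T (slope_melon (Suc n) x) h \<and>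
       (\<forall>l\<in>{1..n}. ascent (slope_melon n x l) T = a l)}. ?F x)"
    proof (intro sum.cong refl)
      fix a assume "a \<in> A"
      then have "a \<in> extensional {1..n}" by (auto simp: A_def PiE_def)
      then have "ep x = a \<longleftrightarrow> (\<forall>l\<in>{1..n}. ascent (slope_melon n x l) T = a l)" for x
        by (auto simp: ep_def extensional_def fun_eq_iff restrict_def)
      then show "{x\<in>?X h. ep x = a} = {x\<in>slope_arrays (Suc n) T. agree (Suc n) T (slope_melon (Suc n) x) h \<and>
       (\<forall>l\<in>{1..n}. ascent (slope_melon n x l) T = a l)}" by blast
    qed
    finally show ?thesis .
  qed
  have "melon_weight c (Suc n) T g = (\<Sum>a\<in>A. \<Sum>x\<in>{x\<in>slope_arrays (Suc n) T. agree (Suc n) T (slope_melon (Suc n) x) g \<and>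
       (\<forall>l\<in>{1..n}. ascent (slope_melon n x l) T = a l)}. ?F x)"
    by (rule split) simp
  also have "\<dots> = (\<Sum>a\<in>A. \<Sum>x\<in>{x\<in>slope_arrays (Suc n) T. agree (Suc n) T (slope_melon (Suc n) x) g' \<and>
       (\<forall>l\<in>{1..n}. ascent (slope_melon n x l) T = a l)}. ?F x)"
  proof (intro sum.cong[OF refl])
    fix a assume a: "a \<in> A"
    have a': "ascent (g (Suc l)) T \<le> a l \<and> a l \<le> ascent (g l) T" if "l \<in> {1..n}" for l
      using PiE_mem[OF a[unfolded A_def] that] by simp
    then have a'': "ascent (g' (Suc l)) T \<le> a l \<and> a l \<le> ascent (g' l) T" if "l \<in> {1..n}" for l
      using Suc.prems(3)[of l] Suc.prems(3)[of "Suc l"] that a'[OF that] by simp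
    obtain u where u: "ordered_slopes n T u" "agree (Suc n) T (bubble n u) g" "\<And>l. l \<in> {1..n} \<Longrightarrow> ascent (u l) T = a l"
      using bubble_fiber_exists[of n T g a, OF Suc.prems(1) a'] by blast
    obtain u' where u': "ordered_slopes n T u'" "agree (Suc n) T (bubble n u') g'" "\<And>l. l \<in> {1..n} \<Longrightarrow> ascent (u' l) T = a l"
      using bubble_fiber_exists[of n T g' a, OF Suc.prems(2) a''] by blast
    have "melon_weight c n T u = melon_weight c n T u'"
      by (rule Suc.IH[OF u(1) u'(1)]) (simp add: u(3) u'(3))
    moreover have "(\<Sum>l\<in>{1..Suc n}. ascent (g l) T) = (\<Sum>l\<in>{1..Suc n}. ascent (g' l) T)"
      using Suc.prems(3) by (intro sum.cong) auto
    ultimately have eq: "melon_weight c n T u * c (Suc n) ((\<Sum>l\<in>{1..Suc n}. ascent (g l) T) - (\<Sum>l\<in>{1..n}. a l)) =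
      melon_weight c n T u' * c (Suc n) ((\<Sum>l\<in>{1..Suc n}. ascent (g' l) T) - (\<Sum>l\<in>{1..n}. a l))"
      by (simp only:)
    show "(\<Sum>x\<in>{x\<in>slope_arrays (Suc n) T. agree (Suc n) T (slope_melon (Suc n) x) g \<and>
       (\<forall>l\<in>{1..n}. ascent (slope_melon n x l) T = a l)}. ?F x) =
      (\<Sum>x\<in>{x\<in>slope_arrays (Suc n) T. agree (Suc n) T (slope_melon (Suc n) x) g' \<and>
       (\<forall>l\<in>{1..n}. ascent (slope_melon n x l) T = a l)}. ?F x)"
    proof (rule trans[OF _ trans[OF eq]])
      show "(\<Sum>x\<in>{x\<in>slope_arrays (Suc n) T. agree (Suc n) T (slope_melon (Suc n) x) g \<and>
         (\<forall>l\<in>{1..n}. ascent (slope_melon n x l) T = a l)}. ?F x) =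
        melon_weight c n T u * c (Suc n) ((\<Sum>l\<in>{1..Suc n}. ascent (g l) T) - (\<Sum>l\<in>{1..n}. a l))"
        by (rule melon_weight_Suc[of n T u g a c, OF u(1,2)]) (rule u(3))
      show "melon_weight c n T u' * c (Suc n) ((\<Sum>l\<in>{1..Suc n}. ascent (g' l) T) - (\<Sum>l\<in>{1..n}. a l)) =
        (\<Sum>x\<in>{x\<in>slope_arrays (Suc n) T. agree (Suc n) T (slope_melon (Suc n) x) g' \<and>
         (\<forall>l\<in>{1..n}. ascent (slope_melon n x l) T = a l)}. ?F x)"
        by (rule melon_weight_Suc[of n T u' g' a c, OF u'(1,2), symmetric]) (rule u'(3))
    qed
  qed
  also have "\<dots> = melon_weight c (Suc n) T g'"
    by (rule split[symmetric]) (rule Suc.prems(3))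
  finally show ?case .
qed

section \<open>Asymptotic slopes\<close>

definition has_rate :: "(nat \<Rightarrow> bool) \<Rightarrow> real \<Rightarrow> bool" where
  "has_rate x r \<longleftrightarrow> (\<lambda>j. ascent x j / j) \<longlonglongrightarrow> r"

lemma ascent_le: "ascent x j \<le> j"
  by (induction j) (auto simp: of_bool_def)

text \<open>The witness is the time just after the last idle step, or 0 if there is none: the queue
  is empty there, which gives \<open>ascent b\<close>, and afterwards \<open>upper\<close> copies
  \<open>a\<close>.\<close>

lemma ascent_upper_attained:
  "\<exists>s\<le>j. real (ascent (upper a b) j) = real (ascent b s) + ascent a j - ascent a s"
proof (induction j)
  case (Suc j)
  show ?case
  proof (cases "idle a b j")
    case True
    then have "queue a b (Suc j) = 0" by (simp add: idle_def)
    then have "ascent (upper a b) (Suc j) = ascent b (Suc j)"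
      using ascent_lower_queue[of a "Suc j" b] ascent_upper_lower[of a b "Suc j"] by linarith
    then show ?thesis by (intro exI[of _ "Suc j"]) simp
  next
    case False
    then have "upper a b j = a j" by (auto simp: upper_def)
    then show ?thesis using Suc by (auto intro: le_SucI)
  qed
qed simp

text \<open>To first order \<open>\<beta> * s + \<alpha> * (j - s)\<close> is to be maximized over
  \<open>s \<le> j\<close>, which happens at an end of the range. For \<open>s \<ge> J\<close> the
  errors are proportional to \<open>s\<close> and \<open>j\<close>; smaller \<open>s\<close> cost at
  most \<open>J\<close>, which is negligible against \<open>j\<close>.\<close>

lemma has_rate_upper:
  assumes "has_rate a \<alpha>" "has_rate b \<beta>"
  shows "has_rate (upper a b) (max \<alpha> \<beta>)"
  unfolding has_rate_def
proof (rule LIMSEQ_I)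
  fix e :: real assume e: "0 < e"
  \<comment> \<open>The bounds below lose at most \<open>4 * \<epsilon> * j\<close>, half of what is
    allowed.\<close>
  define \<epsilon> where "\<epsilon> = e / 8"
  have \<epsilon>: "0 < \<epsilon>" using e by (simp add: \<epsilon>_def)
  obtain J1 where J1: "\<And>j. j \<ge> J1 \<Longrightarrow> \<bar>ascent a j / j - \<alpha>\<bar> < \<epsilon>"
    using LIMSEQ_D[OF assms(1)[unfolded has_rate_def] \<epsilon>] by auto
  obtain J2 where J2: "\<And>j. j \<ge> J2 \<Longrightarrow> \<bar>ascent b j / j - \<beta>\<bar> < \<epsilon>"
    using LIMSEQ_D[OF assms(2)[unfolded has_rate_def] \<epsilon>] by auto
  define J where "J = Suc (max J1 J2)"
  have a: "\<bar>ascent a j - \<alpha> * j\<bar> \<le> \<epsilon> * j" if "j \<ge> J" for j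
  proof -
    have "\<bar>ascent a j / j - \<alpha>\<bar> * j \<le> \<epsilon> * j" using less_imp_le[OF J1[of j]] that by (intro mult_right_mono) (auto simp: J_def)
    moreover have "\<bar>ascent a j / j - \<alpha>\<bar> * j = \<bar>ascent a j - \<alpha> * j\<bar>"
      using that by (simp add: J_def abs_mult_pos left_diff_distrib)
    ultimately show ?thesis by simp
  qed
  have b: "\<bar>ascent b j - \<beta> * j\<bar> \<le> \<epsilon> * j" if "j \<ge> J" for j
  proof -
    have "\<bar>ascent b j / j - \<beta>\<bar> * j \<le> \<epsilon> * j" using less_imp_le[OF J2[of j]] that by (intro mult_right_mono) (auto simp: J_def)
    moreover have "\<bar>ascent b j / j - \<beta>\<bar> * j = \<bar>ascent b j - \<beta> * j\<bar>"
      using that by (simp add: J_def abs_mult_pos left_diff_distrib)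
    ultimately show ?thesis by simp
  qed
  obtain K where K: "real J / \<epsilon> < real K" using reals_Archimedean2 by blast
  show "\<exists>N. \<forall>j\<ge>N. norm (ascent (upper a b) j / j - max \<alpha> \<beta>) < e"
  proof (intro exI[of _ "J + K"] allI impI)
    fix j assume j: "j \<ge> J + K"
    then have j0: "0 < real j" "j \<ge> J" by (auto simp: J_def)
    have Jj: "real J \<le> \<epsilon> * j"
    proof -
      have "real J \<le> \<epsilon> * K" using K \<epsilon> by (simp add: field_simps)
      also have "\<dots> \<le> \<epsilon> * j" using j \<epsilon> by (intro mult_left_mono) auto
      finally show ?thesis .
    qed
    have "ascent a j \<le> ascent (upper a b) j"
      unfolding ascent_def by (intro sum_mono) (auto simp: upper_def)
    moreover have "ascent b j \<le> ascent (upper a b) j"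
      using ascent_upper_lower[of a b j] ascent_lower_le[of a b j] by linarith
    ultimately have lo: "max \<alpha> \<beta> * j - \<epsilon> * j \<le> ascent (upper a b) j"
      using a[OF j0(2)] b[OF j0(2)] by (auto simp: max_def abs_le_iff)
    obtain s where s: "s \<le> j" "real (ascent (upper a b) j) = real (ascent b s) + ascent a j - ascent a s"
      using ascent_upper_attained by blast
    have hi: "ascent (upper a b) j \<le> max \<alpha> \<beta> * j + 4 * \<epsilon> * j"
    proof (cases "s \<ge> J")
      case True
      have "real (ascent (upper a b) j) \<le> (\<beta> - \<alpha>) * s + 2 * (\<epsilon> * s) + \<alpha> * j + \<epsilon> * j"
        using a[OF j0(2)] a[OF True] b[OF True] s(2) by (simp add: abs_le_iff algebra_simps)
      also have "(\<beta> - \<alpha>) * s \<le> max 0 (\<beta> - \<alpha>) * j"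
        using s(1) by (intro mult_mono) auto
      also have "\<epsilon> * s \<le> \<epsilon> * j" using s(1) \<epsilon> by simp
      also have "max 0 (\<beta> - \<alpha>) * j + 2 * (\<epsilon> * j) + \<alpha> * j + \<epsilon> * j = max \<alpha> \<beta> * j + 3 * \<epsilon> * j"
        by (simp add: max_def algebra_simps)
      also have "\<dots> \<le> max \<alpha> \<beta> * j + 4 * \<epsilon> * j" using \<epsilon> by simp
      finally show ?thesis by simp
    next
      case False
      then have "real (ascent b s) \<le> J" using ascent_le[of b s] by simp
      then have "real (ascent (upper a b) j) \<le> J + ascent a j" using s(2) by simp
      also have "\<dots> \<le> \<epsilon> * j + (\<alpha> * j + \<epsilon> * j)" using Jj a[OF j0(2)] by (auto simp: abs_le_iff)
      also have "\<dots> \<le> max \<alpha> \<beta> * j + 4 * \<epsilon> * j"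
      proof -
        have "\<alpha> * j \<le> max \<alpha> \<beta> * j" by (intro mult_right_mono) auto
        moreover have "0 \<le> \<epsilon> * j" using \<epsilon> by simp
        ultimately show ?thesis by simp
      qed
      finally show ?thesis by simp
    qed
    have "\<bar>ascent (upper a b) j - max \<alpha> \<beta> * j\<bar> \<le> 4 * \<epsilon> * j"
      using lo hi \<epsilon> j0 by (simp add: abs_le_iff)
    then have "\<bar>ascent (upper a b) j / j - max \<alpha> \<beta>\<bar> \<le> 4 * \<epsilon>"
      using j0 by (simp add: abs_le_iff field_simps)
    then show "norm (ascent (upper a b) j / j - max \<alpha> \<beta>) < e" using e by (simp add: \<epsilon>_def)
  qed
qed

lemma has_rate_lower:
  assumes "has_rate a \<alpha>" "has_rate b \<beta>"
  shows "has_rate (lower a b) (min \<alpha> \<beta>)"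
proof -
  have "(\<lambda>j. ascent a j / j + ascent b j / j - ascent (upper a b) j / j) \<longlonglongrightarrow> \<alpha> + \<beta> - max \<alpha> \<beta>"
    using assms has_rate_upper[OF assms] unfolding has_rate_def by (intro tendsto_intros)
  moreover have "ascent a j / j + ascent b j / j - ascent (upper a b) j / j = ascent (lower a b) j / j" for j
  proof -
    have "real (ascent a j) + ascent b j = real (ascent (upper a b) j) + ascent (lower a b) j"
      using ascent_upper_lower[of a b j] by linarith
    then show ?thesis by (metis add_diff_cancel_left' add_divide_distrib)
  qed
  moreover have "\<alpha> + \<beta> - max \<alpha> \<beta> = min \<alpha> \<beta>" by (simp add: min_def max_def)
  ultimately show ?thesis by (simp add: has_rate_def)
qed

section \<open>Sorting of the rates\<close>

definition has_rates :: "nat \<Rightarrow> (nat \<Rightarrow> nat \<Rightarrow> bool) \<Rightarrow> (nat \<Rightarrow> real) \<Rightarrow> bool" where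
  "has_rates n u d \<longleftrightarrow> (\<forall>l\<in>{1..n}. has_rate (u l) (d l))"

lemma has_rates_pitman:
  assumes "has_rates n u d" "1 \<le> i" "Suc i \<le> n"
  shows "\<exists>p. p permutes {1..n} \<and> has_rates n (pitman i u) (d \<circ> p)"
proof -
  have r: "has_rate (u i) (d i)" "has_rate (u (Suc i)) (d (Suc i))" using assms by (auto simp: has_rates_def)
  note r' = has_rate_upper[OF r] has_rate_lower[OF r]
  show ?thesis
  proof (cases "d (Suc i) \<le> d i")
    case True
    then show ?thesis using assms r'
      by (intro exI[of _ id]) (auto simp: has_rates_def pitman_def permutes_id max_absorb1 min_absorb2)
  next
    case False
    then show ?thesis using assms r'
      by (intro exI[of _ "Transposition.transpose i (Suc i)"])
         (auto simp: has_rates_def pitman_def permutes_swap_id max_absorb2 min_absorb1 Transposition.transpose_def)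
  qed
qed

lemma has_rates_bubble:
  assumes "has_rates n u d" "Suc m \<le> n"
  shows "\<exists>p. p permutes {1..n} \<and> has_rates n (bubble m u) (d \<circ> p)"
  using assms
proof (induction m arbitrary: u d)
  case 0
  then show ?case by (intro exI[of _ id] conjI permutes_id) simp
next
  case (Suc m)
  obtain p where p: "p permutes {1..n}" "has_rates n (pitman (Suc m) u) (d \<circ> p)"
    using has_rates_pitman[OF Suc.prems(1), of "Suc m"] Suc.prems(2) by auto
  obtain q where q: "q permutes {1..n}" "has_rates n (bubble m (pitman (Suc m) u)) (d \<circ> p \<circ> q)"
    using Suc.IH[OF p(2) Suc_leD[OF Suc.prems(2)]] by blast
  then show ?case
    using permutes_compose[OF q(1) p(1)] by (metis o_assoc bubble.simps(2))
qed

lemma has_rates_slope_melon: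
  assumes "has_rates n u d" "m \<le> n"
  shows "\<exists>p. p permutes {1..n} \<and> has_rates n (slope_melon m u) (d \<circ> p)"
  using assms(2)
proof (induction m)
  case 0
  then show ?case using assms(1) by (intro exI[of _ id] conjI permutes_id) simp
next
  case (Suc m)
  obtain p where p: "p permutes {1..n}" "has_rates n (slope_melon m u) (d \<circ> p)"
    using Suc.IH[OF Suc_leD[OF Suc.prems]] by blast
  obtain q where q: "q permutes {1..n}" "has_rates n (bubble m (slope_melon m u)) (d \<circ> p \<circ> q)"
    using has_rates_bubble[OF p(2) Suc.prems] by blast
  then show ?case
    using permutes_compose[OF q(1) p(1)] by (metis o_assoc slope_melon.simps(2))
qed

lemma decreasing_rearrangement_unique:
  assumes "p permutes {1..n}" "\<And>k l. 1 \<le> k \<Longrightarrow> k \<le> l \<Longrightarrow> l \<le> n \<Longrightarrow> d (p l) \<le> d (p k)" "k \<in> {1..n}"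
  shows "decreasing_rearrangement n d k = d (p k)"
proof -
  let ?xs = "map (d \<circ> p) [1..<Suc n]"
  have m: "mset [1..<Suc n] = mset_set {1..n}"
    by (simp only: mset_upt atLeastLessThanSuc_atLeastAtMost)
  have "mset ?xs = image_mset d (image_mset p (mset_set {1..n}))"
    by (simp only: mset_map m multiset.map_comp)
  also have "image_mset p (mset_set {1..n}) = mset_set {1..n}"
    using permutes_inj_on[OF assms(1)] permutes_image[OF assms(1)] by (simp add: image_mset_mset_set)
  also have "image_mset d \<dots> = mset (map d [1..<Suc n])"
    by (simp only: mset_map m)
  finally have "mset ?xs = mset (map d [1..<Suc n])" .
  then have "mset (rev ?xs) = mset (map d [1..<Suc n])" by (simp only: mset_rev)
  moreover have "sorted (rev ?xs)"
    unfolding sorted_rev_iff_nth_mono using assms(2) by (auto simp del: upt_Suc)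
  ultimately have "sort (map d [1..<Suc n]) = rev ?xs" by (intro properties_for_sort) auto
  then have "decreasing_rearrangement n d k = ?xs ! (k - 1)" by (simp add: decreasing_rearrangement_def del: upt_Suc)
  also have "\<dots> = d (p k)" using assms(3) by (auto simp del: upt_Suc)
  finally show ?thesis .
qed

text \<open>The route of each rate through the insertions need not be traced: the final rates are a
  permutation of \<open>d\<close>, and the order of the lines makes them decreasing.\<close>

lemma has_rates_decreasing_rearrangement:
  assumes "has_rates n u d"
  shows "has_rates n (slope_melon n u) (decreasing_rearrangement n d)"
proof -
  obtain p where p: "p permutes {1..n}" "has_rates n (slope_melon n u) (d \<circ> p)"
    using has_rates_slope_melon[OF assms order_refl] by blast
  have step: "d (p (Suc l)) \<le> d (p l)" if "1 \<le> l" "l < n" for l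
  proof (rule LIMSEQ_le)
    show "(\<lambda>j. ascent (slope_melon n u (Suc l)) j / j) \<longlonglongrightarrow> d (p (Suc l))"
      "(\<lambda>j. ascent (slope_melon n u l) j / j) \<longlonglongrightarrow> d (p l)"
      using p(2) that by (auto simp: has_rates_def has_rate_def)
    have "ascent (slope_melon n u (Suc l)) j \<le> ascent (slope_melon n u l) j" for j
      using ordered_slope_melon[of n j u] that by (simp add: ordered_slopes_def)
    then show "\<exists>N. \<forall>j\<ge>N. ascent (slope_melon n u (Suc l)) j / j \<le> real (ascent (slope_melon n u l) j) / j"
      by (auto intro!: divide_right_mono)
  qed
  have "d (p l) \<le> d (p k)" if "1 \<le> k" "k \<le> l" "l \<le> n" for k l
    using that(2,3)
  proof (induction l rule: dec_induct)
    case (step l')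
    then show ?case using \<open>1 \<le> k\<close> \<open>\<And>l. 1 \<le> l \<Longrightarrow> l < n \<Longrightarrow> d (p (Suc l)) \<le> d (p l)\<close>[of l'] by auto
  qed simp
  then have "decreasing_rearrangement n d k = d (p k)" if "k \<in> {1..n}" for k
    using decreasing_rearrangement_unique[of p n d k, OF p(1) _ that] by blast
  then show ?thesis
    using p(2) by (simp add: has_rates_def)
qed

lemma has_rate_interp:
  assumes "has_rate x r"
  shows "((\<lambda>s. interp x s / s) \<longlongrightarrow> r) at_top"
proof -
  define J where "J s = nat \<lfloor>s\<rfloor>" for s :: real
  have J: "real (J s) \<le> s \<and> s < real (J s) + 1" if "0 \<le> s" for s
    using that unfolding J_def by linarith
  have lim: "filterlim J sequentially at_top"
    unfolding J_def by (rule filterlim_compose[OF filterlim_nat_sequentially filterlim_floor_sequentially])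
  have inv: "((\<lambda>s::real. 1 / s) \<longlongrightarrow> 0) at_top" by real_asymp
  have 1: "((\<lambda>s. ascent x (J s) / J s) \<longlongrightarrow> r) at_top"
    using filterlim_compose[OF assms[unfolded has_rate_def] lim] .
  have 2: "((\<lambda>s. J s / s) \<longlongrightarrow> 1) at_top"
  proof (rule tendsto_sandwich)
    show "\<forall>\<^sub>F s in at_top. 1 - 1 / s \<le> real (J s) / s"
      using eventually_gt_at_top[of 0]
    proof eventually_elim
      case (elim s)
      then have "(s - 1) / s \<le> real (J s) / s" using J[of s] by (intro divide_right_mono) auto
      then show ?case using elim by (simp add: diff_divide_distrib)
    qed
    show "\<forall>\<^sub>F s in at_top. real (J s) / s \<le> 1"
      using eventually_gt_at_top[of 0] by eventually_elim (use J in \<open>auto simp: field_simps\<close>)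
    show "((\<lambda>s::real. 1 - 1 / s) \<longlongrightarrow> 1) at_top" by real_asymp
  qed simp
  have 3: "((\<lambda>s. (interp x s - ascent x (J s)) / s) \<longlongrightarrow> 0) at_top"
  proof (rule tendsto_sandwich[OF _ _ tendsto_const inv])
    have "interp x s - ascent x (J s) \<in> {0..1}" if "0 \<le> s" for s
      using J[OF that] interp_segment[of "J s" s x] by auto
    then have diff: "0 \<le> interp x s - ascent x (J s)" "interp x s - ascent x (J s) \<le> 1" if "0 < s" for s
      using that less_imp_le[OF that] by (auto simp only: atLeastAtMost_iff)
    show "\<forall>\<^sub>F s in at_top. 0 \<le> (interp x s - ascent x (J s)) / s"
      using eventually_gt_at_top[of 0] by eventually_elim (intro divide_nonneg_pos diff)
    show "\<forall>\<^sub>F s in at_top. (interp x s - ascent x (J s)) / s \<le> 1 / s"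
      using eventually_gt_at_top[of 0] by eventually_elim (intro divide_right_mono diff less_imp_le)
  qed
  have "((\<lambda>s. ascent x (J s) / J s * (J s / s) + (interp x s - ascent x (J s)) / s) \<longlongrightarrow> r * 1 + 0) at_top"
    by (intro tendsto_intros 1 2 3)
  moreover have "\<forall>\<^sub>F s in at_top. ascent x (J s) / J s * (J s / s) + (interp x s - ascent x (J s)) / s = interp x s / s"
    using eventually_ge_at_top[of 1]
  proof eventually_elim
    case (elim s)
    then have "J s \<noteq> 0" using J[of s] by linarith
    then show ?case using elim by (simp add: field_simps)
  qed
  ultimately show ?thesis by (simp add: filterlim_cong)
qed

section \<open>Strong law for a single walk\<close>

lemma ascent_slopes:
  assumes "g \<in> bernoulli_paths {0..}"
  shows "real (ascent (slopes g) j) = g (real j)"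
    "of_bool (slopes g j) = g (real j + 1) - g (real j)"
proof -
  show *: "real (ascent (slopes g) j) = g (real j)" for j
    using bernoulli_path_interp_ge0[OF assms, of "real j"] by simp
  show "of_bool (slopes g j) = g (real j + 1) - g (real j)"
    using *[of j] *[of "Suc j"] by (simp add: add.commute)
qed

lemma bernoulli_walk_paths:
  assumes "bernoulli_walk M \<delta> Z" "\<omega> \<in> space M"
  shows "Z \<omega> \<in> bernoulli_paths {0..}"
proof -
  have "Z \<omega> \<in> space (restrict_space (path_space {0..}) (bernoulli_paths {0..}))"
    using assms unfolding bernoulli_walk_def by (auto dest: measurable_space)
  then show ?thesis by (simp add: space_restrict_space)
qed

text \<open>Hoeffding's inequality makes the probabilities of large deviations summable, and
  Borel-Cantelli applies for each threshold \<open>1 / real (Suc k)\<close>.\<close>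

lemma bernoulli_walk_rate:
  assumes M: "prob_space M" and Z: "bernoulli_walk M \<delta> Z" and \<delta>: "\<delta> \<in> {0..1}"
  shows "AE \<omega> in M. has_rate (slopes (Z \<omega>)) \<delta>"
proof -
  interpret prob_space M by (rule M)
  define D where "D j \<omega> = Z \<omega> (real j + 1) - Z \<omega> (real j)" for j \<omega>
  have indep: "indep_vars (\<lambda>_. borel) D UNIV" and dist: "\<And>j. distr M borel (D j) = distr (bernoulli_pmf \<delta>) borel of_bool"
    using Z by (auto simp: bernoulli_walk_def D_def[abs_def])
  have [measurable]: "D j \<in> borel_measurable M" for j
    using indep by (auto simp: indep_vars_def)
  have Dx: "D j \<omega> = of_bool (slopes (Z \<omega>) j)" if "\<omega> \<in> space M" for j \<omega>
    using ascent_slopes(2)[OF bernoulli_walk_paths[OF Z that]] by (simp add: D_def)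
  have "expectation (D 0) = (\<integral>x. x \<partial>distr M borel (D 0))" by (subst integral_distr) auto
  also have "\<dots> = (\<integral>b. of_bool b \<partial>bernoulli_pmf \<delta>)" unfolding dist by (subst integral_distr) auto
  also have "\<dots> = \<delta>" using \<delta> by simp
  finally have ED: "expectation (D 0) = \<delta>" .
  define B where "B k m = {\<omega>\<in>space M. 1 / real (Suc k) \<le> \<bar>(\<Sum>i<m. D i \<omega>) / m - \<delta>\<bar>}" for k m
  have "AE \<omega> in M. eventually (\<lambda>m. \<omega> \<in> space M - B k m) sequentially" for k
  proof (rule borel_cantelli_AE1)
    show "B k m \<in> sets M" for m unfolding B_def by measurable
    show "summable (\<lambda>m. measure M (B k m))"
    proof (rule summable_comparison_test_ev)
      \<comment> \<open>The factor per step in Hoeffding's bound for increments in an interval of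
        length 1.\<close>
      define c where "c = exp (-2 * (1 / real (Suc k))\<^sup>2)"
      show "summable (\<lambda>m. 2 * c ^ m)"
        by (intro summable_mult summable_geometric) (simp add: c_def)
      show "\<forall>\<^sub>F m in sequentially. norm (measure M (B k m)) \<le> 2 * c ^ m"
        using eventually_gt_at_top[of 0]
      proof eventually_elim
        case (elim m)
        interpret H: Hoeffding_ineq_iid M "{..<m}" D "D 0" 0 1 "expectation (D 0)"
        proof unfold_locales
          show "indep_vars (\<lambda>_. borel) D {..<m}" by (rule indep_vars_subset[OF indep]) auto
          show "AE x in M. D 0 x \<in> {0..1}" by (rule AE_I2) (simp add: Dx)
        qed (auto simp: dist)
        have "measure M (B k m) \<le> 2 * exp (-2 * m * (1 / real (Suc k))\<^sup>2)"
          using H.Hoeffding_ineq_abs_ge'[of "1 / real (Suc k)"] elim by (simp add: B_def ED lessThan_empty_iff)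
        also have "exp (-2 * m * (1 / real (Suc k))\<^sup>2) = c ^ m"
          unfolding c_def by (simp flip: exp_of_nat_mult)
        finally show ?case by simp
      qed
    qed
  qed (simp add: emeasure_eq_measure)
  then have "AE \<omega> in M. \<forall>k. eventually (\<lambda>m. \<omega> \<in> space M - B k m) sequentially"
    by (simp add: AE_all_countable)
  then show ?thesis
  proof (rule AE_mp, intro AE_I2 impI)
    fix \<omega> assume \<omega>: "\<omega> \<in> space M" and ev: "\<forall>k. eventually (\<lambda>m. \<omega> \<in> space M - B k m) sequentially"
    have sum: "(\<Sum>i<m. D i \<omega>) = ascent (slopes (Z \<omega>)) m" for m
      using Dx[OF \<omega>] by (simp add: ascent_def)
    show "has_rate (slopes (Z \<omega>)) \<delta>"
      unfolding has_rate_def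
    proof (rule tendstoI)
      fix e :: real assume "0 < e"
      then obtain k where k: "1 / real (Suc k) < e" using reals_Archimedean by (metis inverse_eq_divide)
      show "\<forall>\<^sub>F m in sequentially. dist (ascent (slopes (Z \<omega>)) m / m) \<delta> < e"
        using ev[rule_format, of k]
        by eventually_elim (use k \<omega> sum in \<open>auto simp: B_def dist_real_def\<close>)
    qed
  qed
qed

section \<open>The law of the melon of independent walks\<close>

lemma ordered_slopes_ascent:
  assumes "ordered_slopes n T x" "1 \<le> i" "i \<le> l" "l \<le> n" "j \<le> T"
  shows "ascent (x l) j \<le> ascent (x i) j"
  using assms(3,4)
proof (induction l rule: dec_induct)
  case (step l)
  have "ascent (x (Suc l)) j \<le> ascent (x l) j"
    using assms step by (simp add: ordered_slopes_def)
  then show ?case using step by simp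
qed simp

definition interp_tuple :: "nat \<Rightarrow> (nat \<Rightarrow> nat \<Rightarrow> bool) \<Rightarrow> nat \<Rightarrow> real \<Rightarrow> real" where
  "interp_tuple n x = (\<lambda>k\<in>{1..n}. \<lambda>s\<in>{0..}. interp (x k) s)"

lemma interp_tuple_apply [simp]: "k \<in> {1..n} \<Longrightarrow> 0 \<le> s \<Longrightarrow> interp_tuple n x k s = interp (x k) s"
  by (simp add: interp_tuple_def)

lemma slopes_interp_tuple:
  assumes "k \<in> {1..n}"
  shows "slopes (interp_tuple n x k) = x k"
proof -
  have "slopes (interp_tuple n x k) = slopes (interp (x k))"
    by (intro ext) (simp only: slopes_def interp_tuple_apply[OF assms] of_nat_0_le_iff add_nonneg_nonneg zero_le_one)
  then show ?thesis by simp
qed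

text \<open>Only countable quantifiers remain, as needed for the measurability of the event.\<close>

lemma has_rate_iff:
  "has_rate x r \<longleftrightarrow> (\<forall>k. \<exists>N. \<forall>m\<ge>N. \<bar>real (ascent x m) / m - r\<bar> < 1 / real (Suc k))"
proof
  assume x: "has_rate x r"
  show "\<forall>k. \<exists>N. \<forall>m\<ge>N. \<bar>real (ascent x m) / m - r\<bar> < 1 / real (Suc k)"
  proof
    fix k
    show "\<exists>N. \<forall>m\<ge>N. \<bar>real (ascent x m) / m - r\<bar> < 1 / real (Suc k)"
      using LIMSEQ_D[OF x[unfolded has_rate_def], of "1 / real (Suc k)"] by simp
  qed
next
  assume *: "\<forall>k. \<exists>N. \<forall>m\<ge>N. \<bar>real (ascent x m) / m - r\<bar> < 1 / real (Suc k)"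
  show "has_rate x r" unfolding has_rate_def
  proof (rule LIMSEQ_I)
    fix e :: real assume "0 < e"
    then obtain k where "1 / real (Suc k) < e" using reals_Archimedean by (metis inverse_eq_divide)
    moreover obtain N where "\<forall>m\<ge>N. \<bar>real (ascent x m) / m - r\<bar> < 1 / real (Suc k)" using * by blast
    ultimately show "\<exists>N. \<forall>m\<ge>N. norm (real (ascent x m) / m - r) < e"
      by (metis less_trans real_norm_def)
  qed
qed

lemma measurable_eval:
  assumes "i \<in> {1..n}" "0 \<le> s"
  shows "(\<lambda>X. X i s) \<in> borel_measurable (ordered_bernoulli_space n)"
proof -
  have "(\<lambda>X. X i) \<in> tuple_space n {0..} \<rightarrow>\<^sub>M path_space {0..}"
    unfolding tuple_space_def using assms(1) by (rule measurable_component_singleton)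
  moreover have "(\<lambda>g. g s) \<in> path_space {0..} \<rightarrow>\<^sub>M borel"
    unfolding path_space_def using assms(2) by (intro measurable_component_singleton) auto
  ultimately show ?thesis
    unfolding ordered_bernoulli_space_def by (rule measurable_restrict_space1[OF measurable_compose])
qed

lemma interp_tuple_ordered:
  assumes "\<And>T. ordered_slopes n T x"
  shows "interp_tuple n x \<in> ordered_bernoulli_tuples n {0..}"
proof -
  have "interp_tuple n x \<in> {1..n} \<rightarrow>\<^sub>E bernoulli_paths {0..}"
    unfolding interp_tuple_def by (auto intro!: interp_bernoulli_path)
  moreover have "interp (x j) s \<le> interp (x i) s" if "i \<in> {1..n}" "j \<in> {1..n}" "i \<le> j" for i j s
    unfolding interp_def using that ordered_slopes_ascent[OF assms]
    by (intro weighted_ascent_mono unit_weights_clamp) auto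
  ultimately show ?thesis by (auto simp: ordered_bernoulli_tuples_def)
qed

lemma slope_melon_ordered_tuple: "interp_tuple n (slope_melon n u) \<in> ordered_bernoulli_tuples n {0..}"
  by (intro interp_tuple_ordered ordered_slope_melon)

lemma ordered_tuple_path:
  assumes "X \<in> ordered_bernoulli_tuples n I" "i \<in> {1..n}"
  shows "X i \<in> bernoulli_paths I"
  using assms by (auto simp: ordered_bernoulli_tuples_def)

lemma ordered_tuple_slopes:
  assumes "X \<in> ordered_bernoulli_tuples n {0..}"
  shows "ordered_slopes n T (\<lambda>i. slopes (X i))"
  unfolding ordered_slopes_def
proof (intro allI impI)
  fix l j assume l: "1 \<le> l" "l < n" "j \<le> T"
  then have "X (Suc l) (real j) \<le> X l (real j)"
    using assms by (simp add: ordered_bernoulli_tuples_def)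
  then have "real (ascent (slopes (X (Suc l))) j) \<le> real (ascent (slopes (X l)) j)"
    using l ascent_slopes(1)[OF ordered_tuple_path[OF assms]] by simp
  then show "ascent (slopes (X (Suc l))) j \<le> ascent (slopes (X l)) j" by simp
qed

lemma ordered_tuple_agree:
  assumes "X \<in> ordered_bernoulli_tuples n {0..}" "X' \<in> ordered_bernoulli_tuples n {0..}"
  shows "agree n T (\<lambda>i. slopes (X i)) (\<lambda>i. slopes (X' i)) \<longleftrightarrow> (\<forall>i\<in>{1..n}. \<forall>j\<le>T. X i (real j) = X' i (real j))"
    (is "?L \<longleftrightarrow> ?R")
proof
  assume L: ?L
  show ?R
  proof (intro ballI allI impI)
    fix i j assume i: "i \<in> {1..n}" "j \<le> T"
    from agree_ascent[OF L i] show "X i (real j) = X' i (real j)"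
      using ascent_slopes(1)[OF ordered_tuple_path[OF assms(1) i(1)]] ascent_slopes(1)[OF ordered_tuple_path[OF assms(2) i(1)]]
      by metis
  qed
next
  assume R: ?R
  show ?L unfolding agree_def
  proof (intro ballI allI impI)
    fix i j assume i: "i \<in> {1..n}" "j < T"
    then have "X i (real j) = X' i (real j)" "X i (real (Suc j)) = X' i (real (Suc j))"
      using R Suc_leI less_imp_le by blast+
    then show "slopes (X i) j = slopes (X' i) j" by (simp add: slopes_def add.commute)
  qed
qed

definition bernoulli_weight :: "real \<Rightarrow> nat \<Rightarrow> nat \<Rightarrow> real" where
  "bernoulli_weight \<delta> T k = \<delta> ^ k * (1 - \<delta>) ^ (T - k)"

lemma prod_bernoulli_weight:
  "(\<Prod>j<T. if x j then \<delta> else 1 - \<delta>) = bernoulli_weight \<delta> T (ascent x T)"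
proof (induction T)
  case (Suc T)
  have "Suc T - ascent x T = Suc (T - ascent x T)" using ascent_le[of x T] by simp
  then show ?case using Suc by (simp add: bernoulli_weight_def)
qed (simp add: bernoulli_weight_def)

lemma bernoulli_walk_prob:
  assumes M: "prob_space M" and Z: "bernoulli_walk M \<delta> Z" and \<delta>: "\<delta> \<in> {0..1}"
  shows "measure M {\<omega>\<in>space M. \<forall>j<T. slopes (Z \<omega>) j = x j} = bernoulli_weight \<delta> T (ascent x T)"
proof -
  interpret prob_space M by (rule M)
  define D where "D j \<omega> = Z \<omega> (real j + 1) - Z \<omega> (real j)" for j \<omega>
  have indep: "indep_vars (\<lambda>_. borel) D UNIV" and dist: "\<And>j. distr M borel (D j) = distr (bernoulli_pmf \<delta>) borel of_bool"
    using Z by (auto simp: bernoulli_walk_def D_def[abs_def])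
  have D[measurable]: "D j \<in> borel_measurable M" for j
    using indep by (auto simp: indep_vars_def)
  define A where "A j = (if x j then {1} else - {1 :: real})" for j
  have A: "A j \<in> sets borel" for j by (simp add: A_def)
  have one: "prob (D j -` A j \<inter> space M) = (if x j then \<delta> else 1 - \<delta>)" for j
  proof -
    have "prob (D j -` A j \<inter> space M) = measure (distr M borel (D j)) (A j)"
      using A by (subst measure_distr) auto
    also have "\<dots> = measure (bernoulli_pmf \<delta>) {b. (of_bool b :: real) \<in> A j}"
      unfolding dist using A by (subst measure_distr) (auto simp: vimage_def)
    also have "{b. (of_bool b :: real) \<in> A j} = {x j}"
      by (auto simp: A_def split: if_splits)
    also have "measure (bernoulli_pmf \<delta>) {x j} = (if x j then \<delta> else 1 - \<delta>)"
      using \<delta> by (auto simp: measure_pmf_single)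
    finally show ?thesis .
  qed
  show ?thesis
  proof (cases "T = 0")
    case True
    then show ?thesis by (simp add: bernoulli_weight_def prob_space)
  next
    case False
    have "{\<omega>\<in>space M. \<forall>j<T. slopes (Z \<omega>) j = x j} = (\<Inter>j\<in>{..<T}. D j -` A j \<inter> space M)"
      using False by (auto simp: A_def slopes_def D_def split: if_splits)
    also have "prob \<dots> = (\<Prod>j<T. prob (D j -` A j \<inter> space M))"
      using False A by (intro indep_varsD[OF indep]) (auto simp: lessThan_empty_iff)
    finally show ?thesis by (simp add: one prod_bernoulli_weight)
  qed
qed

definition truncate :: "nat \<Rightarrow> nat \<Rightarrow> (nat \<Rightarrow> nat \<Rightarrow> bool) \<Rightarrow> nat \<Rightarrow> nat \<Rightarrow> bool" where
  "truncate n T u l j \<longleftrightarrow> l \<in> {1..n} \<and> j < T \<and> u l j"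

lemma truncate_slope_arrays: "truncate n T u \<in> slope_arrays n T"
  by (auto simp: slope_arrays_def truncate_def)

lemma agree_truncate: "agree n T u (truncate n T u)"
  by (auto simp: agree_def truncate_def)

lemma agree_slope_arrays_eq:
  "x \<in> slope_arrays n T \<Longrightarrow> y \<in> slope_arrays n T \<Longrightarrow> agree n T x y \<Longrightarrow> x = y"
  unfolding slope_arrays_def agree_def by (intro ext) blast

section \<open>Independent walks and the events of their melon on a finite window\<close>

locale independent_walks = prob_space M for M :: "'a measure" +
  fixes n :: nat and d :: "nat \<Rightarrow> real" and Y :: "'a \<Rightarrow> nat \<Rightarrow> real \<Rightarrow> real"
  assumes n: "1 \<le> n"
    and drift: "\<And>i. i \<in> {1..n} \<Longrightarrow> d i \<in> {0..1}"
    and walk: "\<And>i. i \<in> {1..n} \<Longrightarrow> bernoulli_walk M (d i) (\<lambda>\<omega>. Y \<omega> i)"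
    and indep: "indep_vars (\<lambda>_. path_space {0..}) (\<lambda>i \<omega>. Y \<omega> i) {1..n}"
begin

definition U :: "'a \<Rightarrow> nat \<Rightarrow> nat \<Rightarrow> bool" where
  "U \<omega> l = slopes (Y \<omega> l)"

lemma melon_Y: "\<omega> \<in> space M \<Longrightarrow> melon n (Y \<omega>) = interp_tuple n (slope_melon n (U \<omega>))"
  using bernoulli_walk_paths[OF walk] melon_eq_interp[of n "Y \<omega>"]
  unfolding interp_tuple_def U_def[abs_def] by simp

lemma sets_slope_event:
  assumes "l \<in> {1..n}"
  shows "{\<omega>\<in>space M. U \<omega> l j = b} \<in> sets M"
proof -
  have "indep_vars (\<lambda>_. borel) (\<lambda>j \<omega>. Y \<omega> l (real j + 1) - Y \<omega> l (real j)) UNIV"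
    using walk[OF assms] by (simp add: bernoulli_walk_def)
  then have [measurable]: "(\<lambda>\<omega>. Y \<omega> l (real j + 1) - Y \<omega> l (real j)) \<in> borel_measurable M"
    by (auto simp: indep_vars_def)
  show ?thesis unfolding U_def slopes_def by measurable
qed

lemma sets_agree_U: "{\<omega>\<in>space M. agree n T (U \<omega>) x} \<in> sets M"
proof -
  have "{\<omega>\<in>space M. agree n T (U \<omega>) x} = {\<omega>\<in>space M. \<forall>l\<in>{1..n}. \<forall>j\<in>{..<T}. U \<omega> l j = x l j}"
    by (auto simp: agree_def)
  also have "\<dots> \<in> sets M"
    by (intro sets.sets_Collect_finite_All sets_slope_event) auto
  finally show ?thesis .
qed

lemma prob_agree_U: "prob {\<omega>\<in>space M. agree n T (U \<omega>) x} = (\<Prod>l\<in>{1..n}. bernoulli_weight (d l) T (ascent (x l) T))"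
proof -
  define A where "A l = {g\<in>space (path_space {0..}). \<forall>j<T. slopes g j = x l j}" for l
  have A: "A l \<in> sets (path_space {0..})" for l
    unfolding A_def slopes_def path_space_def by measurable
  have "{\<omega>\<in>space M. agree n T (U \<omega>) x} = (\<Inter>l\<in>{1..n}. (\<lambda>\<omega>. Y \<omega> l) -` A l \<inter> space M)"
  proof -
    have "Y \<omega> l \<in> space (path_space {0..})" if "l \<in> {1..n}" "\<omega> \<in> space M" for l \<omega>
      using indep that by (auto simp: indep_vars_def dest: measurable_space)
    then show ?thesis using n by (auto simp: A_def agree_def U_def)
  qed
  also have "prob \<dots> = (\<Prod>l\<in>{1..n}. prob ((\<lambda>\<omega>. Y \<omega> l) -` A l \<inter> space M))"
    using A n by (intro indep_varsD[OF indep]) auto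
  also have "\<dots> = (\<Prod>l\<in>{1..n}. bernoulli_weight (d l) T (ascent (x l) T))"
  proof (intro prod.cong refl)
    fix l assume l: "l \<in> {1..n}"
    have "Y \<omega> l \<in> space (path_space {0..})" if "\<omega> \<in> space M" for \<omega>
      using indep l that by (auto simp: indep_vars_def dest: measurable_space)
    then have "(\<lambda>\<omega>. Y \<omega> l) -` A l \<inter> space M = {\<omega>\<in>space M. \<forall>j<T. slopes (Y \<omega> l) j = x l j}"
      by (auto simp: A_def)
    then show "prob ((\<lambda>\<omega>. Y \<omega> l) -` A l \<inter> space M) = bernoulli_weight (d l) T (ascent (x l) T)"
      using bernoulli_walk_prob[OF prob_space_axioms walk[OF l] drift[OF l]] by simp
  qed
  finally show ?thesis .
qed

text \<open>The melon up to \<open>T\<close> depends on the input slopes up to \<open>T\<close>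
  only, so its events are finite unions of input events, whose probabilities are products.\<close>

lemma slope_melon_event:
  "{\<omega>\<in>space M. agree n T (slope_melon n (U \<omega>)) g} =
    (\<Union>x\<in>{x\<in>slope_arrays n T. agree n T (slope_melon n x) g}. {\<omega>\<in>space M. agree n T (U \<omega>) x})"
proof (intro equalityI subsetI)
  fix \<omega> assume \<omega>: "\<omega> \<in> {\<omega>\<in>space M. agree n T (slope_melon n (U \<omega>)) g}"
  let ?x = "truncate n T (U \<omega>)"
  have "agree n T (slope_melon n ?x) (slope_melon n (U \<omega>))"
    by (intro agree_slope_melon agree_sym[OF agree_truncate] order_refl)
  then have "agree n T (slope_melon n ?x) g" by (rule agree_trans) (use \<omega> in simp)
  then show "\<omega> \<in> (\<Union>x\<in>{x\<in>slope_arrays n T. agree n T (slope_melon n x) g}. {\<omega>\<in>space M. agree n T (U \<omega>) x})"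
    using \<omega> by (intro UN_I[of ?x] CollectI conjI truncate_slope_arrays agree_truncate) auto
next
  fix \<omega> assume "\<omega> \<in> (\<Union>x\<in>{x\<in>slope_arrays n T. agree n T (slope_melon n x) g}. {\<omega>\<in>space M. agree n T (U \<omega>) x})"
  then show "\<omega> \<in> {\<omega>\<in>space M. agree n T (slope_melon n (U \<omega>)) g}"
    using agree_trans[OF agree_slope_melon[OF _ order_refl]] by blast
qed

lemma sets_slope_melon_agree: "{\<omega>\<in>space M. agree n T (slope_melon n (U \<omega>)) g} \<in> sets M"
  unfolding slope_melon_event
  by (rule sets.finite_UN) (simp_all add: sets_agree_U finite_slope_arrays)

lemma prob_slope_melon:
  "prob {\<omega>\<in>space M. agree n T (slope_melon n (U \<omega>)) g} = melon_weight (\<lambda>l. bernoulli_weight (d l) T) n T g"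
  unfolding slope_melon_event melon_weight_def prob_agree_U[symmetric]
proof (rule finite_measure_finite_Union)
  show "finite {x \<in> slope_arrays n T. agree n T (slope_melon n x) g}" using finite_slope_arrays by simp
  show "(\<lambda>x. {\<omega> \<in> space M. agree n T (U \<omega>) x}) ` {x \<in> slope_arrays n T. agree n T (slope_melon n x) g} \<subseteq> sets M"
    using sets_agree_U by blast
  show "disjoint_family_on (\<lambda>x. {\<omega> \<in> space M. agree n T (U \<omega>) x}) {x \<in> slope_arrays n T. agree n T (slope_melon n x) g}"
    unfolding disjoint_family_on_def
  proof (intro ballI impI equals0I)
    fix x y \<omega>
    assume xy: "x \<in> {x \<in> slope_arrays n T. agree n T (slope_melon n x) g}" "y \<in> {x \<in> slope_arrays n T. agree n T (slope_melon n x) g}"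
      "x \<noteq> y" and \<omega>: "\<omega> \<in> {\<omega> \<in> space M. agree n T (U \<omega>) x} \<inter> {\<omega> \<in> space M. agree n T (U \<omega>) y}"
    have "agree n T (U \<omega>) x" "agree n T (U \<omega>) y" using \<omega> by simp_all
    then have "agree n T x y" using agree_trans[OF agree_sym] by metis
    then show False using agree_slope_arrays_eq[of x n T y] xy by simp
  qed
qed

lemma measurable_melon: "(\<lambda>\<omega>. melon n (Y \<omega>)) \<in> M \<rightarrow>\<^sub>M ordered_bernoulli_space n"
proof -
  have ev: "{\<omega>\<in>space M. slope_melon n (U \<omega>) l j} \<in> sets M" if l: "l \<in> {1..n}" for l j
  proof -
    have "{\<omega>\<in>space M. slope_melon n (U \<omega>) l j} =
      (\<Union>x\<in>{x\<in>slope_arrays n (Suc j). x l j}. {\<omega>\<in>space M. agree n (Suc j) (slope_melon n (U \<omega>)) x})"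
    proof (intro equalityI subsetI)
      fix \<omega> assume \<omega>: "\<omega> \<in> {\<omega>\<in>space M. slope_melon n (U \<omega>) l j}"
      have "truncate n (Suc j) (slope_melon n (U \<omega>)) l j" using \<omega> l by (simp add: truncate_def)
      then show "\<omega> \<in> (\<Union>x\<in>{x\<in>slope_arrays n (Suc j). x l j}. {\<omega>\<in>space M. agree n (Suc j) (slope_melon n (U \<omega>)) x})"
        using \<omega> by (intro UN_I[of "truncate n (Suc j) (slope_melon n (U \<omega>))"] CollectI conjI truncate_slope_arrays agree_truncate) auto
    qed (use l in \<open>auto simp: agree_def\<close>)
    also have "\<dots> \<in> sets M"
      by (rule sets.finite_UN) (simp_all add: sets_slope_melon_agree finite_slope_arrays)
    finally show ?thesis .
  qed
  have "(\<lambda>\<omega>. interp (slope_melon n (U \<omega>) l) s) \<in> borel_measurable M" if "l \<in> {1..n}" for l s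
  proof -
    have [measurable]: "Measurable.pred M (\<lambda>\<omega>. slope_melon n (U \<omega>) l j)" for j
      using ev[OF that] by (simp add: pred_def)
    show ?thesis unfolding interp_def weighted_ascent_def of_bool_def by measurable
  qed
  then have "(\<lambda>\<omega>. interp_tuple n (slope_melon n (U \<omega>))) \<in> M \<rightarrow>\<^sub>M tuple_space n {0..}"
    unfolding interp_tuple_def tuple_space_def path_space_def by (intro measurable_restrict)
  then have "(\<lambda>\<omega>. interp_tuple n (slope_melon n (U \<omega>))) \<in> M \<rightarrow>\<^sub>M ordered_bernoulli_space n"
    unfolding ordered_bernoulli_space_def
    using slope_melon_ordered_tuple by (intro measurable_restrict_space2) auto
  then show ?thesis by (subst measurable_cong[OF melon_Y])
qed

definition \<mu> :: "(nat \<Rightarrow> real \<Rightarrow> real) measure" where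
  "\<mu> = distr M (ordered_bernoulli_space n) (\<lambda>\<omega>. melon n (Y \<omega>))"

lemma melon_rates:
  "AE X in \<mu>. \<forall>i\<in>{1..n}. ((\<lambda>t. X i t / t) \<longlongrightarrow> decreasing_rearrangement n d i) at_top"
proof -
  let ?S = "ordered_bernoulli_space n"
  let ?e = "decreasing_rearrangement n d"
  \<comment> \<open>The rates are transferred to the image measure through integer times, where they
    form a measurable event; on Bernoulli paths this event implies the limit along the
    reals.\<close>
  define Q where "Q X \<longleftrightarrow> (\<forall>i\<in>{1..n}. \<forall>k. \<exists>N. \<forall>m\<ge>N. \<bar>X i (real m) / m - ?e i\<bar> < 1 / real (Suc k))"
    for X :: "nat \<Rightarrow> real \<Rightarrow> real"
  have Q_iff: "Q X \<longleftrightarrow> (\<forall>i\<in>{1..n}. has_rate (slopes (X i)) (?e i))" if "X \<in> ordered_bernoulli_tuples n {0..}" for X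
    unfolding Q_def has_rate_iff using ascent_slopes(1)[OF ordered_tuple_path[OF that]] by simp
  have "{X\<in>space ?S. Q X} \<in> sets ?S"
    unfolding Q_def
  proof (intro sets.sets_Collect_finite_All sets.sets_Collect_countable_All sets.sets_Collect_countable_Ex)
    fix i k N m assume i: "i \<in> {1..n}"
    note [measurable] = measurable_eval[OF i, of "real m", OF of_nat_0_le_iff]
    show "{X\<in>space ?S. N \<le> m \<longrightarrow> \<bar>X i (real m) / m - ?e i\<bar> < 1 / real (Suc k)} \<in> sets ?S"
      by measurable
  qed simp
  moreover have "AE \<omega> in M. Q (melon n (Y \<omega>))"
  proof -
    have "AE \<omega> in M. \<forall>l\<in>{1..n}. has_rate (U \<omega> l) (d l)"
      unfolding U_def using walk drift
      by (intro AE_finite_allI bernoulli_walk_rate[OF prob_space_axioms]) auto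
    then show ?thesis
    proof (rule AE_mp, intro AE_I2 impI)
      fix \<omega> assume \<omega>: "\<omega> \<in> space M" and rates: "\<forall>l\<in>{1..n}. has_rate (U \<omega> l) (d l)"
      have "has_rates n (slope_melon n (U \<omega>)) ?e"
        using rates by (intro has_rates_decreasing_rearrangement) (simp add: has_rates_def)
      moreover have "slopes (interp_tuple n (slope_melon n (U \<omega>)) i) = slope_melon n (U \<omega>) i" if "i \<in> {1..n}" for i
        using that by (intro slopes_interp_tuple)
      ultimately show "Q (melon n (Y \<omega>))"
        using Q_iff[OF slope_melon_ordered_tuple[of n "U \<omega>"]] by (simp add: melon_Y[OF \<omega>] has_rates_def)
    qed
  qed
  ultimately have "AE X in \<mu>. Q X"
    unfolding \<mu>_def by (subst AE_distr_iff[OF measurable_melon]) auto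
  moreover have "AE X in \<mu>. X \<in> ordered_bernoulli_tuples n {0..}"
    by (rule AE_I2) (simp add: \<mu>_def space_ordered_bernoulli_space)
  ultimately show ?thesis
  proof eventually_elim
    case (elim X)
    show ?case
    proof
      fix i assume i: "i \<in> {1..n}"
      then have "((\<lambda>s. interp (slopes (X i)) s / s) \<longlongrightarrow> ?e i) at_top"
        using elim Q_iff by (intro has_rate_interp) auto
      moreover have "\<forall>\<^sub>F t in at_top. interp (slopes (X i)) t / t = X i t / t"
        using eventually_ge_at_top[of 0]
        by eventually_elim (simp add: bernoulli_path_interp_ge0[OF ordered_tuple_path[OF elim(2) i]])
      ultimately show "((\<lambda>t. X i t / t) \<longlongrightarrow> ?e i) at_top"
        by (rule Lim_transform_eventually)
    qed
  qed
qed

end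

section \<open>The Gibbs property\<close>

lemma path_segment:
  assumes "g \<in> bernoulli_paths {0..}" "real j \<le> s" "s \<le> real j + 1"
  shows "g s = g (real j) + (g (real j + 1) - g (real j)) * (s - real j)"
proof -
  have "0 \<le> s" using assms(2) by (rule order_trans[OF of_nat_0_le_iff])
  then show ?thesis
    using bernoulli_path_interp_ge0[OF assms(1), of s] interp_segment[OF assms(2,3), of "slopes g"]
      ascent_slopes[OF assms(1), of j] by simp
qed

lemma path_determined:
  assumes g: "g \<in> bernoulli_paths {0..}" "g' \<in> bernoulli_paths {0..}"
    and eq: "\<And>j. j \<in> {t..T} \<Longrightarrow> g (real j) = g' (real j)" and s: "real t \<le> s" "s \<le> real T"
  shows "g s = g' s"
proof -
  have "0 \<le> s" using s(1) by (rule order_trans[OF of_nat_0_le_iff])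
  then obtain j where j: "real j \<le> s" "s < real j + 1" by (rule nat_floor_segment)
  have "real t < real (Suc j)" using s(1) j(2) by simp
  then have tj: "t \<le> j" by simp
  show ?thesis
  proof (cases "s = real j")
    case True
    then show ?thesis using eq[of j] s tj by simp
  next
    case False
    then have "real j < real T" using j s by simp
    then have "j \<in> {t..T}" "Suc j \<in> {t..T}" using tj by auto
    then have "g (real j) = g' (real j)" "g (real j + 1) = g' (real j + 1)"
      using eq[of j] eq[of "Suc j"] by (simp_all add: add.commute)
    then show ?thesis using path_segment[OF g(1), of j s] path_segment[OF g(2), of j s] j by simp
  qed
qed

text \<open>Integer times suffice because they determine a Bernoulli path, and for fixed
  \<open>t\<close> and \<open>T\<close> there are only finitely many cylinders.\<close>

definition cylinder :: "nat \<Rightarrow> nat \<Rightarrow> nat \<Rightarrow> (nat \<Rightarrow> real \<Rightarrow> real) \<Rightarrow> (nat \<Rightarrow> real \<Rightarrow> real) set" where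
  "cylinder n t T X0 =
    {X \<in> ordered_bernoulli_tuples n {0..}. \<forall>i\<in>{1..n}. \<forall>j\<in>{t..T}. X i (real j) = X0 i (real j)}"

text \<open>The empty set is the intersection of incompatible cylinders; with it the generator is
  stable under intersection.\<close>

definition cylinders :: "nat \<Rightarrow> nat \<Rightarrow> (nat \<Rightarrow> real \<Rightarrow> real) set set" where
  "cylinders n t = insert {} {cylinder n t T X0 | T X0. t \<le> T \<and> X0 \<in> ordered_bernoulli_tuples n {0..}}"

lemma cylinder_subset: "cylinder n t T X0 \<subseteq> ordered_bernoulli_tuples n {0..}"
  by (auto simp: cylinder_def)

lemma cylinders_subset: "cylinders n t \<subseteq> Pow (ordered_bernoulli_tuples n {0..})"
  unfolding cylinders_def using cylinder_subset by blast

lemma cylinder_self: "X \<in> ordered_bernoulli_tuples n {0..} \<Longrightarrow> X \<in> cylinder n t T X"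
  by (simp add: cylinder_def)

lemma cylinder_eq: "X \<in> cylinder n t T X0 \<Longrightarrow> cylinder n t T X0 = cylinder n t T X"
  by (auto simp: cylinder_def)

lemma Int_stable_cylinders: "Int_stable (cylinders n t)"
proof (rule Int_stableI)
  fix A B assume A: "A \<in> cylinders n t" and B: "B \<in> cylinders n t"
  show "A \<inter> B \<in> cylinders n t"
  proof (cases "A \<inter> B = {}")
    case False
    then obtain Z where Z: "Z \<in> A" "Z \<in> B" by auto
    from A Z(1) obtain T X where T: "t \<le> T" "A = cylinder n t T X" by (auto simp: cylinders_def)
    from B Z(2) obtain T' X' where T': "t \<le> T'" "B = cylinder n t T' X'" by (auto simp: cylinders_def)
    have "A = cylinder n t T Z" "B = cylinder n t T' Z"
      using Z cylinder_eq unfolding T(2) T'(2) by blast+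
    then have "A \<inter> B = cylinder n t (max T T') Z" by (auto simp: cylinder_def le_max_iff_disj)
    moreover have "Z \<in> ordered_bernoulli_tuples n {0..}" using Z(1) T(2) cylinder_subset by blast
    moreover have "t \<le> max T T'" using T by simp
    ultimately show ?thesis unfolding cylinders_def by blast
  qed (simp add: cylinders_def)
qed

lemma finite_cylinders_upto: "finite (cylinder n t T ` ordered_bernoulli_tuples n {0..})"
proof (rule finite_subset)
  let ?V = "{1..n} \<rightarrow>\<^sub>E ({t..T} \<rightarrow>\<^sub>E real ` {0..T})"
  let ?C = "\<lambda>v. {X \<in> ordered_bernoulli_tuples n {0..}. \<forall>i\<in>{1..n}. \<forall>j\<in>{t..T}. X i (real j) = v i j}"
  show "finite (?C ` ?V)" by (intro finite_imageI finite_PiE) auto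
  show "cylinder n t T ` ordered_bernoulli_tuples n {0..} \<subseteq> ?C ` ?V"
  proof (rule image_subsetI)
    fix X assume X: "X \<in> ordered_bernoulli_tuples n {0..}"
    show "cylinder n t T X \<in> ?C ` ?V"
    proof (rule image_eqI)
      show "cylinder n t T X = ?C (\<lambda>i\<in>{1..n}. \<lambda>j\<in>{t..T}. X i (real j))"
        by (simp add: cylinder_def)
      have "X i (real j) \<in> real ` {0..T}" if "i \<in> {1..n}" "j \<in> {t..T}" for i j
        using ascent_slopes(1)[OF ordered_tuple_path[OF X that(1)], of j, symmetric]
          ascent_le[of "slopes (X i)" j] that(2) by auto
      then show "(\<lambda>i\<in>{1..n}. \<lambda>j\<in>{t..T}. X i (real j)) \<in> ?V" by simp
    qed
  qed
qed

text \<open>The second assumption expresses that membership in \<open>D\<close> depends only on the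
  values at integer times in \<open>{t..T}\<close>; such a \<open>D\<close> is a finite union of
  cylinders.\<close>

lemma cylinder_union_sigma:
  assumes "D \<subseteq> ordered_bernoulli_tuples n {0..}" "\<And>X. X \<in> D \<Longrightarrow> cylinder n t T X \<subseteq> D" "t \<le> T"
  shows "D \<in> sigma_sets (ordered_bernoulli_tuples n {0..}) (cylinders n t)"
proof -
  have "X \<in> cylinder n t T X" if "X \<in> D" for X using that assms(1) by (intro cylinder_self) auto
  then have "D = \<Union>(cylinder n t T ` D)" using assms(2) by (intro equalityI subsetI) auto
  also have "\<dots> \<in> sigma_sets (ordered_bernoulli_tuples n {0..}) (cylinders n t)"
  proof (rule sigma_sets_UNION)
    show "countable (cylinder n t T ` D)"
      using finite_subset[OF image_mono[OF assms(1)] finite_cylinders_upto] by (rule countable_finite)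
    fix B assume "B \<in> cylinder n t T ` D"
    then have "B \<in> cylinders n t" using assms(1,3) by (auto simp: cylinders_def)
    then show "B \<in> sigma_sets (ordered_bernoulli_tuples n {0..}) (cylinders n t)" by (rule sigma_sets.Basic)
  qed
  finally show ?thesis .
qed

lemma space_future_algebra [simp]: "space (future_algebra n t) = ordered_bernoulli_tuples n {0..}"
  by (simp add: future_algebra_def)

lemma restrict_tuple_space:
  "restrict_tuple n I X \<in> space (tuple_space n I)"
  by (auto simp: restrict_tuple_def tuple_space_def path_space_def space_PiM)

lemma cylinder_sets_future: "cylinder n t T X0 \<in> sets (future_algebra n t)"
proof -
  let ?N = "tuple_space n {real t..}"
  have [measurable]: "(\<lambda>Z. Z i (real j)) \<in> borel_measurable ?N" if "i \<in> {1..n}" "j \<in> {t..T}" for i j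
  proof -
    have "(\<lambda>Z. Z i) \<in> ?N \<rightarrow>\<^sub>M path_space {real t..}"
      unfolding tuple_space_def using that(1) by (rule measurable_component_singleton)
    moreover have "(\<lambda>g. g (real j)) \<in> path_space {real t..} \<rightarrow>\<^sub>M borel"
      unfolding path_space_def using that(2) by (intro measurable_component_singleton) auto
    ultimately show ?thesis by (rule measurable_compose)
  qed
  define A where "A = {Z \<in> space ?N. \<forall>i\<in>{1..n}. \<forall>j\<in>{t..T}. Z i (real j) = X0 i (real j)}"
  have "A \<in> sets ?N"
    unfolding A_def by (intro sets.sets_Collect_finite_All) (auto intro!: measurable_sets_borel)
  then have "restrict_tuple n {real t..} -` A \<inter> ordered_bernoulli_tuples n {0..} \<in> sets (future_algebra n t)"
    unfolding future_algebra_def by (rule in_vimage_algebra)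
  also have "restrict_tuple n {real t..} -` A \<inter> ordered_bernoulli_tuples n {0..} = cylinder n t T X0"
    using restrict_tuple_space[of n "{real t..}"]
    by (auto simp: A_def cylinder_def) (auto simp: restrict_tuple_def)
  finally show ?thesis .
qed

text \<open>The value at a real time \<open>s\<close> is determined by the integer times from
  \<open>t\<close> up to the ceiling of \<open>s\<close>, so every coordinate map is measurable for
  the cylinders.\<close>

lemma future_algebra_cylinders:
  "sets (future_algebra n t) \<subseteq> sigma_sets (ordered_bernoulli_tuples n {0..}) (cylinders n t)"
proof -
  let ?\<Omega> = "ordered_bernoulli_tuples n {0..}"
  let ?\<Sigma> = "sigma ?\<Omega> (cylinders n t)"
  have sets: "sets ?\<Sigma> = sigma_sets ?\<Omega> (cylinders n t)" and space: "space ?\<Sigma> = ?\<Omega>"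
    using cylinders_subset by (simp_all add: sets_measure_of space_measure_of)
  have "(\<lambda>X. X i s) \<in> borel_measurable ?\<Sigma>" if i: "i \<in> {1..n}" and s: "real t \<le> s" for i s
  proof (rule measurableI)
    fix A :: "real set" assume "A \<in> sets borel"
    define T where "T = nat \<lceil>s\<rceil>"
    have T: "s \<le> real T" by (simp add: T_def real_nat_ceiling_ge)
    then have "real t \<le> real T" using s by linarith
    then have tT: "t \<le> T" by simp
    have "(\<lambda>X. X i s) -` A \<inter> ?\<Omega> \<in> sigma_sets ?\<Omega> (cylinders n t)"
    proof (rule cylinder_union_sigma[OF _ _ tT])
      fix X assume X: "X \<in> (\<lambda>X. X i s) -` A \<inter> ?\<Omega>"
      show "cylinder n t T X \<subseteq> (\<lambda>X. X i s) -` A \<inter> ?\<Omega>"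
      proof
        fix Z assume Z: "Z \<in> cylinder n t T X"
        have "Z \<in> ?\<Omega>" using Z cylinder_subset by blast
        moreover have "Z i s = X i s"
          by (rule path_determined[OF ordered_tuple_path[OF \<open>Z \<in> ?\<Omega>\<close> i] ordered_tuple_path[OF _ i] _ s T])
             (use X Z i in \<open>auto simp: cylinder_def\<close>)
        ultimately show "Z \<in> (\<lambda>X. X i s) -` A \<inter> ?\<Omega>" using X by auto
      qed
    qed auto
    then show "(\<lambda>X. X i s) -` A \<inter> space ?\<Sigma> \<in> sets ?\<Sigma>" by (simp only: sets space)
  qed simp
  then have meas: "restrict_tuple n {real t..} \<in> ?\<Sigma> \<rightarrow>\<^sub>M tuple_space n {real t..}"
    unfolding restrict_tuple_def[abs_def] tuple_space_def path_space_def by (intro measurable_restrict) auto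
  show ?thesis
    unfolding future_algebra_def sets_vimage_algebra
  proof (rule sigma_sets_mono, clarify)
    fix A assume "A \<in> sets (tuple_space n {real t..})"
    from measurable_sets[OF meas this] show "restrict_tuple n {real t..} -` A \<inter> ?\<Omega> \<in> sigma_sets ?\<Omega> (cylinders n t)"
      by (simp only: sets space)
  qed
qed

section \<open>Gluing a past to a future\<close>

lemma interp_cong:
  assumes "\<And>j. j < T \<Longrightarrow> x j = y j" "s \<le> real T"
  shows "interp x s = interp y s"
  unfolding interp_eq[OF assms(2)] using assms(1) by (intro sum.cong) auto

lemma bridge_path_nat:
  assumes "f \<in> bernoulli_bridges n t x" "i \<in> {1..n}" "j \<le> t"
  shows "f i (real j) = ascent (slopes (f i)) j"
proof -
  have "f i \<in> bernoulli_paths {0..real t}"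
    using assms by (auto simp: bernoulli_bridges_def ordered_bernoulli_tuples_def)
  from bernoulli_path_interp_upto[OF this, of "real j"] show ?thesis using assms(3) by simp
qed

text \<open>The slopes are concatenated at \<open>t\<close>. Since \<open>f\<close> ends where
  \<open>X\<close> stands at time \<open>t\<close>, the glued lines follow \<open>X\<close>
  afterwards and inherit the order from both pieces.\<close>

lemma splice_exists:
  assumes X: "X \<in> ordered_bernoulli_tuples n {0..}" and f: "f \<in> bernoulli_bridges n t (\<lambda>i. X i (real t))"
  shows "\<exists>Z\<in>ordered_bernoulli_tuples n {0..}. \<forall>i\<in>{1..n}.
     (\<forall>j\<le>t. Z i (real j) = f i (real j)) \<and> (\<forall>j\<ge>t. Z i (real j) = X i (real j))"
proof -
  define x where "x i j = (if j < t then slopes (f i) j else slopes (X i) j)" for i j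
  have low: "real (ascent (x i) j) = f i (real j)" if "i \<in> {1..n}" "j \<le> t" for i j
    using bridge_path_nat[OF f that] ascent_cong[of j "x i" "slopes (f i)"] that by (simp add: x_def)
  have high: "real (ascent (x i) j) = X i (real j)" if "i \<in> {1..n}" "t \<le> j" for i j
    using that(2)
  proof (induction j rule: dec_induct)
    case base
    then show ?case using low[OF that(1), of t] f that(1) by (simp add: bernoulli_bridges_def)
  next
    case (step j)
    then show ?case
      using ascent_slopes(2)[OF ordered_tuple_path[OF X that(1)], of j] by (simp add: x_def add.commute)
  qed
  have "ordered_slopes n T x" for T
    unfolding ordered_slopes_def
  proof (intro allI impI)
    fix l j assume l: "1 \<le> l" "l < n" "j \<le> T"
    have "real (ascent (x (Suc l)) j) \<le> real (ascent (x l) j)"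
    proof (cases "j \<le> t")
      case True
      then have "f (Suc l) (real j) \<le> f l (real j)"
        using f l by (auto simp: bernoulli_bridges_def ordered_bernoulli_tuples_def)
      then show ?thesis using low True l by simp
    next
      case False
      have "X (Suc l) (real j) \<le> X l (real j)" using X l by (auto simp: ordered_bernoulli_tuples_def)
      then show ?thesis using high False l by simp
    qed
    then show "ascent (x (Suc l)) j \<le> ascent (x l) j" by simp
  qed
  then have "interp_tuple n x \<in> ordered_bernoulli_tuples n {0..}" by (rule interp_tuple_ordered)
  moreover have "interp_tuple n x i (real j) = ascent (x i) j" if "i \<in> {1..n}" for i j
    using that by (simp only: interp_tuple_apply of_nat_0_le_iff interp_nat)
  ultimately show ?thesis using low high by (intro bexI[of _ "interp_tuple n x"]) auto
qed

lemma restrict_tuple_bridge: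
  assumes "X \<in> ordered_bernoulli_tuples n {0..}"
  shows "restrict_tuple n {0..real t} X \<in> bernoulli_bridges n t (\<lambda>i. X i (real t))"
proof -
  have "restrict (X i) {0..real t} \<in> bernoulli_paths {0..real t}" if "i \<in> {1..n}" for i
  proof -
    have "restrict (X i) {0..real t} = restrict (interp (slopes (X i))) {0..real t}"
      using bernoulli_path_interp_ge0[OF ordered_tuple_path[OF assms that]] by (intro restrict_ext) auto
    then show ?thesis using interp_bernoulli_path[of "{0..real t}" "slopes (X i)"] by simp
  qed
  then have "restrict_tuple n {0..real t} X \<in> {1..n} \<rightarrow>\<^sub>E bernoulli_paths {0..real t}"
    unfolding restrict_tuple_def by auto
  moreover have "\<forall>i\<in>{1..n}. \<forall>j\<in>{1..n}. i \<le> j \<longrightarrow> (\<forall>s\<in>{0..real t}. X j s \<le> X i s)"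
    using assms by (auto simp: ordered_bernoulli_tuples_def)
  ultimately show ?thesis
    by (auto simp: bernoulli_bridges_def ordered_bernoulli_tuples_def restrict_tuple_def)
qed

text \<open>Prescribing the past \<open>f\<close> inside a cylinder of future values leaves a cylinder starting at time 0 with
  the same endpoint, so all bridges are equally likely if the measure of such a cylinder depends on its
  endpoint only.\<close>

lemma bridge_cylinder:
  assumes X: "X \<in> ordered_bernoulli_tuples n {0..}" and f: "f \<in> bernoulli_bridges n t (\<lambda>i. X i (real t))"
    and Z: "Z \<in> ordered_bernoulli_tuples n {0..}"
      "\<And>i j. i \<in> {1..n} \<Longrightarrow> j \<le> t \<Longrightarrow> Z i (real j) = f i (real j)"
      "\<And>i j. i \<in> {1..n} \<Longrightarrow> t \<le> j \<Longrightarrow> Z i (real j) = X i (real j)"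
    and "t \<le> T"
  shows "{W \<in> cylinder n t T X. restrict_tuple n {0..real t} W = f} = cylinder n 0 T Z"
proof (intro equalityI subsetI)
  fix W assume W: "W \<in> {W \<in> cylinder n t T X. restrict_tuple n {0..real t} W = f}"
  have "W i (real j) = Z i (real j)" if "i \<in> {1..n}" "j \<le> T" for i j
  proof (cases "j \<le> t")
    case True
    then have "W i (real j) = restrict_tuple n {0..real t} W i (real j)"
      using that by (simp add: restrict_tuple_def)
    then show ?thesis using W Z(2)[OF that(1) True] by simp
  next
    case False
    then show ?thesis using W Z(3)[OF that(1)] that by (simp add: cylinder_def)
  qed
  then show "W \<in> cylinder n 0 T Z" using W by (auto simp: cylinder_def)
next
  fix W assume W: "W \<in> cylinder n 0 T Z"
  then have W\<Omega>: "W \<in> ordered_bernoulli_tuples n {0..}" using cylinder_subset by blast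
  have WZ: "W i (real j) = Z i (real j)" if "i \<in> {1..n}" "j \<le> T" for i j
    using W that by (simp add: cylinder_def)
  have "restrict_tuple n {0..real t} W i s = f i s" for i s
  proof (cases "i \<in> {1..n} \<and> s \<in> {0..real t}")
    case True
    then have i: "i \<in> {1..n}" and s: "0 \<le> s" "s \<le> real t" by auto
    have fi: "f i \<in> bernoulli_paths {0..real t}"
      using f i by (auto simp: bernoulli_bridges_def ordered_bernoulli_tuples_def)
    have "W i (real j) = f i (real j)" if "j \<le> t" for j
      using WZ[OF i, of j] Z(2)[OF i that] that \<open>t \<le> T\<close> by simp
    from this[of "Suc _"] this have "slopes (W i) j = slopes (f i) j" if "j < t" for j
      using that by (simp add: slopes_def add.commute)
    then have "interp (slopes (W i)) s = interp (slopes (f i)) s" using s(2) by (rule interp_cong)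
    then have "W i s = f i s"
      using bernoulli_path_interp_ge0[OF ordered_tuple_path[OF W\<Omega> i] s(1)] bernoulli_path_interp_upto[OF fi s] by simp
    then show ?thesis using True by (simp add: restrict_tuple_def)
  next
    case False
    have "f \<in> {1..n} \<rightarrow>\<^sub>E bernoulli_paths {0..real t}"
      using f by (auto simp: bernoulli_bridges_def ordered_bernoulli_tuples_def)
    then have "i \<notin> {1..n} \<Longrightarrow> f i = undefined" "i \<in> {1..n} \<Longrightarrow> f i \<in> extensional {0..real t}"
      by (auto simp: PiE_iff extensional_def bernoulli_paths_def)
    then show ?thesis using False by (auto simp: restrict_tuple_def extensional_def)
  qed
  then have "restrict_tuple n {0..real t} W = f" by (intro ext)
  moreover have "W \<in> cylinder n t T X"
    using W\<Omega> WZ Z(3) by (auto simp: cylinder_def)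
  ultimately show "W \<in> {W \<in> cylinder n t T X. restrict_tuple n {0..real t} W = f}" by simp
qed

lemma bridges_cong:
  assumes "\<And>i. i \<in> {1..n} \<Longrightarrow> x i = y i"
  shows "bernoulli_bridges n t x = bernoulli_bridges n t y"
  using assms by (auto simp: bernoulli_bridges_def)

text \<open>The cylinder splits into one piece per bridge. Each piece is a cylinder from time 0
  whose endpoint at \<open>T\<close> is that of \<open>X\<close>, so all pieces have the same
  measure \<open>q\<close> and the probability is a ratio of counts.\<close>

lemma measure_cylinder_bridge:
  assumes \<mu>: "prob_space \<mu>" "sets \<mu> = sets (ordered_bernoulli_space n)"
    and unif: "\<And>T X X'. X \<in> ordered_bernoulli_tuples n {0..} \<Longrightarrow> X' \<in> ordered_bernoulli_tuples n {0..} \<Longrightarrow>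
      (\<And>i. i \<in> {1..n} \<Longrightarrow> X i (real T) = X' i (real T)) \<Longrightarrow>
      measure \<mu> (cylinder n 0 T X) = measure \<mu> (cylinder n 0 T X')"
    and X: "X \<in> ordered_bernoulli_tuples n {0..}" and "t \<le> T"
  shows "measure \<mu> {W \<in> cylinder n t T X. restrict_tuple n {0..real t} W \<in> A} =
    measure \<mu> (cylinder n t T X) * measure (bridge_measure n t (\<lambda>i. X i (real t))) A"
proof -
  interpret prob_space \<mu> by (rule \<mu>(1))
  define B where "B = bernoulli_bridges n t (\<lambda>i. X i (real t))"
  define q where "q = measure \<mu> (cylinder n 0 T X)"
  have fin: "finite B" unfolding B_def by (rule finite_bernoulli_bridges)
  have ne: "B \<noteq> {}" using restrict_tuple_bridge[OF X] by (auto simp: B_def)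
  have cyl_sets: "cylinder n 0 T Z \<in> sets \<mu>" for Z
    using cylinder_sets_future[of n 0 T Z] subalgebra_future_algebra[OF \<mu>(2), of 0] by (auto simp: subalgebra_def)
  have part: "{W \<in> cylinder n t T X. restrict_tuple n {0..real t} W = f} \<in> sets \<mu> \<and>
    measure \<mu> {W \<in> cylinder n t T X. restrict_tuple n {0..real t} W = f} = q" if f: "f \<in> B" for f
  proof -
    obtain Z where Z: "Z \<in> ordered_bernoulli_tuples n {0..}"
      "\<And>i j. i \<in> {1..n} \<Longrightarrow> j \<le> t \<Longrightarrow> Z i (real j) = f i (real j)"
      "\<And>i j. i \<in> {1..n} \<Longrightarrow> t \<le> j \<Longrightarrow> Z i (real j) = X i (real j)"
      using splice_exists[OF X f[unfolded B_def]] by blast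
    have "measure \<mu> (cylinder n 0 T Z) = q"
      unfolding q_def using Z(3) \<open>t \<le> T\<close> by (intro unif Z(1) X) auto
    moreover have "{W \<in> cylinder n t T X. restrict_tuple n {0..real t} W = f} = cylinder n 0 T Z"
      by (rule bridge_cylinder[OF X f[unfolded B_def] Z(1) _ _ \<open>t \<le> T\<close>]) (fact Z(2), fact Z(3))
    ultimately show ?thesis using cyl_sets by simp
  qed
  have count: "measure \<mu> {W \<in> cylinder n t T X. restrict_tuple n {0..real t} W \<in> A} = card (A \<inter> B) * q" for A
  proof -
    have "restrict_tuple n {0..real t} W \<in> B" if "W \<in> cylinder n t T X" for W
    proof -
      have "W \<in> ordered_bernoulli_tuples n {0..}" using that cylinder_subset by blast
      from restrict_tuple_bridge[OF this, of t] show ?thesis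
        using bridges_cong[of n "\<lambda>i. W i (real t)" "\<lambda>i. X i (real t)" t] that \<open>t \<le> T\<close>
        by (simp add: B_def cylinder_def)
    qed
    then have "{W \<in> cylinder n t T X. restrict_tuple n {0..real t} W \<in> A} =
       (\<Union>f\<in>A \<inter> B. {W \<in> cylinder n t T X. restrict_tuple n {0..real t} W = f})" by blast
    also have "measure \<mu> \<dots> = (\<Sum>f\<in>A \<inter> B. measure \<mu> {W \<in> cylinder n t T X. restrict_tuple n {0..real t} W = f})"
      using fin part by (intro finite_measure_finite_Union) (auto simp: disjoint_family_on_def)
    also have "\<dots> = card (A \<inter> B) * q" using part by simp
    finally show ?thesis .
  qed
  have "measure (measure_pmf (bridge_measure n t (\<lambda>i. X i (real t)))) A = real (card (A \<inter> B)) / real (card B)"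
    unfolding bridge_measure_def B_def[symmetric] using measure_pmf_of_set[OF ne fin, of A] by (simp add: Int_commute)
  moreover have "measure \<mu> (cylinder n t T X) = card B * q" using count[of UNIV] by simp
  moreover have "card B \<noteq> 0" using ne fin by simp
  ultimately show ?thesis using count[of A] by simp
qed

section \<open>Conditional expectation given the future\<close>

lemma sets_future_algebra:
  "sets (future_algebra n t) = sigma_sets (ordered_bernoulli_tuples n {0..}) (cylinders n t)"
proof
  have "cylinders n t \<subseteq> sets (future_algebra n t)"
    unfolding cylinders_def using cylinder_sets_future by blast
  from sets.sigma_sets_subset[OF this]
  show "sigma_sets (ordered_bernoulli_tuples n {0..}) (cylinders n t) \<subseteq> sets (future_algebra n t)" by simp
qed (rule future_algebra_cylinders)

text \<open>The bridge probability is measurable for the future and has the same integral as the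
  indicator over each cylinder; a pi-lambda argument extends this to all future events, which
  characterizes the conditional expectation.\<close>

theorem bernoulli_gibbsI:
  assumes \<mu>: "prob_space \<mu>" "sets \<mu> = sets (ordered_bernoulli_space n)"
    and unif: "\<And>T X X'. X \<in> ordered_bernoulli_tuples n {0..} \<Longrightarrow> X' \<in> ordered_bernoulli_tuples n {0..} \<Longrightarrow>
      (\<And>i. i \<in> {1..n} \<Longrightarrow> X i (real T) = X' i (real T)) \<Longrightarrow>
      measure \<mu> (cylinder n 0 T X) = measure \<mu> (cylinder n 0 T X')"
  shows "bernoulli_gibbs n \<mu>"
  unfolding bernoulli_gibbs_def
proof (intro conjI allI impI ballI \<mu>)
  fix t :: nat and A assume A: "A \<in> sets (tuple_space n {0..real t})"
  interpret prob_space \<mu> by (rule \<mu>(1))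
  let ?\<Omega> = "ordered_bernoulli_tuples n {0..}"
  let ?F = "future_algebra n t"
  have sub: "subalgebra \<mu> ?F" by (rule subalgebra_future_algebra[OF \<mu>(2)])
  interpret F: finite_measure_subalgebra \<mu> ?F by unfold_locales (rule sub)
  have space: "space \<mu> = ?\<Omega>"
    using sets_eq_imp_space_eq[OF \<mu>(2)] space_ordered_bernoulli_space by simp
  have F_sets: "B \<in> sets \<mu>" if "B \<in> sets ?F" for B using sub that by (auto simp: subalgebra_def)
  define E where "E = {X\<in>space \<mu>. restrict_tuple n {0..real t} X \<in> A}"
  define \<gamma> where "\<gamma> X = measure (measure_pmf (bridge_measure n t (\<lambda>i. X i (real t)))) A" for X
  have "restrict_tuple n {0..real t} \<in> \<mu> \<rightarrow>\<^sub>M tuple_space n {0..real t}"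
    using measurable_restrict_tuple[of "{0..real t}" n] measurable_cong_sets[OF \<mu>(2) refl] by auto
  from measurable_sets[OF this A] have E: "E \<in> sets \<mu>"
    unfolding E_def by (simp add: vimage_def Int_def conj_commute)
  have \<gamma>_cyl: "\<gamma> Z = \<gamma> X" if "Z \<in> cylinder n t T X" "t \<le> T" for T X Z
    unfolding \<gamma>_def bridge_measure_def
    using that bridges_cong[of n "\<lambda>i. Z i (real t)" "\<lambda>i. X i (real t)" t] by (simp add: cylinder_def)
  have \<gamma>_F: "\<gamma> \<in> borel_measurable ?F"
  proof (rule measurableI)
    fix S :: "real set"
    have "\<gamma> -` S \<inter> ?\<Omega> \<in> sigma_sets ?\<Omega> (cylinders n t)"
    proof (rule cylinder_union_sigma[OF _ _ order_refl])
      fix X assume "X \<in> \<gamma> -` S \<inter> ?\<Omega>"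
      then show "cylinder n t t X \<subseteq> \<gamma> -` S \<inter> ?\<Omega>"
        using \<gamma>_cyl[of _ t X] cylinder_subset[of n t t X] by auto
    qed auto
    then show "\<gamma> -` S \<inter> space ?F \<in> sets ?F" by (simp only: sets_future_algebra space_future_algebra)
  qed simp
  have \<gamma>_int: "integrable \<mu> \<gamma>"
  proof (rule integrable_const_bound[where B = 1])
    show "\<gamma> \<in> borel_measurable \<mu>" by (rule measurable_from_subalg[OF sub \<gamma>_F])
    show "AE X in \<mu>. norm (\<gamma> X) \<le> 1" unfolding \<gamma>_def by simp
  qed
  have E_int: "integrable \<mu> (indicator E :: _ \<Rightarrow> real)" using E by (simp add: integrable_indicator_iff emeasure_eq_measure)
  \<comment> \<open>Working with the difference turns the equality of integrals into a vanishing
    integral, which is convenient under complements and disjoint unions.\<close>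
  define h where "h X = indicator E X - \<gamma> X" for X
  have h_int: "integrable \<mu> h" unfolding h_def by (intro Bochner_Integration.integrable_diff E_int \<gamma>_int)
  have set_int: "set_integrable \<mu> B f" if "integrable \<mu> f" "B \<in> sets \<mu>" for B and f :: "_ \<Rightarrow> real"
    unfolding set_integrable_def using integrable_mult_indicator[OF that(2,1)] by simp
  have cyl: "(LINT X:cylinder n t T X0|\<mu>. h X) = 0" if "X0 \<in> ?\<Omega>" "t \<le> T" for T X0
  proof -
    let ?B = "cylinder n t T X0"
    have B: "?B \<in> sets \<mu>" by (rule F_sets[OF cylinder_sets_future])
    have "(LINT X:?B|\<mu>. indicator E X) = (LINT X|\<mu>. indicat_real (?B \<inter> E) X)"
      unfolding set_lebesgue_integral_def by (intro Bochner_Integration.integral_cong) (auto simp: indicator_def)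
    also have "\<dots> = measure \<mu> (?B \<inter> E)" using B E by simp
    also have "?B \<inter> E = {W \<in> ?B. restrict_tuple n {0..real t} W \<in> A}"
      using cylinder_subset[of n t T X0] by (auto simp: E_def space)
    also have "measure \<mu> \<dots> = measure \<mu> ?B * \<gamma> X0"
      unfolding \<gamma>_def by (rule measure_cylinder_bridge[OF \<mu> unif that])
    finally have 1: "(LINT X:?B|\<mu>. indicator E X) = measure \<mu> ?B * \<gamma> X0" .
    have "(LINT X:?B|\<mu>. \<gamma> X) = (LINT X|\<mu>. indicat_real ?B X * \<gamma> X0)"
      unfolding set_lebesgue_integral_def using \<gamma>_cyl[OF _ that(2)]
      by (intro Bochner_Integration.integral_cong) (auto simp: indicator_def)
    also have "\<dots> = measure \<mu> ?B * \<gamma> X0" using B by simp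
    finally show ?thesis unfolding h_def
      using 1 by (subst set_integral_diff) (auto intro!: set_int E_int \<gamma>_int B)
  qed
  \<comment> \<open>Complements need the integral over the whole space, which is the disjoint union
    of the finitely many cylinders at the single time \<open>t\<close>.\<close>
  have whole: "(LINT X:?\<Omega>|\<mu>. h X) = 0"
  proof -
    have "?\<Omega> = (\<Union>B\<in>cylinder n t t ` ?\<Omega>. B)"
      using cylinder_self[of _ n t t] cylinder_subset[of n t t] by blast
    then have "(LINT X:?\<Omega>|\<mu>. h X) = (LINT X:(\<Union>B\<in>cylinder n t t ` ?\<Omega>. B)|\<mu>. h X)" by simp
    also have "\<dots> = (\<Sum>B\<in>cylinder n t t ` ?\<Omega>. LINT X:B|\<mu>. h X)"
    proof (rule set_integral_finite_Union[OF finite_cylinders_upto])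
      show "disjoint_family_on (\<lambda>B. B) (cylinder n t t ` ?\<Omega>)"
        unfolding disjoint_family_on_def using cylinder_eq by blast
      show "set_integrable \<mu> B h" "B \<in> sets \<mu>" if "B \<in> cylinder n t t ` ?\<Omega>" for B
        using that F_sets[OF cylinder_sets_future] by (auto intro!: set_int h_int)
    qed
    also have "\<dots> = 0" using cyl by (intro sum.neutral) auto
    finally show ?thesis .
  qed
  have zero: "(LINT X:B|\<mu>. h X) = 0" if "B \<in> sets ?F" for B
    using Int_stable_cylinders cylinders_subset that[unfolded sets_future_algebra]
  proof (induction B rule: sigma_sets_induct_disjoint)
    case (basic B)
    then show ?case using cyl by (auto simp: cylinders_def set_lebesgue_integral_def)
  next
    case empty
    show ?case by (simp add: set_lebesgue_integral_def)
  next
    case (compl B)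
    have B: "B \<in> sets ?F" using compl(1) by (simp add: sets_future_algebra)
    then have "B \<subseteq> ?\<Omega>" using sets.sets_into_space by fastforce
    then have "?\<Omega> = B \<union> (?\<Omega> - B)" by blast
    then have "(LINT X:?\<Omega>|\<mu>. h X) = (LINT X:B \<union> (?\<Omega> - B)|\<mu>. h X)" by simp
    also have "\<dots> = (LINT X:B|\<mu>. h X) + (LINT X:?\<Omega> - B|\<mu>. h X)"
      using F_sets[OF B] sets.top[of \<mu>] unfolding space
      by (intro set_integral_Un set_int h_int) auto
    finally show ?case using whole compl(2) by simp
  next
    case (union B)
    have B: "B i \<in> sets \<mu>" for i using union(2) F_sets by (auto simp: sets_future_algebra)
    have "(LINT X:(\<Union>i. B i)|\<mu>. h X) = (\<Sum>i. LINT X:B i|\<mu>. h X)"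
      using union(1) B by (intro lebesgue_integral_countable_add set_int h_int) (auto simp: disjoint_family_on_def)
    then show ?case using union(3) by simp
  qed
  have "AE X in \<mu>. real_cond_exp \<mu> ?F (indicator E) X = \<gamma> X"
  proof (rule F.real_cond_exp_charact[OF _ E_int \<gamma>_int \<gamma>_F])
    fix B assume B: "B \<in> sets ?F"
    have "(LINT X:B|\<mu>. indicator E X) - (LINT X:B|\<mu>. \<gamma> X) = (LINT X:B|\<mu>. h X)"
      unfolding h_def using F_sets[OF B]
      by (intro set_integral_diff(2)[symmetric] set_int E_int \<gamma>_int)
    then show "(LINT X:B|\<mu>. indicator E X) = (LINT X:B|\<mu>. \<gamma> X)" using zero[OF B] by simp
  qed
  then show "AE X in \<mu>. real_cond_exp \<mu> ?F (indicator {X \<in> space \<mu>. restrict_tuple n {0..real t} X \<in> A}) X =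
      measure (bridge_measure n t (\<lambda>i. X i (real t))) A"
    by (simp only: E_def \<gamma>_def)
qed

context independent_walks
begin

lemma measure_cylinder:
  assumes "X \<in> ordered_bernoulli_tuples n {0..}"
  shows "measure \<mu> (cylinder n 0 T X) = melon_weight (\<lambda>l. bernoulli_weight (d l) T) n T (\<lambda>i. slopes (X i))"
proof -
  have "cylinder n 0 T X \<in> sets (ordered_bernoulli_space n)"
    using cylinder_sets_future[of n 0 T X] subalgebra_future_algebra[OF refl, of n 0] by (auto simp: subalgebra_def)
  then have "measure \<mu> (cylinder n 0 T X) = prob ((\<lambda>\<omega>. melon n (Y \<omega>)) -` cylinder n 0 T X \<inter> space M)"
    unfolding \<mu>_def by (rule measure_distr[OF measurable_melon])
  also have "(\<lambda>\<omega>. melon n (Y \<omega>)) -` cylinder n 0 T X \<inter> space M =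
    {\<omega>\<in>space M. agree n T (slope_melon n (U \<omega>)) (\<lambda>i. slopes (X i))}"
  proof -
    have "melon n (Y \<omega>) \<in> cylinder n 0 T X \<longleftrightarrow> agree n T (slope_melon n (U \<omega>)) (\<lambda>i. slopes (X i))"
      if \<omega>: "\<omega> \<in> space M" for \<omega>
    proof -
      let ?Z = "interp_tuple n (slope_melon n (U \<omega>))"
      have "?Z \<in> cylinder n 0 T X \<longleftrightarrow> agree n T (\<lambda>i. slopes (?Z i)) (\<lambda>i. slopes (X i))"
        unfolding ordered_tuple_agree[OF slope_melon_ordered_tuple assms]
        using slope_melon_ordered_tuple[of n "U \<omega>"] by (auto simp: cylinder_def)
      also have "\<dots> \<longleftrightarrow> agree n T (slope_melon n (U \<omega>)) (\<lambda>i. slopes (X i))"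
        unfolding agree_def by (simp only: slopes_interp_tuple cong: ball_cong)
      finally show ?thesis by (simp only: melon_Y[OF \<omega>])
    qed
    then show ?thesis by auto
  qed
  finally show ?thesis by (simp only: prob_slope_melon)
qed

text \<open>The drifts enter through \<open>bernoulli_weight\<close> alone. For each line this is a
  function of the number of ascents, the form of weight that \<open>melon_weight_endpoint\<close>
  covers.\<close>

lemma gibbs_melon: "bernoulli_gibbs n \<mu>"
proof (rule bernoulli_gibbsI)
  show "prob_space \<mu>" unfolding \<mu>_def by (rule prob_space_distr[OF measurable_melon])
  show "sets \<mu> = sets (ordered_bernoulli_space n)" by (simp add: \<mu>_def)
  fix T X X' assume X: "X \<in> ordered_bernoulli_tuples n {0..}" "X' \<in> ordered_bernoulli_tuples n {0..}"
    and eq: "\<And>i. i \<in> {1..n} \<Longrightarrow> X i (real T) = X' i (real T)"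
  show "measure \<mu> (cylinder n 0 T X) = measure \<mu> (cylinder n 0 T X')"
    unfolding measure_cylinder[OF X(1)] measure_cylinder[OF X(2)]
  proof (rule melon_weight_endpoint)
    show "ordered_slopes n T (\<lambda>i. slopes (X i))" "ordered_slopes n T (\<lambda>i. slopes (X' i))"
      using X by (auto intro: ordered_tuple_slopes)
    fix l assume l: "l \<in> {1..n}"
    have "real (ascent (slopes (X l)) T) = real (ascent (slopes (X' l)) T)"
      using ascent_slopes(1)[OF ordered_tuple_path[OF X(1) l]] ascent_slopes(1)[OF ordered_tuple_path[OF X(2) l]] eq[OF l]
      by simp
    then show "ascent (slopes (X l)) T = ascent (slopes (X' l)) T" by simp
  qed
qed

end

theorem theorem1p5:
  fixes n :: nat and d :: "nat \<Rightarrow> real" and M :: "'a measure"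
    and Y :: "'a \<Rightarrow> nat \<Rightarrow> real \<Rightarrow> real"
  assumes "1 \<le> n"
    and "\<And>i. i \<in> {1..n} \<Longrightarrow> d i \<in> {0..1}"
    and "prob_space M"
    and "\<And>\<omega>. \<omega> \<in> space M \<Longrightarrow> Y \<omega> \<in> cadlag_tuples n"
    and "\<And>i. i \<in> {1..n} \<Longrightarrow> bernoulli_walk M (d i) (\<lambda>\<omega>. Y \<omega> i)"
    and "prob_space.indep_vars M (\<lambda>_. path_space {0..}) (\<lambda>i \<omega>. Y \<omega> i) {1..n}"
  shows "(\<lambda>\<omega>. melon n (Y \<omega>)) \<in> M \<rightarrow>\<^sub>M ordered_bernoulli_space n \<and>
    nonintersecting_bernoulli_walks n (decreasing_rearrangement n d)
      (distr M (ordered_bernoulli_space n) (\<lambda>\<omega>. melon n (Y \<omega>)))"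
proof -
  interpret independent_walks M n d Y
    by (rule independent_walks.intro[OF assms(3)]) (unfold_locales, use assms in auto)
  show ?thesis
    using measurable_melon gibbs_melon melon_rates
    unfolding nonintersecting_bernoulli_walks_def \<mu>_def by blast
qed

end
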